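(* Let $A$ be a finitely generated semigroup (with absorbing element $0$). Let $\mathbb{H}_A$ be the Hall algebra of the category $\mathcal{C}^N_A$ of finite $A$-modules with normal morphisms, and let $\mathfrak{n}_A \subset \mathbb{H}_A$ be the Lie subalgebra (with respect to the commutator bracket $[x,y]=x\star y-y\star x$) spanned by the elements $\delta_{\overline{M}}$ for $M$ an indecomposable $A$-module. Then there is an isomorphism of Hopf algebras $\mathbb{H}_A \simeq \mathbb{U}(\mathfrak{n}_A)$, where $\mathbb{U}(\mathfrak{n}_A)$ is the universal enveloping algebra of $\mathfrak{n}_A$ over $\mathbb{Q}$.
   Context: Semigroups are multiplicative and have an absorbing element $0$ ($0\cdot a=a\cdot 0=0$ for all $a$); a monoid is such a semigroup with an identity $1$. $A$ is finitely generated if there are finitely many elements $a_1,\dots,a_n\in A$ such that every element of $A$ is a word in $a_1,\dots,a_n$. An $A$-module is a pointed set $(M,* )$ with a map $A\times M\to M$ satisfying $(ab)\cdot m=a\cdot(b\cdot m)$ and $0\cdot m=*$ (and $1\cdot m=m$ when $A$ is a monoid). It is finite if the set $M$ is finite, and $\dim M=|M|-1$. Morphisms are pointed maps commuting with the action. The zero module is $\{*\}$. A submodule $N\subset M$ is a pointed subset preserved by $A$, and $M/N=(M\setminus N)\cup\{*\}$ is the module obtained by identifying all elements of $N$ with the basepoint. $M\oplus N$ is the wedge sum (disjoint union with basepoints identified). A nonzero module is indecomposable if it is not isomorphic to $N\oplus L$ with $N,L$ both nonzero. A morphism $f:M\to N$ is normal if every fibre $f^{-1}(n)$ with $n\neq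 *$ has at most one element. $\mathcal{C}^N_A$ is the category of finite $A$-modules with normal morphisms; $\mathrm{Iso}(\mathcal{C}^N_A)$ is the set of its isomorphism classes, and $\overline{M}$ is the class of $M$. The Hall algebra $\mathbb{H}_A$ is the $\mathbb{Q}$-vector space of finitely supported functions $f:\mathrm{Iso}(\mathcal{C}^N_A)\to\mathbb{Q}$, with product $(f\star g)(\overline{M})=\sum_{N\subset M} f(\overline{M/N})\,g(\overline{N})$ (sum over all $A$-submodules $N$ of $M$) and coproduct $\Delta:\mathbb{H}_A\to\mathbb{H}_A\otimes\mathbb{H}_A$, $\Delta(f)(\overline{M},\overline{N})=f(\overline{M\oplus N})$ (elements of $\mathbb{H}_A\otimes\mathbb{H}_A$ being identified with finitely supported functions on pairs of isomorphism classes). The function $\delta_{\overline{M}}$ takes value $1$ on $\overline{M}$ and $0$ elsewhere; the unit is $\delta_{\overline{\{*\}}}$ and the counit is $f\mapsto f(\overline{\{*\}})$. $\mathbb{H}_A$ is graded by $\dim M$ and is a graded connected bialgebra, hence a Hopf algebra. $\mathbb{U}(\mathfrak{n}_A)$ carries its usual Hopf algebra structure, in which elements of $\mathfrak{n}_A$ are primitive. *)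

theory Defs
  imports Complex_Main "HOL-Algebra.QuotRing" "HOL-Algebra.Module" "HOL-Library.Poly_Mapping"
begin

section \<open>Finite modules over a semigroup with absorbing element\<close>

text \<open>
  The semigroup \<open>A\<close> is a type of sort \<open>{semigroup_mult, mult_zero}\<close>: an associative
  multiplication together with an absorbing element \<open>0\<close>.  It is a monoid if it has a two-sided
  identity, and in this case the identity is required to act trivially on modules.
\<close>

inductive_set words :: "'a::semigroup_mult set \<Rightarrow> 'a set" for S where
  letter: "a \<in> S \<Longrightarrow> a \<in> words S"
| prepend: "a \<in> S \<Longrightarrow> b \<in> words S \<Longrightarrow> a * b \<in> words S"

definition finitely_generated :: "'a::semigroup_mult itself \<Rightarrow> bool" where
  "finitely_generated _ \<longleftrightarrow> (\<exists>S :: 'a set. finite S \<and> words S = UNIV)"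

definition is_identity :: "'a::semigroup_mult \<Rightarrow> bool" where
  "is_identity e \<longleftrightarrow> (\<forall>a. e * a = a \<and> a * e = a)"

record ('a, 'm) amod =
  pts :: "'m set"
  bpt :: 'm
  act :: "'a \<Rightarrow> 'm \<Rightarrow> 'm"

definition amodule :: "('a::{semigroup_mult,mult_zero}, 'm) amod \<Rightarrow> bool" where
  "amodule M \<longleftrightarrow> bpt M \<in> pts M \<and>
     (\<forall>a. \<forall>m \<in> pts M. act M a m \<in> pts M) \<and>
     (\<forall>a b. \<forall>m \<in> pts M. act M (a * b) m = act M a (act M b m)) \<and>
     (\<forall>m \<in> pts M. act M 0 m = bpt M) \<and>
     (\<forall>e. is_identity e \<longrightarrow> (\<forall>m \<in> pts M. act M e m = m))"

definition finite_amodule :: "('a::{semigroup_mult,mult_zero}, 'm) amod \<Rightarrow> bool" where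
  "finite_amodule M \<longleftrightarrow> amodule M \<and> finite (pts M)"

definition amod_hom :: "('a, 'm) amod \<Rightarrow> ('a, 'n) amod \<Rightarrow> ('m \<Rightarrow> 'n) set" where
  "amod_hom M N = {f. f ` pts M \<subseteq> pts N \<and> f (bpt M) = bpt N \<and>
     (\<forall>a. \<forall>m \<in> pts M. f (act M a m) = act N a (f m))}"

definition normal_hom :: "('a, 'm) amod \<Rightarrow> ('a, 'n) amod \<Rightarrow> ('m \<Rightarrow> 'n) set" where
  "normal_hom M N = {f \<in> amod_hom M N.
     \<forall>n \<in> pts N. n \<noteq> bpt N \<longrightarrow>
       (\<forall>m \<in> pts M. \<forall>m' \<in> pts M. f m = n \<longrightarrow> f m' = n \<longrightarrow> m = m')}"

definition amod_iso :: "('a, 'm) amod \<Rightarrow> ('a, 'n) amod \<Rightarrow> bool" (infix \<open>\<cong>\<^sub>A\<close> 50) where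
  "M \<cong>\<^sub>A N \<longleftrightarrow> (\<exists>f \<in> normal_hom M N. \<exists>g \<in> normal_hom N M.
     (\<forall>m \<in> pts M. g (f m) = m) \<and> (\<forall>n \<in> pts N. f (g n) = n))"

definition zero_amod :: "('a, nat) amod" where
  "zero_amod = \<lparr>pts = {0}, bpt = 0, act = \<lambda>_ _. 0\<rparr>"

definition subamods :: "('a, 'm) amod \<Rightarrow> 'm set set" where
  "subamods M = {N. N \<subseteq> pts M \<and> bpt M \<in> N \<and> (\<forall>a. \<forall>n \<in> N. act M a n \<in> N)}"

definition quot_amod :: "('a, 'm) amod \<Rightarrow> 'm set \<Rightarrow> ('a, 'm) amod" where
  "quot_amod M N =
     \<lparr>pts = (pts M - N) \<union> {bpt M},
      bpt = bpt M,
      act = \<lambda>a m. if act M a m \<in> N then bpt M else act M a m\<rparr>"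

text \<open>The wedge sum; \<open>Inl (bpt M)\<close> serves as the common base point.\<close>

definition wedge :: "('a, 'm) amod \<Rightarrow> ('a, 'n) amod \<Rightarrow> ('a, 'm + 'n) amod" where
  "wedge M N =
     \<lparr>pts = Inl ` pts M \<union> Inr ` (pts N - {bpt N}),
      bpt = Inl (bpt M),
      act = \<lambda>a x. case x of
          Inl m \<Rightarrow> Inl (act M a m)
        | Inr n \<Rightarrow> if act N a n = bpt N then Inl (bpt M) else Inr (act N a n)\<rparr>"

text \<open>
  If \<open>M\<close> is isomorphic to a wedge sum, then the summands are isomorphic to submodules of \<open>M\<close>.
  So it suffices to let the summands range over modules on the same type of points.
\<close>

definition indecomposable :: "('a::{semigroup_mult,mult_zero}, 'm) amod \<Rightarrow> bool" where
  "indecomposable M \<longleftrightarrow> amodule M \<and> pts M \<noteq> {bpt M} \<and>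
     \<not> (\<exists>(N :: ('a, 'm) amod) (L :: ('a, 'm) amod). amodule N \<and> amodule L \<and>
          pts N \<noteq> {bpt N} \<and> pts L \<noteq> {bpt L} \<and> M \<cong>\<^sub>A wedge N L)"

lemma amod_iso_refl: "M \<cong>\<^sub>A M"
  unfolding amod_iso_def normal_hom_def amod_hom_def by (intro bexI[of _ id]) auto

lemma amod_iso_sym: "M \<cong>\<^sub>A N \<Longrightarrow> N \<cong>\<^sub>A M"
  unfolding amod_iso_def by blast

lemma normal_hom_comp:
  assumes "f \<in> normal_hom M N" "g \<in> normal_hom N L"
  shows "g \<circ> f \<in> normal_hom M L"
  using assms unfolding normal_hom_def amod_hom_def
  by (clarsimp simp: image_subset_iff) metis

lemma amod_iso_trans:
  assumes "M \<cong>\<^sub>A N" "N \<cong>\<^sub>A L"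
  shows "M \<cong>\<^sub>A L"
proof -
  obtain f g where fg: "f \<in> normal_hom M N" "g \<in> normal_hom N M"
    "\<forall>m \<in> pts M. g (f m) = m" "\<forall>n \<in> pts N. f (g n) = n"
    using assms(1) unfolding amod_iso_def by blast
  obtain h k where hk: "h \<in> normal_hom N L" "k \<in> normal_hom L N"
    "\<forall>m \<in> pts N. k (h m) = m" "\<forall>n \<in> pts L. h (k n) = n"
    using assms(2) unfolding amod_iso_def by blast
  have fN: "\<And>m. m \<in> pts M \<Longrightarrow> f m \<in> pts N" and kN: "\<And>n. n \<in> pts L \<Longrightarrow> k n \<in> pts N"
    using fg(1) hk(2) unfolding normal_hom_def amod_hom_def by auto
  have 1: "h \<circ> f \<in> normal_hom M L" by (rule normal_hom_comp[OF fg(1) hk(1)])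
  have 2: "g \<circ> k \<in> normal_hom L M" by (rule normal_hom_comp[OF hk(2) fg(2)])
  have 3: "\<forall>m \<in> pts M. (g \<circ> k) ((h \<circ> f) m) = m" using fN fg(3) hk(3) by simp
  have 4: "\<forall>n \<in> pts L. (h \<circ> f) ((g \<circ> k) n) = n" using kN fg(4) hk(4) by simp
  show ?thesis
    unfolding amod_iso_def by (rule bexI[where x = "h \<circ> f"], rule bexI[where x = "g \<circ> k"]) (rule conjI[OF 3 4], rule 2, rule 1)
qed

lemma finite_amodule_zero:
  "finite_amodule (zero_amod :: ('a::{semigroup_mult,mult_zero}, nat) amod)"
  by (simp add: finite_amodule_def amodule_def zero_amod_def)

text \<open>
  Every finite module is isomorphic to one whose points are natural numbers; \<open>isoclass\<close> below
  uses this to assign a class to finite modules on any type of points.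
\<close>

definition isoclass_rel ::
    "('a::{semigroup_mult,mult_zero}, nat) amod \<Rightarrow> ('a, nat) amod \<Rightarrow> bool" where
  "isoclass_rel M N \<longleftrightarrow> finite_amodule M \<and> finite_amodule N \<and> M \<cong>\<^sub>A N"

quotient_type (overloaded) 'a isoclass =
  "('a::{semigroup_mult,mult_zero}, nat) amod" / partial: isoclass_rel
proof (rule part_equivpI)
  have "isoclass_rel (zero_amod :: ('a, nat) amod) zero_amod"
    by (simp add: isoclass_rel_def finite_amodule_zero amod_iso_refl)
  then show "\<exists>M :: ('a, nat) amod. isoclass_rel M M" ..
  show "symp (isoclass_rel :: ('a, nat) amod \<Rightarrow> _)"
  proof (rule sympI)
    fix M N :: "('a, nat) amod"
    assume "isoclass_rel M N"
    then show "isoclass_rel N M"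
      by (simp add: isoclass_rel_def amod_iso_sym)
  qed
  show "transp (isoclass_rel :: ('a, nat) amod \<Rightarrow> _)"
  proof (rule transpI)
    fix M N L :: "('a, nat) amod"
    assume "isoclass_rel M N" "isoclass_rel N L"
    then show "isoclass_rel M L"
      using amod_iso_trans[of M N L] by (simp add: isoclass_rel_def)
  qed
qed

definition isoclass :: "('a::{semigroup_mult,mult_zero}, 'm) amod \<Rightarrow> 'a isoclass" where
  "isoclass M = abs_isoclass (SOME N. finite_amodule N \<and> N \<cong>\<^sub>A M)"


section \<open>Algebras and tensor products over the rationals\<close>

definition QQ :: "(rat, rat) module" where
  "QQ = \<lparr>carrier = UNIV, mult = (*), one = 1, zero = 0, add = (+), smult = (*)\<rparr>"

definition Q_span :: "(rat, 'v, 'c) module_scheme \<Rightarrow> 'v set \<Rightarrow> 'v set" where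
  "Q_span V X = \<Inter>{H. submodule H QQ V \<and> X \<subseteq> H}"

definition Q_linear ::
    "(rat, 'v, 'c) module_scheme \<Rightarrow> (rat, 'w, 'd) module_scheme \<Rightarrow> ('v \<Rightarrow> 'w) set" where
  "Q_linear V W = {f. f \<in> carrier V \<rightarrow> carrier W \<and>
     (\<forall>x \<in> carrier V. \<forall>y \<in> carrier V. f (x \<oplus>\<^bsub>V\<^esub> y) = f x \<oplus>\<^bsub>W\<^esub> f y) \<and>
     (\<forall>c. \<forall>x \<in> carrier V. f (c \<odot>\<^bsub>V\<^esub> x) = c \<odot>\<^bsub>W\<^esub> f x)}"

definition Q_algebra :: "(rat, 'v, 'c) module_scheme \<Rightarrow> bool" where
  "Q_algebra B \<longleftrightarrow> ring B \<and> module QQ B \<and>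
     (\<forall>c. \<forall>x \<in> carrier B. \<forall>y \<in> carrier B.
        (c \<odot>\<^bsub>B\<^esub> x) \<otimes>\<^bsub>B\<^esub> y = c \<odot>\<^bsub>B\<^esub> (x \<otimes>\<^bsub>B\<^esub> y) \<and>
        x \<otimes>\<^bsub>B\<^esub> (c \<odot>\<^bsub>B\<^esub> y) = c \<odot>\<^bsub>B\<^esub> (x \<otimes>\<^bsub>B\<^esub> y))"

text \<open>
  \<open>V \<otimes> W\<close> is the free vector space on \<open>carrier V \<times> carrier W\<close> modulo the bilinear relations; its
  elements are cosets of formal linear combinations of pairs.  The fields \<open>mult\<close> and \<open>one\<close> of
  \<open>free_space\<close> and of \<open>tensor_space\<close> are not used.
\<close>

definition free_space :: "'s set \<Rightarrow> (rat, 's \<Rightarrow>\<^sub>0 rat) module" where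
  "free_space G =
     \<lparr>carrier = {t. Poly_Mapping.keys t \<subseteq> G}, mult = undefined, one = undefined,
      zero = 0, add = (+), smult = (\<lambda>c. Poly_Mapping.map ((*) c))\<rparr>"

definition tensor_null ::
    "(rat, 'v, 'c) module_scheme \<Rightarrow> (rat, 'w, 'd) module_scheme \<Rightarrow> ('v \<times> 'w \<Rightarrow>\<^sub>0 rat) set" where
  "tensor_null V W = Q_span (free_space (carrier V \<times> carrier W))
     ({Poly_Mapping.single (x \<oplus>\<^bsub>V\<^esub> x', y) 1 - Poly_Mapping.single (x, y) 1
         - Poly_Mapping.single (x', y) 1
         | x x' y. x \<in> carrier V \<and> x' \<in> carrier V \<and> y \<in> carrier W} \<union>
      {Poly_Mapping.single (x, y \<oplus>\<^bsub>W\<^esub> y') 1 - Poly_Mapping.single (x, y) 1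
         - Poly_Mapping.single (x, y') 1
         | x y y'. x \<in> carrier V \<and> y \<in> carrier W \<and> y' \<in> carrier W} \<union>
      {Poly_Mapping.single (c \<odot>\<^bsub>V\<^esub> x, y) 1 - Poly_Mapping.single (x, y) c
         | c x y. x \<in> carrier V \<and> y \<in> carrier W} \<union>
      {Poly_Mapping.single (x, c \<odot>\<^bsub>W\<^esub> y) 1 - Poly_Mapping.single (x, y) c
         | c x y. x \<in> carrier V \<and> y \<in> carrier W})"

definition tensor_space ::
    "(rat, 'v, 'c) module_scheme \<Rightarrow> (rat, 'w, 'd) module_scheme
       \<Rightarrow> (rat, ('v \<times> 'w \<Rightarrow>\<^sub>0 rat) set) module" where
  "tensor_space V W = (let F = free_space (carrier V \<times> carrier W); K = tensor_null V W in
     \<lparr>carrier = a_rcosets\<^bsub>F\<^esub> K, mult = undefined, one = undefined,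
      zero = K, add = set_add F, smult = (\<lambda>c T. \<Union>t\<in>T. K +>\<^bsub>F\<^esub> (c \<odot>\<^bsub>F\<^esub> t))\<rparr>)"

definition tens ::
    "(rat, 'v, 'c) module_scheme \<Rightarrow> (rat, 'w, 'd) module_scheme
       \<Rightarrow> 'v \<Rightarrow> 'w \<Rightarrow> ('v \<times> 'w \<Rightarrow>\<^sub>0 rat) set" where
  "tens V W x y =
     tensor_null V W +>\<^bsub>free_space (carrier V \<times> carrier W)\<^esub> Poly_Mapping.single (x, y) 1"

text \<open>
  The linear map out of a tensor product induced by a bilinear map \<open>\<beta>\<close> with values in \<open>Z\<close>: the
  common value of \<open>\<beta>\<close>, extended linearly, on all formal representatives of \<open>T\<close>.
\<close>

definition tensor_lift ::
    "(rat, 'z, 'c) module_scheme \<Rightarrow> ('v \<Rightarrow> 'w \<Rightarrow> 'z) \<Rightarrow> ('v \<times> 'w \<Rightarrow>\<^sub>0 rat) set \<Rightarrow> 'z" where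
  "tensor_lift Z \<beta> T = the_elem
     ((\<lambda>t. \<Oplus>\<^bsub>Z\<^esub>p\<in>Poly_Mapping.keys t.
              Poly_Mapping.lookup t p \<odot>\<^bsub>Z\<^esub> \<beta> (fst p) (snd p)) ` T)"

text \<open>For algebras: \<open>(a \<otimes> b) (c \<otimes> d) = a c \<otimes> b d\<close>.\<close>

definition tensor ::
    "(rat, 'v, 'c) module_scheme \<Rightarrow> (rat, 'w, 'd) module_scheme
       \<Rightarrow> (rat, ('v \<times> 'w \<Rightarrow>\<^sub>0 rat) set) module" where
  "tensor V W = (let P = tensor_space V W in
     P\<lparr>mult := \<lambda>S T. tensor_lift P (\<lambda>a b.
                 tensor_lift P (\<lambda>c d. tens V W (a \<otimes>\<^bsub>V\<^esub> c) (b \<otimes>\<^bsub>W\<^esub> d)) T) S,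
       one := tens V W \<one>\<^bsub>V\<^esub> \<one>\<^bsub>W\<^esub>\<rparr>)"

definition tensor_map ::
    "(rat, 'v, 'c) module_scheme \<Rightarrow> (rat, 'w, 'd) module_scheme
       \<Rightarrow> ('s \<Rightarrow> 'v) \<Rightarrow> ('t \<Rightarrow> 'w) \<Rightarrow> ('s \<times> 't \<Rightarrow>\<^sub>0 rat) set \<Rightarrow> ('v \<times> 'w \<Rightarrow>\<^sub>0 rat) set" where
  "tensor_map V W f g = tensor_lift (tensor V W) (\<lambda>a b. tens V W (f a) (g b))"

text \<open>The associativity isomorphism \<open>(B \<otimes> B) \<otimes> B \<rightarrow> B \<otimes> (B \<otimes> B)\<close>.\<close>

definition tensor_assoc ::
    "(rat, 'v, 'c) module_scheme
       \<Rightarrow> (('v \<times> 'v \<Rightarrow>\<^sub>0 rat) set \<times> 'v \<Rightarrow>\<^sub>0 rat) set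
       \<Rightarrow> ('v \<times> ('v \<times> 'v \<Rightarrow>\<^sub>0 rat) set \<Rightarrow>\<^sub>0 rat) set" where
  "tensor_assoc B = (let P = tensor B (tensor B B) in
     tensor_lift P (\<lambda>T c. tensor_lift P (\<lambda>a b. tens B (tensor B B) a (tens B B b c)) T))"


section \<open>Hopf algebras\<close>

record 'v bialg = "(rat, 'v) module" +
  comult :: "'v \<Rightarrow> ('v \<times> 'v \<Rightarrow>\<^sub>0 rat) set"
  counit :: "'v \<Rightarrow> rat"

definition bialgebra :: "('v, 'c) bialg_scheme \<Rightarrow> bool" where
  "bialgebra B \<longleftrightarrow> Q_algebra B \<and>
     comult B \<in> Q_linear B (tensor B B) \<and> counit B \<in> Q_linear B QQ \<and>
     (\<forall>x \<in> carrier B.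
        tensor_assoc B (tensor_map (tensor B B) B (comult B) (\<lambda>b. b) (comult B x)) =
        tensor_map B (tensor B B) (\<lambda>a. a) (comult B) (comult B x)) \<and>
     (\<forall>x \<in> carrier B. tensor_lift B (\<lambda>a b. counit B a \<odot>\<^bsub>B\<^esub> b) (comult B x) = x) \<and>
     (\<forall>x \<in> carrier B. tensor_lift B (\<lambda>a b. counit B b \<odot>\<^bsub>B\<^esub> a) (comult B x) = x) \<and>
     comult B \<in> ring_hom B (tensor B B) \<and> counit B \<in> ring_hom B QQ"

definition antipode :: "('v, 'c) bialg_scheme \<Rightarrow> ('v \<Rightarrow> 'v) \<Rightarrow> bool" where
  "antipode B S \<longleftrightarrow> S \<in> Q_linear B B \<and>
     (\<forall>x \<in> carrier B.
        tensor_lift B (\<lambda>a b. S a \<otimes>\<^bsub>B\<^esub> b) (comult B x) = counit B x \<odot>\<^bsub>B\<^esub> \<one>\<^bsub>B\<^esub> \<and>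
        tensor_lift B (\<lambda>a b. a \<otimes>\<^bsub>B\<^esub> S b) (comult B x) = counit B x \<odot>\<^bsub>B\<^esub> \<one>\<^bsub>B\<^esub>)"

definition hopf_algebra :: "('v, 'c) bialg_scheme \<Rightarrow> bool" where
  "hopf_algebra B \<longleftrightarrow> bialgebra B \<and> (\<exists>S. antipode B S)"

definition hopf_iso :: "('v, 'c) bialg_scheme \<Rightarrow> ('w, 'd) bialg_scheme \<Rightarrow> ('v \<Rightarrow> 'w) set" where
  "hopf_iso B C = {\<phi>. bij_betw \<phi> (carrier B) (carrier C) \<and>
     \<phi> \<in> Q_linear B C \<and> \<phi> \<in> ring_hom B C \<and>
     (\<forall>x \<in> carrier B. tensor_map C C \<phi> \<phi> (comult B x) = comult C (\<phi> x)) \<and>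
     (\<forall>x \<in> carrier B. counit C (\<phi> x) = counit B x) \<and>
     (\<forall>S T. antipode B S \<longrightarrow> antipode C T \<longrightarrow> (\<forall>x \<in> carrier B. \<phi> (S x) = T (\<phi> x)))}"

definition commutator :: "('v, 'c) ring_scheme \<Rightarrow> 'v \<Rightarrow> 'v \<Rightarrow> 'v" where
  "commutator B x y = (x \<otimes>\<^bsub>B\<^esub> y) \<ominus>\<^bsub>B\<^esub> (y \<otimes>\<^bsub>B\<^esub> x)"

definition lie_subalgebra :: "'v set \<Rightarrow> (rat, 'v, 'c) module_scheme \<Rightarrow> bool" where
  "lie_subalgebra L B \<longleftrightarrow>
     submodule L QQ B \<and> (\<forall>x \<in> L. \<forall>y \<in> L. commutator B x y \<in> L)"


section \<open>Universal enveloping algebras\<close>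

datatype 'g word = Word (letters: "'g list")

instantiation word :: (type) monoid_add
begin

definition "0 = Word []"

definition "v + w = Word (letters v @ letters w)"

instance
  by standard (simp_all add: zero_word_def plus_word_def)

end

text \<open>
  The free associative unital algebra on the set \<open>G\<close>: the product of \<open>\<Rightarrow>\<^sub>0\<close> is convolution, hence
  concatenation of words.
\<close>

definition free_algebra :: "'g set \<Rightarrow> (rat, 'g word \<Rightarrow>\<^sub>0 rat) module" where
  "free_algebra G =
     \<lparr>carrier = {t. \<forall>w \<in> Poly_Mapping.keys t. set (letters w) \<subseteq> G}, mult = (*), one = 1,
      zero = 0, add = (+), smult = (\<lambda>c. Poly_Mapping.map ((*) c))\<rparr>"

definition gen :: "'g \<Rightarrow> 'g word \<Rightarrow>\<^sub>0 rat" where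
  "gen x = Poly_Mapping.single (Word [x]) 1"

text \<open>
  Let \<open>g\<close> be a rational vector space with Lie bracket \<open>br\<close>.  The first two families of relations
  turn the free algebra on the set \<open>carrier g\<close> into the tensor algebra \<open>T(g)\<close>, and the third one
  turns \<open>T(g)\<close> into \<open>U(g)\<close>.
\<close>

definition env_ideal ::
    "(rat, 'g, 'c) module_scheme \<Rightarrow> ('g \<Rightarrow> 'g \<Rightarrow> 'g) \<Rightarrow> ('g word \<Rightarrow>\<^sub>0 rat) set" where
  "env_ideal g br = Idl\<^bsub>free_algebra (carrier g)\<^esub>
     ({gen (x \<oplus>\<^bsub>g\<^esub> y) - gen x - gen y | x y. x \<in> carrier g \<and> y \<in> carrier g} \<union>
      {gen (c \<odot>\<^bsub>g\<^esub> x) - Poly_Mapping.map ((*) c) (gen x) | c x. x \<in> carrier g} \<union>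
      {gen x * gen y - gen y * gen x - gen (br x y) | x y. x \<in> carrier g \<and> y \<in> carrier g})"

definition env_algebra ::
    "(rat, 'g, 'c) module_scheme \<Rightarrow> ('g \<Rightarrow> 'g \<Rightarrow> 'g)
       \<Rightarrow> (rat, ('g word \<Rightarrow>\<^sub>0 rat) set) module" where
  "env_algebra g br = (let F = free_algebra (carrier g); I = env_ideal g br in
     ring.extend (F Quot I)
       \<lparr>smult = (\<lambda>c X. \<Union>x\<in>X. I +>\<^bsub>F\<^esub> (c \<odot>\<^bsub>F\<^esub> x))\<rparr>)"

definition env_incl ::
    "(rat, 'g, 'c) module_scheme \<Rightarrow> ('g \<Rightarrow> 'g \<Rightarrow> 'g) \<Rightarrow> 'g \<Rightarrow> ('g word \<Rightarrow>\<^sub>0 rat) set" where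
  "env_incl g br x = env_ideal g br +>\<^bsub>free_algebra (carrier g)\<^esub> gen x"

text \<open>
  The algebra homomorphism from \<open>U(g)\<close> to \<open>Z\<close> induced by a Lie algebra homomorphism \<open>j\<close> from \<open>g\<close>
  to \<open>Z\<close>: the common value, on all representatives of \<open>X\<close> in the free algebra, of the
  multiplicative extension of \<open>j\<close>.
\<close>

definition env_lift ::
    "(rat, 'z, 'c) module_scheme \<Rightarrow> ('g \<Rightarrow> 'z) \<Rightarrow> ('g word \<Rightarrow>\<^sub>0 rat) set \<Rightarrow> 'z" where
  "env_lift Z j X = the_elem
     ((\<lambda>t. \<Oplus>\<^bsub>Z\<^esub>w\<in>Poly_Mapping.keys t. Poly_Mapping.lookup t w \<odot>\<^bsub>Z\<^esub>
              foldr (\<lambda>x z. j x \<otimes>\<^bsub>Z\<^esub> z) (letters w) \<one>\<^bsub>Z\<^esub>) ` X)"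

definition enveloping ::
    "(rat, 'g, 'c) module_scheme \<Rightarrow> ('g \<Rightarrow> 'g \<Rightarrow> 'g) \<Rightarrow> ('g word \<Rightarrow>\<^sub>0 rat) set bialg" where
  "enveloping g br = (let U = env_algebra g br; \<iota> = env_incl g br in
     module.extend U
       \<lparr>comult = env_lift (tensor U U)
          (\<lambda>x. tens U U (\<iota> x) \<one>\<^bsub>U\<^esub> \<oplus>\<^bsub>tensor U U\<^esub> tens U U \<one>\<^bsub>U\<^esub> (\<iota> x)),
        counit = env_lift QQ (\<lambda>_. 0)\<rparr>)"


section \<open>The Hall algebra\<close>

definition delta :: "'i \<Rightarrow> 'i \<Rightarrow> rat" where
  "delta X = (\<lambda>Y. if Y = X then 1 else 0)"

text \<open>
  The product of two finitely supported functions is finitely supported if \<open>'a\<close> is finitely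
  generated, since there are then only finitely many modules of each finite dimension.
\<close>

definition hall_algebra ::
    "(rat, 'a::{semigroup_mult,mult_zero} isoclass \<Rightarrow> rat) module" where
  "hall_algebra =
     \<lparr>carrier = {f. finite {X. f X \<noteq> 0}},
      mult = (\<lambda>f g X. let M = rep_isoclass X in
                \<Sum>N\<in>subamods M. f (isoclass (quot_amod M N)) * g (isoclass (M\<lparr>pts := N\<rparr>))),
      one = delta (isoclass zero_amod),
      zero = (\<lambda>_. 0),
      add = (\<lambda>f g X. f X + g X),
      smult = (\<lambda>c f X. c * f X)\<rparr>"

text \<open>A finitely supported function on pairs of classes, as an element of the tensor product.\<close>

definition pairs_to_tensor ::
    "('a::{semigroup_mult,mult_zero} isoclass \<times> 'a isoclass \<Rightarrow> rat)
       \<Rightarrow> (('a isoclass \<Rightarrow> rat) \<times> ('a isoclass \<Rightarrow> rat) \<Rightarrow>\<^sub>0 rat) set" where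
  "pairs_to_tensor F = (let T = tensor hall_algebra hall_algebra in
     \<Oplus>\<^bsub>T\<^esub>p\<in>{p. F p \<noteq> 0}.
        F p \<odot>\<^bsub>T\<^esub> tens hall_algebra hall_algebra (delta (fst p)) (delta (snd p)))"

definition hall :: "('a::{semigroup_mult,mult_zero} isoclass \<Rightarrow> rat) bialg" where
  "hall = module.extend hall_algebra
     \<lparr>comult = (\<lambda>f. pairs_to_tensor
          (\<lambda>(X, Y). f (isoclass (wedge (rep_isoclass X) (rep_isoclass Y))))),
      counit = (\<lambda>f. f (isoclass zero_amod))\<rparr>"

definition hall_lie :: "('a::{semigroup_mult,mult_zero} isoclass \<Rightarrow> rat) set" where
  "hall_lie = Q_span hall
     {delta (isoclass M) | M :: ('a, nat) amod. finite_amodule M \<and> indecomposable M}"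

end

theory Submission
  imports Defs "HOL-Library.Multiset"
begin

text \<open>
  The proof compares the Hall algebra \<open>H\<close> with the enveloping algebra \<open>U\<close> of its Lie algebra of
  primitive elements; the combinatorics of wedge sums gives directly that the canonical map from \<open>U\<close>
  to \<open>H\<close> is bijective.

  Isomorphism classes form a commutative monoid under the wedge sum, graded by dimension, and the
  coproduct of \<open>H\<close> is \<open>\<Delta> f (X, Y) = f (X + Y)\<close>.  The submodules of a wedge sum are the wedge sums of
  submodules (\<open>hmul_wedge\<close>), so \<open>\<Delta>\<close> is multiplicative and \<open>H\<close> is a bialgebra (\<open>bialgebra_hall\<close>).  Since
  \<open>A\<close> is finitely generated, there are finitely many classes of bounded dimension, and so products and
  coproducts are finitely supported.  The primitive elements of \<open>H\<close> are the combinations of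
  indecomposable classes (\<open>hall_lie_eq\<close>); they form the Lie algebra in question.

  A product of \<open>k\<close> primitive elements has an explicit iterated coproduct.  It follows that the product
  of \<open>k\<close> indecomposable classes is nonnegative, vanishes at all sums of more than \<open>k\<close> indecomposable
  classes, and at sums of exactly \<open>k\<close> of them is nonzero only if the summands are the factors
  (\<open>hall_word_nonzero_iff\<close>).  So the product of the summands of \<open>X\<close> is a nonzero multiple of \<open>X\<close> plus classes
  with fewer summands, and the canonical map from \<open>U\<close> to \<open>H\<close> is surjective (\<open>delta_in_image\<close>).  In \<open>U\<close>
  the order of the factors does not matter modulo shorter products (\<open>uword_mset\<close>); hence the leading part
  of an element of \<open>U\<close> is a combination of multisets of indecomposable classes, whose coefficients can be
  read off from the image in \<open>H\<close>, and the map is injective (\<open>hall_map_kernel_step\<close>).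

  The rest is general.  The map respects coproducts and counits, because it does so on the Lie algebra.
  The bialgebra axioms pass from \<open>H\<close> to \<open>U\<close>.  The map \<open>x \<mapsto> - x\<close> extends to an antipode of \<open>U\<close>
  (\<open>antipode_enveloping\<close>), which passes to \<open>H\<close>.  Antipodes are unique (\<open>antipode_unique\<close>), and so an
  isomorphism of bialgebras respects them.
\<close>

section \<open>Linear algebra over the rationals\<close>

lemma QQ_simps [simp]:
  "carrier QQ = UNIV" "monoid.mult QQ = (*)" "one QQ = 1" "zero QQ = 0" "add QQ = (+)" "smult QQ = (*)"
  by (simp_all add: QQ_def)

lemma abelian_group_QQ: "abelian_group QQ"
proof (rule abelian_groupI)
  show "\<exists>y\<in>carrier QQ. y \<oplus>\<^bsub>QQ\<^esub> x = \<zero>\<^bsub>QQ\<^esub>" for x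
    by (rule bexI[of _ "- x"]) simp_all
qed simp_all

lemma cring_QQ: "cring QQ"
  by (rule cringI[OF abelian_group_QQ]) (auto intro!: comm_monoidI simp: algebra_simps)

lemma module_QQ: "module QQ QQ"
  by (rule moduleI[OF cring_QQ abelian_group_QQ]) (auto simp: algebra_simps)

locale Q_space =
  fixes V :: "(rat, 'v, 'c) module_scheme" (structure)
  assumes is_module: "module QQ V"
begin

sublocale abelian_group V
  using is_module by (simp add: module_def)

lemma smult_closed [simp, intro]: "x \<in> carrier V \<Longrightarrow> c \<odot> x \<in> carrier V"
  using module.smult_closed[OF is_module] by simp

lemma smult_l_distr: "x \<in> carrier V \<Longrightarrow> (c + d) \<odot> x = c \<odot> x \<oplus> d \<odot> x"
  using module.smult_l_distr[OF is_module] by simp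

lemma smult_r_distr:
  "x \<in> carrier V \<Longrightarrow> y \<in> carrier V \<Longrightarrow> c \<odot> (x \<oplus> y) = c \<odot> x \<oplus> c \<odot> y"
  using module.smult_r_distr[OF is_module] by simp

lemma smult_assoc: "x \<in> carrier V \<Longrightarrow> (c * d) \<odot> x = c \<odot> (d \<odot> x)"
  using module.smult_assoc1[OF is_module] by simp

lemma smult_one [simp]: "x \<in> carrier V \<Longrightarrow> 1 \<odot> x = x"
  using module.smult_one[OF is_module] by simp

lemma smult_zero_left [simp]: "x \<in> carrier V \<Longrightarrow> 0 \<odot> x = \<zero>"
  using module.smult_l_null[OF is_module] by simp

lemma smult_zero_right [simp]: "c \<odot> \<zero> = \<zero>"
  using module.smult_r_null[OF is_module] by simp

lemma smult_minus_one: "x \<in> carrier V \<Longrightarrow> (-1) \<odot> x = \<ominus> x"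
proof -
  assume x: "x \<in> carrier V"
  have "(-1) \<odot> x \<oplus> x = ((-1) + 1) \<odot> x"
    using x by (simp only: smult_l_distr smult_one)
  then show ?thesis
    using x by (simp add: minus_equality)
qed

lemma smult_neg: "x \<in> carrier V \<Longrightarrow> (- c) \<odot> x = \<ominus> (c \<odot> x)"
  using smult_minus_one[of "c \<odot> x"] smult_assoc[of x "-1" c] by simp

lemma smult_minus_right: "x \<in> carrier V \<Longrightarrow> c \<odot> (\<ominus> x) = \<ominus> (c \<odot> x)"
  using smult_minus_one[of x] smult_assoc[of x c "-1"] smult_neg[of x c] by simp

lemma submoduleI:
  assumes "H \<subseteq> carrier V" "\<zero> \<in> H" "\<And>a b. a \<in> H \<Longrightarrow> b \<in> H \<Longrightarrow> a \<oplus> b \<in> H"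
    and sm: "\<And>c x. x \<in> H \<Longrightarrow> c \<odot> x \<in> H"
  shows "submodule H QQ V"
proof (rule module.submoduleI[OF is_module])
  show "\<ominus> a \<in> H" if "a \<in> H" for a
    using sm[OF that, of "-1"] that assms(1) by (auto simp: smult_minus_one)
qed (use assms in auto)

lemma submoduleD:
  assumes "submodule H QQ V"
  shows "H \<subseteq> carrier V" "\<zero> \<in> H" "\<And>a b. a \<in> H \<Longrightarrow> b \<in> H \<Longrightarrow> a \<oplus> b \<in> H"
    "\<And>c x. x \<in> H \<Longrightarrow> c \<odot> x \<in> H" "\<And>a. a \<in> H \<Longrightarrow> \<ominus> a \<in> H"
    "\<And>a b. a \<in> H \<Longrightarrow> b \<in> H \<Longrightarrow> a \<ominus> b \<in> H"
proof -
  note E = module.submoduleE[OF is_module assms]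
  show "H \<subseteq> carrier V" "\<And>a b. a \<in> H \<Longrightarrow> b \<in> H \<Longrightarrow> a \<oplus> b \<in> H"
    "\<And>a. a \<in> H \<Longrightarrow> \<ominus> a \<in> H"
    "\<And>a b. a \<in> H \<Longrightarrow> b \<in> H \<Longrightarrow> a \<ominus> b \<in> H"
    using E by (auto simp: a_minus_def)
  show "\<And>c x. x \<in> H \<Longrightarrow> c \<odot> x \<in> H"
    using E(4) by simp
  show "\<zero> \<in> H"
    using subgroup.one_closed[OF submodule.axioms(1)[OF assms]] by simp
qed

lemma Q_span_submodule:
  assumes "X \<subseteq> carrier V"
  shows "submodule (Q_span V X) QQ V"
proof (rule submoduleI)
  have "submodule (carrier V) QQ V"
    by (rule submoduleI) auto
  then show "Q_span V X \<subseteq> carrier V"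
    using assms by (auto simp: Q_span_def)
qed (auto simp: Q_span_def dest: submoduleD)

lemma Q_span_superset: "X \<subseteq> Q_span V X"
  by (auto simp: Q_span_def)

lemma Q_span_least: "submodule H QQ V \<Longrightarrow> X \<subseteq> H \<Longrightarrow> Q_span V X \<subseteq> H"
  by (auto simp: Q_span_def)

lemma Q_span_mono: "X \<subseteq> Y \<Longrightarrow> Q_span V X \<subseteq> Q_span V Y"
  by (auto simp: Q_span_def)

lemma Q_span_induct [consumes 2, case_names zero add smult gen]:
  assumes x: "x \<in> Q_span V X" and X: "X \<subseteq> carrier V"
    and "P \<zero>"
    and "\<And>x y. x \<in> Q_span V X \<Longrightarrow> y \<in> Q_span V X \<Longrightarrow> P x \<Longrightarrow> P y \<Longrightarrow> P (x \<oplus> y)"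
    and "\<And>c x. x \<in> Q_span V X \<Longrightarrow> P x \<Longrightarrow> P (c \<odot> x)"
    and "\<And>x. x \<in> X \<Longrightarrow> P x"
  shows "P x"
proof -
  note S = submoduleD[OF Q_span_submodule[OF X]]
  have "Q_span V X \<subseteq> {x \<in> Q_span V X. P x}"
    by (rule Q_span_least, rule submoduleI)
      (use assms S Q_span_superset[of X] in auto)
  then show ?thesis
    using x by auto
qed

lemma minus_add_cancel:
  "x \<in> carrier V \<Longrightarrow> y \<in> carrier V \<Longrightarrow> z \<in> carrier V \<Longrightarrow> (x \<ominus> y) \<oplus> (y \<ominus> z) = x \<ominus> z"
  by (simp add: a_minus_def a_assoc r_neg1)

lemma minus_eq_zero_iff:
  "x \<in> carrier V \<Longrightarrow> y \<in> carrier V \<Longrightarrow> x \<ominus> y = \<zero> \<longleftrightarrow> x = y"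
  by (metis a_minus_def minus_equality minus_minus r_neg a_inv_closed)

lemma minus_self: "x \<in> carrier V \<Longrightarrow> x \<ominus> x = \<zero>"
  by (simp add: minus_eq_zero_iff)

lemma add_minus_add:
  "x \<in> carrier V \<Longrightarrow> y \<in> carrier V \<Longrightarrow> x' \<in> carrier V \<Longrightarrow> y' \<in> carrier V \<Longrightarrow>
    (x \<oplus> x') \<ominus> (y \<oplus> y') = (x \<ominus> y) \<oplus> (x' \<ominus> y')"
  by (simp add: a_minus_def a_ac minus_add)

lemma smult_minus:
  "x \<in> carrier V \<Longrightarrow> y \<in> carrier V \<Longrightarrow> c \<odot> (x \<ominus> y) = c \<odot> x \<ominus> c \<odot> y"
  by (simp add: a_minus_def smult_r_distr smult_minus_right)

end

subsection \<open>Linear maps\<close>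

lemma Q_linearI:
  assumes "\<And>x. x \<in> carrier V \<Longrightarrow> f x \<in> carrier W"
    and "\<And>x y. x \<in> carrier V \<Longrightarrow> y \<in> carrier V \<Longrightarrow> f (x \<oplus>\<^bsub>V\<^esub> y) = f x \<oplus>\<^bsub>W\<^esub> f y"
    and "\<And>c x. x \<in> carrier V \<Longrightarrow> f (c \<odot>\<^bsub>V\<^esub> x) = c \<odot>\<^bsub>W\<^esub> f x"
  shows "f \<in> Q_linear V W"
  using assms by (auto simp: Q_linear_def)

lemma
  assumes "f \<in> Q_linear V W"
  shows Q_linear_closed: "x \<in> carrier V \<Longrightarrow> f x \<in> carrier W"
    and Q_linear_add: "x \<in> carrier V \<Longrightarrow> y \<in> carrier V \<Longrightarrow> f (x \<oplus>\<^bsub>V\<^esub> y) = f x \<oplus>\<^bsub>W\<^esub> f y"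
    and Q_linear_smult: "x \<in> carrier V \<Longrightarrow> f (c \<odot>\<^bsub>V\<^esub> x) = c \<odot>\<^bsub>W\<^esub> f x"
  using assms by (auto simp: Q_linear_def)

lemma Q_linear_zero:
  assumes "Q_space V" "Q_space W" "f \<in> Q_linear V W"
  shows "f \<zero>\<^bsub>V\<^esub> = \<zero>\<^bsub>W\<^esub>"
proof -
  interpret V: Q_space V by fact
  interpret W: Q_space W by fact
  show ?thesis
    using Q_linear_smult[OF assms(3), of "\<zero>\<^bsub>V\<^esub>" 0] Q_linear_closed[OF assms(3), of "\<zero>\<^bsub>V\<^esub>"] by simp
qed

lemma Q_linear_minus:
  assumes "Q_space V" "Q_space W" "f \<in> Q_linear V W" "x \<in> carrier V" "y \<in> carrier V"
  shows "f (\<ominus>\<^bsub>V\<^esub> x) = \<ominus>\<^bsub>W\<^esub> f x" "f (x \<ominus>\<^bsub>V\<^esub> y) = f x \<ominus>\<^bsub>W\<^esub> f y"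
proof -
  interpret V: Q_space V by fact
  interpret W: Q_space W by fact
  note f = Q_linear_closed[OF assms(3)] Q_linear_add[OF assms(3)] Q_linear_smult[OF assms(3)]
  have *: "f (\<ominus>\<^bsub>V\<^esub> x) = \<ominus>\<^bsub>W\<^esub> f x" if "x \<in> carrier V" for x
    using f(3)[OF that, of "-1"] that by (simp add: V.smult_minus_one W.smult_minus_one f)
  show "f (\<ominus>\<^bsub>V\<^esub> x) = \<ominus>\<^bsub>W\<^esub> f x" "f (x \<ominus>\<^bsub>V\<^esub> y) = f x \<ominus>\<^bsub>W\<^esub> f y"
    using assms by (simp_all add: * a_minus_def f)
qed

lemma Q_linear_comp:
  "f \<in> Q_linear V W \<Longrightarrow> g \<in> Q_linear W Z \<Longrightarrow> (\<lambda>x. g (f x)) \<in> Q_linear V Z"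
  by (auto simp: Q_linear_def Pi_iff)

lemma Q_linear_id: "(\<lambda>x. x) \<in> Q_linear V V"
  by (auto simp: Q_linear_def)

lemma Q_linear_cong:
  assumes "Q_space V" "\<And>x. x \<in> carrier V \<Longrightarrow> f x = g x"
  shows "f \<in> Q_linear V W \<longleftrightarrow> g \<in> Q_linear V W"
proof -
  interpret V: Q_space V by fact
  show ?thesis
    using assms(2) by (auto simp: Q_linear_def Pi_iff)
qed

lemma Q_linear_sum:
  assumes "Q_space W" "f \<in> Q_linear V W" "g \<in> Q_linear V W"
  shows "(\<lambda>x. f x \<oplus>\<^bsub>W\<^esub> g x) \<in> Q_linear V W"
proof -
  interpret W: Q_space W by fact
  note f = Q_linear_closed[OF assms(2)] Q_linear_add[OF assms(2)] Q_linear_smult[OF assms(2)]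
  note g = Q_linear_closed[OF assms(3)] Q_linear_add[OF assms(3)] Q_linear_smult[OF assms(3)]
  show ?thesis
    by (rule Q_linearI) (auto simp: f g W.a_ac W.smult_r_distr)
qed

lemma kernel_submodule:
  assumes "Q_space V" "Q_space W" "f \<in> Q_linear V W"
  shows "submodule {x \<in> carrier V. f x = \<zero>\<^bsub>W\<^esub>} QQ V"
proof -
  interpret V: Q_space V by fact
  interpret W: Q_space W by fact
  show ?thesis
    by (rule V.submoduleI)
      (auto simp: Q_linear_zero[OF assms] Q_linear_add[OF assms(3)] Q_linear_smult[OF assms(3)])
qed

subsection \<open>Linear combinations\<close>

text \<open>
  The sum runs over the support of the coefficient function.  This is the sum that occurs in the
  linear maps induced on tensor products and on enveloping algebras and in the coproduct of the
  Hall algebra, so that their linearity comes down to that of \<open>lincomb\<close>.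
\<close>

definition lincomb ::
    "(rat, 'z, 'c) module_scheme \<Rightarrow> ('p \<Rightarrow> 'z) \<Rightarrow> ('p \<Rightarrow> rat) \<Rightarrow> 'z" where
  "lincomb Z v F = (\<Oplus>\<^bsub>Z\<^esub>p\<in>{p. F p \<noteq> 0}. F p \<odot>\<^bsub>Z\<^esub> v p)"

context Q_space
begin

lemma lincomb_superset:
  assumes "finite A" "{p. F p \<noteq> 0} \<subseteq> A" "v \<in> A \<rightarrow> carrier V"
  shows "lincomb V v F = (\<Oplus>p\<in>A. F p \<odot> v p)"
  unfolding lincomb_def
  by (rule add.finprod_mono_neutral_cong_left) (use assms in \<open>auto simp: Pi_iff\<close>)

lemma lincomb_closed:
  assumes "v \<in> {p. F p \<noteq> 0} \<rightarrow> carrier V"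
  shows "lincomb V v F \<in> carrier V"
  unfolding lincomb_def by (rule finsum_closed) (use assms in auto)

lemma lincomb_add:
  assumes "finite {p. F p \<noteq> 0}" "finite {p. G p \<noteq> 0}"
    and "v \<in> {p. F p \<noteq> 0} \<rightarrow> carrier V" "v \<in> {p. G p \<noteq> 0} \<rightarrow> carrier V"
  shows "lincomb V v (\<lambda>p. F p + G p) = lincomb V v F \<oplus> lincomb V v G"
proof -
  let ?A = "{p. F p \<noteq> 0} \<union> {p. G p \<noteq> 0}"
  have *: "finite ?A" "v \<in> ?A \<rightarrow> carrier V"
    using assms by auto
  have "lincomb V v (\<lambda>p. F p + G p) = (\<Oplus>p\<in>?A. (F p + G p) \<odot> v p)"
    by (rule lincomb_superset) (use * in auto)
  also have "\<dots> = (\<Oplus>p\<in>?A. F p \<odot> v p \<oplus> G p \<odot> v p)"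
    by (rule finsum_cong') (use * in \<open>auto simp: smult_l_distr Pi_iff\<close>)
  also have "\<dots> = (\<Oplus>p\<in>?A. F p \<odot> v p) \<oplus> (\<Oplus>p\<in>?A. G p \<odot> v p)"
    by (rule finsum_addf) (use * in auto)
  also have "(\<Oplus>p\<in>?A. F p \<odot> v p) = lincomb V v F"
    by (rule lincomb_superset[symmetric]) (use * in auto)
  also have "(\<Oplus>p\<in>?A. G p \<odot> v p) = lincomb V v G"
    by (rule lincomb_superset[symmetric]) (use * in auto)
  finally show ?thesis .
qed

lemma lincomb_smult:
  assumes "finite {p. F p \<noteq> 0}" "v \<in> {p. F p \<noteq> 0} \<rightarrow> carrier V"
  shows "lincomb V v (\<lambda>p. c * F p) = c \<odot> lincomb V v F"
proof -
  let ?A = "{p. F p \<noteq> 0}"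
  have "lincomb V v (\<lambda>p. c * F p) = (\<Oplus>p\<in>?A. (c * F p) \<odot> v p)"
    by (rule lincomb_superset) (use assms in auto)
  also have "\<dots> = (\<Oplus>p\<in>?A. c \<odot> (F p \<odot> v p))"
    by (rule finsum_cong') (use assms in \<open>auto simp: smult_assoc Pi_iff\<close>)
  also have "\<dots> = c \<odot> lincomb V v F"
    unfolding lincomb_def
    using module.finsum_smult_ldistr[OF is_module, of ?A c "\<lambda>p. F p \<odot> v p"] assms
    by (simp add: Pi_iff)
  finally show ?thesis .
qed

lemma lincomb_zero [simp]: "lincomb V v (\<lambda>p. 0) = \<zero>"
  by (simp add: lincomb_def)

lemma lincomb_single:
  assumes "v q \<in> carrier V"
  shows "lincomb V v (\<lambda>p. if p = q then c else 0) = c \<odot> v q"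
proof -
  have "lincomb V v (\<lambda>p. if p = q then c else 0) = (\<Oplus>p\<in>{q}. (if p = q then c else 0) \<odot> v p)"
    by (rule lincomb_superset) (use assms in auto)
  then show ?thesis
    using assms by simp
qed

end

lemma finsupp_induct [consumes 1, case_names zero step]:
  fixes F :: "'i \<Rightarrow> rat"
  assumes "finite {p. F p \<noteq> 0}"
    and zero: "P (\<lambda>p. 0)"
    and step: "\<And>c q G. finite {p. G p \<noteq> 0} \<Longrightarrow> F q \<noteq> 0 \<Longrightarrow> {p. G p \<noteq> 0} \<subseteq> {p. F p \<noteq> 0} \<Longrightarrow> P G \<Longrightarrow>
       P (\<lambda>p. c * delta q p + G p)"
  shows "P F"
proof -
  have "P (\<lambda>p. if p \<in> A then F p else 0)" if "finite A" "A \<subseteq> {p. F p \<noteq> 0}" for A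
    using that
  proof (induction A rule: finite_induct)
    case empty
    then show ?case using zero by simp
  next
    case (insert q A)
    have "P (\<lambda>p. F q * delta q p + (if p \<in> A then F p else 0))"
      by (rule step) (use insert in \<open>auto intro: finite_subset[OF _ insert(1)]\<close>)
    moreover have "(\<lambda>p. F q * delta q p + (if p \<in> A then F p else 0)) =
        (\<lambda>p. if p \<in> insert q A then F p else 0)"
      using insert.hyps by (auto simp: delta_def)
    ultimately show ?case by simp
  qed
  from this[OF assms(1)] have "P (\<lambda>p. if F p \<noteq> 0 then F p else 0)" by simp
  moreover have "(\<lambda>p. if F p \<noteq> 0 then F p else 0) = F" by auto
  ultimately show ?thesis by simp
qed

lemma (in Q_space) lincomb_delta_add:
  assumes "finite {p. G p \<noteq> 0}" "v q \<in> carrier V" "v \<in> {p. G p \<noteq> 0} \<rightarrow> carrier V"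
  shows "lincomb V v (\<lambda>p. c * delta q p + G p) = c \<odot> v q \<oplus> lincomb V v G"
proof -
  have d: "(\<lambda>p. c * delta q p) = (\<lambda>p. if p = q then c else 0)"
    by (auto simp: delta_def)
  have "lincomb V v (\<lambda>p. c * delta q p + G p) = lincomb V v (\<lambda>p. c * delta q p) \<oplus> lincomb V v G"
    by (rule lincomb_add) (use assms in \<open>auto simp: delta_def\<close>)
  then show ?thesis
    using lincomb_single[of v q c] assms by (simp add: d)
qed

text \<open>
  By induction on the support: a linear map preserves each step \<open>c * delta q + G\<close>.
\<close>

lemma Q_linear_lincomb:
  assumes "Q_space V" "Q_space W" "f \<in> Q_linear V W"
    and "finite {p. F p \<noteq> 0}" "v \<in> {p. F p \<noteq> 0} \<rightarrow> carrier V"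
  shows "f (lincomb V v F) = lincomb W (\<lambda>p. f (v p)) F"
proof -
  interpret V: Q_space V by fact
  interpret W: Q_space W by fact
  show ?thesis
    using assms(4)
  proof (induction rule: finsupp_induct)
    case zero
    then show ?case by (simp add: Q_linear_zero[OF assms(1-3)])
  next
    case (step c q G)
    have v: "v q \<in> carrier V" "v \<in> {p. G p \<noteq> 0} \<rightarrow> carrier V"
      using step assms(5) by auto
    have fv: "f (v q) \<in> carrier W" "(\<lambda>p. f (v p)) \<in> {p. G p \<noteq> 0} \<rightarrow> carrier W"
      using v Q_linear_closed[OF assms(3)] by auto
    show ?case
      using V.lincomb_delta_add[OF step(1) v, of c] W.lincomb_delta_add[of G "\<lambda>p. f (v p)" q c] step fv v
      by (simp add: Q_linear_add[OF assms(3)] Q_linear_smult[OF assms(3)] V.lincomb_closed)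
  qed
qed

subsection \<open>Quotient spaces\<close>

text \<open>
  Tensor products and enveloping algebras are both given by cosets, with the same formulas for the
  sum and for the scalar multiplication.  Everything about cosets is derived here once.
\<close>

locale Q_quotient = Q_space F for F :: "(rat, 'v, 'c) module_scheme" (structure) +
  fixes K
  assumes sub: "submodule K QQ F"
begin

sublocale abelian_subgroup K F
  by (rule abelian_subgroupI3)
    (use submodule.axioms(1)[OF sub] abelian_group_axioms in \<open>auto intro: additive_subgroupI\<close>)

lemma K_subset: "K \<subseteq> carrier F"
  by (rule a_subset)

lemma coset_eqI:
  assumes "x \<in> carrier F" "y \<in> carrier F" "x \<ominus> y \<in> K"
  shows "K +> x = K +> y"
proof -
  have "(x \<ominus> y) \<oplus> y \<in> K +> y"
    using assms by (auto simp: a_r_coset_def')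
  then have "x \<in> K +> y"
    using assms by (simp add: a_minus_def a_assoc l_neg)
  then show ?thesis
    using assms(2) a_repr_independence a_subgroup by metis
qed

lemma coset_memE:
  assumes "t \<in> K +> x" "x \<in> carrier F"
  obtains k where "k \<in> K" "t = k \<oplus> x" "t \<in> carrier F" "t \<ominus> x = k"
proof -
  obtain k where k: "k \<in> K" "t = k \<oplus> x"
    using assms by (auto simp: a_r_coset_def')
  then have "k \<in> carrier F"
    using K_subset by auto
  then show ?thesis
    using that[of k] k assms by (simp add: a_minus_def a_assoc r_neg)
qed

lemma coset_rep_mem: "x \<in> carrier F \<Longrightarrow> x \<in> K +> x"
  by (rule a_rcos_self)

lemma coset_add:
  "x \<in> carrier F \<Longrightarrow> y \<in> carrier F \<Longrightarrow> set_add F (K +> x) (K +> y) = K +> (x \<oplus> y)"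
  by (rule a_rcos_sum)

lemma coset_zero: "K +> \<zero> = K"
  using K_subset by simp

text \<open>
  The scalar multiple of a coset is written as a union over all of its representatives; all members
  of this union coincide, because the submodule is closed under scalars.
\<close>

lemma coset_smult:
  assumes "x \<in> carrier F"
  shows "(\<Union>t\<in>K +> x. K +> (c \<odot> t)) = K +> (c \<odot> x)"
proof -
  have "K +> (c \<odot> t) = K +> (c \<odot> x)" if "t \<in> K +> x" for t
  proof (rule coset_memE[OF that assms])
    fix k assume k: "k \<in> K" "t \<in> carrier F" "t \<ominus> x = k"
    then have "c \<odot> t \<ominus> c \<odot> x = c \<odot> k"
      using assms smult_minus[of t x c] by simp
    then show ?thesis
      using coset_eqI[of "c \<odot> t" "c \<odot> x"] k assms submoduleD(4)[OF sub] by simp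
  qed
  then show ?thesis
    using coset_rep_mem[OF assms] by blast
qed

text \<open>
  A linear map that vanishes on \<open>K\<close> is constant on each coset, so its value on a coset may be
  computed at any representative.
\<close>

lemma coset_lift:
  assumes "Q_space Z" "h \<in> Q_linear F Z" "\<And>k. k \<in> K \<Longrightarrow> h k = \<zero>\<^bsub>Z\<^esub>" "x \<in> carrier F"
  shows "the_elem (h ` (K +> x)) = h x"
proof -
  interpret Z: Q_space Z by fact
  have "h t = h x" if "t \<in> K +> x" for t
  proof (rule coset_memE[OF that assms(4)])
    fix k assume k: "k \<in> K" "t = k \<oplus> x"
    then have "k \<in> carrier F"
      using K_subset by auto
    then show ?thesis
      using Q_linear_add[OF assms(2) _ assms(4), of k] assms(3)[OF k(1)] Q_linear_closed[OF assms(2) assms(4)]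
      by (simp only: k(2) Z.l_zero)
  qed
  then have "h ` (K +> x) = {h x}"
    using coset_rep_mem[OF assms(4)] by blast
  then show ?thesis by (simp only: the_elem_eq)
qed

lemma a_rcosets_eq: "a_rcosets K = (\<lambda>x. K +> x) ` carrier F"
  unfolding A_RCOSETS_def' by blast

lemma quotient_space:
  fixes Q :: "(rat, 'v set, 'd) module_scheme"
  assumes "carrier Q = a_rcosets K" "zero Q = K" "add Q = set_add F"
    and "smult Q = (\<lambda>c T. \<Union>t\<in>T. K +> (c \<odot> t))"
  shows "Q_space Q" "(\<lambda>x. K +> x) \<in> Q_linear F Q"
proof -
  have z: "zero Q = K +> \<zero>"
    by (simp add: assms coset_zero)
  have "abelian_group Q"
  proof (rule abelian_groupI)
    fix X assume "X \<in> carrier Q"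
    then obtain x where x: "x \<in> carrier F" "X = K +> x"
      by (auto simp: assms a_rcosets_eq)
    then show "\<exists>Y\<in>carrier Q. Y \<oplus>\<^bsub>Q\<^esub> X = \<zero>\<^bsub>Q\<^esub>"
      by (auto simp: z assms(1,3) a_rcosets_eq coset_add l_neg intro!: bexI[of _ "\<ominus> x"])
  qed (auto simp: z assms(1,3) a_rcosets_eq coset_add a_ac)
  moreover have sm: "c \<odot>\<^bsub>Q\<^esub> (K +> x) = K +> (c \<odot> x)" if "x \<in> carrier F" for c x
    using coset_smult[OF that] by (simp add: assms(4))
  ultimately show "Q_space Q"
    by (intro Q_space.intro moduleI cring_QQ)
      (auto simp: assms(1,3) a_rcosets_eq coset_add sm smult_l_distr smult_r_distr smult_assoc)
  show "(\<lambda>x. K +> x) \<in> Q_linear F Q"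
    by (rule Q_linearI) (auto simp: assms(1,3) a_rcosets_eq coset_add sm)
qed

end

subsection \<open>Tensor products\<close>

lemma free_space_simps [simp]:
  "carrier (free_space G) = {t. Poly_Mapping.keys t \<subseteq> G}"
  "zero (free_space G) = 0" "add (free_space G) = (+)"
  "smult (free_space G) = (\<lambda>c. Poly_Mapping.map ((*) c))"
  by (simp_all add: free_space_def)

lemma lookup_map_times [simp]:
  "Poly_Mapping.lookup (Poly_Mapping.map ((*) c) t) p = c * (Poly_Mapping.lookup t p :: rat)"
  by (simp add: map.rep_eq when_def)

lemma keys_map_times: "Poly_Mapping.keys (Poly_Mapping.map ((*) (c::rat)) t) \<subseteq> Poly_Mapping.keys t"
  by (auto simp: in_keys_iff)

lemma Q_space_free_space: "Q_space (free_space G)"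
proof (intro Q_space.intro moduleI cring_QQ abelian_groupI)
  fix x assume "x \<in> carrier (free_space G)"
  then show "\<exists>y\<in>carrier (free_space G). y \<oplus>\<^bsub>free_space G\<^esub> x = \<zero>\<^bsub>free_space G\<^esub>"
    by (intro bexI[of _ "- x"]) auto
next
  fix x y c assume "x \<in> carrier (free_space G)" "y \<in> carrier (free_space G)"
  then show "x \<oplus>\<^bsub>free_space G\<^esub> y \<in> carrier (free_space G)"
    using Poly_Mapping.keys_add[of x y] by auto
next
  fix x c assume "x \<in> carrier (free_space G)"
  then show "c \<odot>\<^bsub>free_space G\<^esub> x \<in> carrier (free_space G)"
    using keys_map_times[of c x] by auto
qed (auto intro!: poly_mapping_eqI simp: lookup_add algebra_simps)

lemma free_space_lincomb_linear:
  assumes "Q_space Z" "v \<in> G \<rightarrow> carrier Z"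
  shows "(\<lambda>t. lincomb Z v (Poly_Mapping.lookup t)) \<in> Q_linear (free_space G) Z"
proof -
  interpret Z: Q_space Z by fact
  have v: "v \<in> {p. Poly_Mapping.lookup t p \<noteq> 0} \<rightarrow> carrier Z" if "Poly_Mapping.keys t \<subseteq> G" for t
    using that assms(2) by (auto simp: in_keys_iff)
  show ?thesis
  proof (rule Q_linearI)
    fix x y assume "x \<in> carrier (free_space G)" "y \<in> carrier (free_space G)"
    then show "lincomb Z v (Poly_Mapping.lookup (x \<oplus>\<^bsub>free_space G\<^esub> y)) =
        lincomb Z v (Poly_Mapping.lookup x) \<oplus>\<^bsub>Z\<^esub> lincomb Z v (Poly_Mapping.lookup y)"
      using Z.lincomb_add[OF _ _ v v] by (simp add: lookup_add[abs_def] plus_poly_mapping.rep_eq)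
  next
    fix c x assume "x \<in> carrier (free_space G)"
    then show "lincomb Z v (Poly_Mapping.lookup (c \<odot>\<^bsub>free_space G\<^esub> x)) =
        c \<odot>\<^bsub>Z\<^esub> lincomb Z v (Poly_Mapping.lookup x)"
      using Z.lincomb_smult[OF _ v, of x c] by (simp add: lookup_map_times[abs_def])
  qed (use Z.lincomb_closed[OF v] in auto)
qed

lemma (in Q_space) lincomb_lookup_single:
  assumes "v p \<in> carrier V"
  shows "lincomb V v (Poly_Mapping.lookup (Poly_Mapping.single p c)) = c \<odot> v p"
proof -
  have "Poly_Mapping.lookup (Poly_Mapping.single p c) = (\<lambda>q. if q = p then c else 0)"
    by (auto simp: lookup_single when_def)
  then show ?thesis
    using lincomb_single[of v p c] assms by simp
qed

text \<open>
  Elements of a free space or of a free algebra are sums of multiples of basis elements from \<open>G\<close>.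
\<close>

lemma keys_subset_induct [consumes 1, case_names zero add single]:
  fixes t :: "'p \<Rightarrow>\<^sub>0 'r::comm_monoid_add"
  assumes "Poly_Mapping.keys t \<subseteq> G"
    and "P 0" "\<And>s t. Poly_Mapping.keys s \<subseteq> G \<Longrightarrow> Poly_Mapping.keys t \<subseteq> G \<Longrightarrow> P s \<Longrightarrow> P t \<Longrightarrow> P (s + t)"
    and "\<And>p c. p \<in> G \<Longrightarrow> P (Poly_Mapping.single p c)"
  shows "P t"
  using assms(1)
proof (induction t rule: update_induct)
  case const
  then show ?case using assms by simp
next
  case (update f a b)
  have e: "Poly_Mapping.update a b f = Poly_Mapping.single a b + f"
    using update(1) by (intro poly_mapping_eqI) (auto simp: lookup_update lookup_add lookup_single in_keys_iff when_def)
  from update(2) have k: "Poly_Mapping.keys (Poly_Mapping.update a b f) = insert a (Poly_Mapping.keys f)"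
    by (auto simp: in_keys_iff lookup_update split: if_splits)
  show ?case
    unfolding e by (rule assms(3)) (use update k assms(4) in auto)
qed


definition Q_bilinear ::
    "(rat, 'v, 'c) module_scheme \<Rightarrow> (rat, 'w, 'd) module_scheme \<Rightarrow> (rat, 'z, 'e) module_scheme
       \<Rightarrow> ('v \<Rightarrow> 'w \<Rightarrow> 'z) set" where
  "Q_bilinear V W Z = {\<beta>. (\<forall>x\<in>carrier V. \<beta> x \<in> Q_linear W Z) \<and>
     (\<forall>y\<in>carrier W. (\<lambda>x. \<beta> x y) \<in> Q_linear V Z)}"

lemma Q_bilinearI:
  assumes "\<And>x. x \<in> carrier V \<Longrightarrow> \<beta> x \<in> Q_linear W Z"
    and "\<And>y. y \<in> carrier W \<Longrightarrow> (\<lambda>x. \<beta> x y) \<in> Q_linear V Z"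
  shows "\<beta> \<in> Q_bilinear V W Z"
  using assms by (auto simp: Q_bilinear_def)

lemma
  assumes "\<beta> \<in> Q_bilinear V W Z"
  shows Q_bilinear_right: "x \<in> carrier V \<Longrightarrow> \<beta> x \<in> Q_linear W Z"
    and Q_bilinear_left: "y \<in> carrier W \<Longrightarrow> (\<lambda>x. \<beta> x y) \<in> Q_linear V Z"
  using assms by (auto simp: Q_bilinear_def)

lemma Q_bilinear_comp:
  assumes "\<beta> \<in> Q_bilinear V W Z" "f \<in> Q_linear V' V" "g \<in> Q_linear W' W"
  shows "(\<lambda>x y. \<beta> (f x) (g y)) \<in> Q_bilinear V' W' Z"
proof (rule Q_bilinearI)
  show "(\<lambda>y. \<beta> (f x) (g y)) \<in> Q_linear W' Z" if "x \<in> carrier V'" for x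
    by (rule Q_linear_comp[OF assms(3)], rule Q_bilinear_right[OF assms(1)],
        rule Q_linear_closed[OF assms(2) that])
  show "(\<lambda>x. \<beta> (f x) (g y)) \<in> Q_linear V' Z" if "y \<in> carrier W'" for y
    by (rule Q_linear_comp[OF assms(2)], rule Q_bilinear_left[OF assms(1)],
        rule Q_linear_closed[OF assms(3) that])
qed

lemma tensor_simps:
  fixes V :: "(rat, 'v, 'c) module_scheme" and W :: "(rat, 'w, 'd) module_scheme"
  defines "F \<equiv> free_space (carrier V \<times> carrier W)" and "K \<equiv> tensor_null V W"
  shows "carrier (tensor V W) = a_rcosets\<^bsub>F\<^esub> K"
    "zero (tensor V W) = K"
    "add (tensor V W) = set_add F"
    "smult (tensor V W) = (\<lambda>c T. \<Union>t\<in>T. K +>\<^bsub>F\<^esub> (c \<odot>\<^bsub>F\<^esub> t))"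
  by (simp_all add: tensor_def tensor_space_def Let_def F_def K_def)

lemma tensor_one: "one (tensor V W) = tens V W \<one>\<^bsub>V\<^esub> \<one>\<^bsub>W\<^esub>"
  by (simp add: tensor_def Let_def)

context
  fixes V :: "(rat, 'v, 'c) module_scheme" and W :: "(rat, 'w, 'd) module_scheme"
  assumes V: "Q_space V" and W: "Q_space W"
begin

interpretation V: Q_space V by (rule V)
interpretation W: Q_space W by (rule W)

abbreviation "FVW \<equiv> free_space (carrier V \<times> carrier W)"

interpretation FS: Q_space FVW
  by (rule Q_space_free_space)

lemma FVW_minus:
  "s \<in> carrier FVW \<Longrightarrow> t \<in> carrier FVW \<Longrightarrow> s - t \<in> carrier FVW"
  using Poly_Mapping.keys_diff[of s t] by auto

lemma FVW_single:
  "x \<in> carrier V \<Longrightarrow> y \<in> carrier W \<Longrightarrow> Poly_Mapping.single (x, y) c \<in> carrier FVW"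
  by simp

lemma tensor_null_gens:
  "{Poly_Mapping.single (x \<oplus>\<^bsub>V\<^esub> x', y) 1 - Poly_Mapping.single (x, y) 1
         - Poly_Mapping.single (x', y) (1::rat)
         | x x' y. x \<in> carrier V \<and> x' \<in> carrier V \<and> y \<in> carrier W} \<union>
      {Poly_Mapping.single (x, y \<oplus>\<^bsub>W\<^esub> y') 1 - Poly_Mapping.single (x, y) 1
         - Poly_Mapping.single (x, y') 1
         | x y y'. x \<in> carrier V \<and> y \<in> carrier W \<and> y' \<in> carrier W} \<union>
      {Poly_Mapping.single (c \<odot>\<^bsub>V\<^esub> x, y) 1 - Poly_Mapping.single (x, y) c
         | c x y. x \<in> carrier V \<and> y \<in> carrier W} \<union>
      {Poly_Mapping.single (x, c \<odot>\<^bsub>W\<^esub> y) 1 - Poly_Mapping.single (x, y) c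
         | c x y. x \<in> carrier V \<and> y \<in> carrier W} \<subseteq> carrier FVW"
  by (intro Un_least subsetI; elim CollectE exE conjE; simp only: FVW_minus FVW_single
      V.a_closed W.a_closed V.smult_closed W.smult_closed)

interpretation QT: Q_quotient FVW "tensor_null V W"
  unfolding tensor_null_def
  by (intro Q_quotient.intro Q_space_free_space Q_quotient_axioms.intro
      FS.Q_span_submodule[OF tensor_null_gens])

lemma Q_space_tensor: "Q_space (tensor V W)"
  by (rule QT.quotient_space(1)) (simp_all only: tensor_simps)

lemma coset_linear: "(\<lambda>t. tensor_null V W +>\<^bsub>FVW\<^esub> t) \<in> Q_linear FVW (tensor V W)"
  by (rule QT.quotient_space(2)) (simp_all only: tensor_simps)

interpretation T: Q_space "tensor V W"
  by (rule Q_space_tensor)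

lemma tensor_carrierE:
  assumes "T \<in> carrier (tensor V W)"
  obtains t where "t \<in> carrier FVW" "T = tensor_null V W +>\<^bsub>FVW\<^esub> t"
  using assms by (auto simp: tensor_simps QT.a_rcosets_eq)

lemma tens_bilinear: "tens V W \<in> Q_bilinear V W (tensor V W)"
proof -
  let ?s = "\<lambda>x y c. Poly_Mapping.single (x, y) (c::rat)"
  let ?c = "\<lambda>t. tensor_null V W +>\<^bsub>FVW\<^esub> t"
  note lin = Q_linear_closed[OF coset_linear] Q_linear_add[OF coset_linear]
    Q_linear_smult[OF coset_linear]
  have in_null: "x \<in> carrier V \<Longrightarrow> x' \<in> carrier V \<Longrightarrow> y \<in> carrier W \<Longrightarrow>
      ?s (x \<oplus>\<^bsub>V\<^esub> x') y 1 - (?s x y 1 + ?s x' y 1) \<in> tensor_null V W"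
    "x \<in> carrier V \<Longrightarrow> y \<in> carrier W \<Longrightarrow> y' \<in> carrier W \<Longrightarrow>
      ?s x (y \<oplus>\<^bsub>W\<^esub> y') 1 - (?s x y 1 + ?s x y' 1) \<in> tensor_null V W"
    "x \<in> carrier V \<Longrightarrow> y \<in> carrier W \<Longrightarrow> ?s (c \<odot>\<^bsub>V\<^esub> x) y 1 - ?s x y c \<in> tensor_null V W"
    "x \<in> carrier V \<Longrightarrow> y \<in> carrier W \<Longrightarrow> ?s x (c \<odot>\<^bsub>W\<^esub> y) 1 - ?s x y c \<in> tensor_null V W"
    for x x' y y' c
    unfolding tensor_null_def diff_diff_eq[symmetric]
    by (rule subsetD[OF FS.Q_span_superset], blast)+
  have minus: "s \<ominus>\<^bsub>FVW\<^esub> t = s - t" if "s \<in> carrier FVW" "t \<in> carrier FVW" for s t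
  proof -
    have "(- t) \<oplus>\<^bsub>FVW\<^esub> t = \<zero>\<^bsub>FVW\<^esub>" "- t \<in> carrier FVW"
      using that by auto
    then show ?thesis
      using FS.minus_equality[of "- t" t] that by (simp add: a_minus_def)
  qed
  have closed: "?s x y c \<in> carrier FVW" if "x \<in> carrier V" "y \<in> carrier W" for x y c
    using that by simp
  have scal: "Poly_Mapping.map ((*) c) (?s x y 1) = ?s x y c" for x y c
    by simp
  show ?thesis
  proof (intro Q_bilinearI Q_linearI)
    fix x y assume "x \<in> carrier V" "y \<in> carrier W"
    then show "tens V W x y \<in> carrier (tensor V W)"
      by (simp add: tens_def lin(1))
    then show "tens V W x y \<in> carrier (tensor V W)" .
  next
    fix x y y' assume xy: "x \<in> carrier V" "y \<in> carrier W" "y' \<in> carrier W"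
    have sum: "?s x y 1 + ?s x y' 1 \<in> carrier FVW"
      using FS.a_closed[OF closed closed, OF xy(1,2) xy(1,3), of 1 1] by simp
    have "?c (?s x (y \<oplus>\<^bsub>W\<^esub> y') 1) = ?c (?s x y 1 + ?s x y' 1)"
      by (rule QT.coset_eqI[OF closed sum])
        (use xy in \<open>simp_all only: minus[OF closed sum] W.a_closed in_null\<close>)
    then show "tens V W x (y \<oplus>\<^bsub>W\<^esub> y') = tens V W x y \<oplus>\<^bsub>tensor V W\<^esub> tens V W x y'"
      using xy lin(2)[OF closed closed, OF xy(1,2) xy(1,3)] by (simp add: tens_def)
  next
    fix c x y assume xy: "x \<in> carrier V" "y \<in> carrier W"
    have "?c (?s x (c \<odot>\<^bsub>W\<^esub> y) 1) = ?c (?s x y c)"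
      by (rule QT.coset_eqI[OF closed closed])
        (use xy in \<open>simp_all only: minus[OF closed closed] W.smult_closed in_null\<close>)
    then show "tens V W x (c \<odot>\<^bsub>W\<^esub> y) = c \<odot>\<^bsub>tensor V W\<^esub> tens V W x y"
      using xy lin(3)[OF closed, OF xy, of c 1] by (simp add: tens_def)
  next
    fix x x' y assume xy: "x \<in> carrier V" "x' \<in> carrier V" "y \<in> carrier W"
    have sum: "?s x y 1 + ?s x' y 1 \<in> carrier FVW"
      using FS.a_closed[OF closed closed, OF xy(1,3) xy(2,3), of 1 1] by simp
    have "?c (?s (x \<oplus>\<^bsub>V\<^esub> x') y 1) = ?c (?s x y 1 + ?s x' y 1)"
      by (rule QT.coset_eqI[OF closed sum])
        (use xy in \<open>simp_all only: minus[OF closed sum] V.a_closed in_null\<close>)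
    then show "tens V W (x \<oplus>\<^bsub>V\<^esub> x') y = tens V W x y \<oplus>\<^bsub>tensor V W\<^esub> tens V W x' y"
      using xy lin(2)[OF closed closed, OF xy(1,3) xy(2,3)] by (simp add: tens_def)
  next
    fix c x y assume xy: "x \<in> carrier V" "y \<in> carrier W"
    have "?c (?s (c \<odot>\<^bsub>V\<^esub> x) y 1) = ?c (?s x y c)"
      by (rule QT.coset_eqI[OF closed closed])
        (use xy in \<open>simp_all only: minus[OF closed closed] V.smult_closed in_null\<close>)
    then show "tens V W (c \<odot>\<^bsub>V\<^esub> x) y = c \<odot>\<^bsub>tensor V W\<^esub> tens V W x y"
      using xy lin(3)[OF closed, OF xy, of c 1] by (simp add: tens_def)
  qed
qed

lemma tens_closed [simp]:
  "x \<in> carrier V \<Longrightarrow> y \<in> carrier W \<Longrightarrow> tens V W x y \<in> carrier (tensor V W)"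
  using Q_linear_closed[OF Q_bilinear_right[OF tens_bilinear]] .

lemma tens_linear_left: "y \<in> carrier W \<Longrightarrow> (\<lambda>x. tens V W x y) \<in> Q_linear V (tensor V W)"
  by (rule Q_bilinear_left[OF tens_bilinear])

lemma tens_linear_right: "x \<in> carrier V \<Longrightarrow> tens V W x \<in> Q_linear W (tensor V W)"
  by (rule Q_bilinear_right[OF tens_bilinear])

text \<open>
  Scalars need no step of their own, since \<open>c (x \<otimes> y) = (c x) \<otimes> y\<close>: pure tensors span a tensor
  product already as an additive group.
\<close>

lemma tensor_induct [consumes 1, case_names tens add]:
  assumes "T \<in> carrier (tensor V W)"
    and tens: "\<And>x y. x \<in> carrier V \<Longrightarrow> y \<in> carrier W \<Longrightarrow> P (tens V W x y)"
    and add: "\<And>S T. S \<in> carrier (tensor V W) \<Longrightarrow> T \<in> carrier (tensor V W) \<Longrightarrow> P S \<Longrightarrow> P T \<Longrightarrow>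
       P (S \<oplus>\<^bsub>tensor V W\<^esub> T)"
  shows "P T"
proof -
  note lin = Q_linear_closed[OF coset_linear] Q_linear_add[OF coset_linear]
    Q_linear_smult[OF coset_linear]
  obtain t where t: "t \<in> carrier FVW" "T = tensor_null V W +>\<^bsub>FVW\<^esub> t"
    using assms(1) by (rule tensor_carrierE)
  have single: "P (tensor_null V W +>\<^bsub>FVW\<^esub> Poly_Mapping.single (x, y) c)"
    if "x \<in> carrier V" "y \<in> carrier W" for x y c
  proof -
    have "tensor_null V W +>\<^bsub>FVW\<^esub> Poly_Mapping.single (x, y) c = c \<odot>\<^bsub>tensor V W\<^esub> tens V W x y"
      using lin(3)[of "Poly_Mapping.single (x, y) 1" c] that by (simp add: tens_def)
    also have "\<dots> = tens V W (c \<odot>\<^bsub>V\<^esub> x) y"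
      using Q_linear_smult[OF tens_linear_left] that by metis
    finally show ?thesis
      using tens[of "c \<odot>\<^bsub>V\<^esub> x" y] that by simp
  qed
  have "Poly_Mapping.keys t \<subseteq> carrier V \<times> carrier W"
    using t by simp
  then have "P (tensor_null V W +>\<^bsub>FVW\<^esub> t)"
  proof (induction t rule: keys_subset_induct)
    case zero
    have "P (tensor_null V W +>\<^bsub>FVW\<^esub> Poly_Mapping.single (\<zero>\<^bsub>V\<^esub>, \<zero>\<^bsub>W\<^esub>) 0)"
      by (rule single) auto
    then show ?case by simp
  next
    case (add s t)
    then show ?case
      using lin(2)[of s t] assms(3) lin(1) by simp
  next
    case (single p c)
    then show ?case
      using \<open>\<And>y x c. x \<in> carrier V \<Longrightarrow> y \<in> carrier W \<Longrightarrow> P (tensor_null V W +>\<^bsub>FVW\<^esub> Poly_Mapping.single (x, y) c)\<close>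
      by (cases p) auto
  qed
  then show ?thesis by (simp add: t)
qed

lemma tensor_linear_eqI:
  assumes "f \<in> Q_linear (tensor V W) Z" "g \<in> Q_linear (tensor V W) Z" "T \<in> carrier (tensor V W)"
    and "\<And>x y. x \<in> carrier V \<Longrightarrow> y \<in> carrier W \<Longrightarrow> f (tens V W x y) = g (tens V W x y)"
  shows "f T = g T"
  using assms(3)
  by (induction rule: tensor_induct)
    (simp_all add: assms(4) Q_linear_add[OF assms(1)] Q_linear_add[OF assms(2)])

context
  fixes Z :: "(rat, 'z, 'e) module_scheme" and \<beta> :: "'v \<Rightarrow> 'w \<Rightarrow> 'z"
  assumes Z: "Q_space Z" and bil: "\<beta> \<in> Q_bilinear V W Z"
begin

interpretation Z: Q_space Z by (rule Z)

abbreviation lin_ext where "lin_ext t \<equiv> lincomb Z (\<lambda>p. \<beta> (fst p) (snd p)) (Poly_Mapping.lookup t)"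

lemma lin_ext_linear: "lin_ext \<in> Q_linear FVW Z"
  by (rule free_space_lincomb_linear[OF Z])
    (auto intro: Q_linear_closed[OF Q_bilinear_right[OF bil]])

text \<open>
  The kernel of the linear extension of a bilinear map is a submodule that contains the four
  families of bilinear relations, hence their span.
\<close>

lemma lin_ext_null:
  assumes "t \<in> tensor_null V W"
  shows "lin_ext t = \<zero>\<^bsub>Z\<^esub>"
proof -
  have c: "\<beta> x y \<in> carrier Z" if "x \<in> carrier V" "y \<in> carrier W" for x y
    using Q_linear_closed[OF Q_bilinear_right[OF bil]] that .
  have s: "lin_ext (Poly_Mapping.single (x, y) a) = a \<odot>\<^bsub>Z\<^esub> \<beta> x y" if "x \<in> carrier V" "y \<in> carrier W" for x y a
    using Z.lincomb_lookup_single[of "\<lambda>p. \<beta> (fst p) (snd p)" "(x, y)" a] c[OF that] by simp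
  have d: "lin_ext (s - t) = lin_ext s \<ominus>\<^bsub>Z\<^esub> lin_ext t" if "s \<in> carrier FVW" "t \<in> carrier FVW" for s t
  proof -
    have "s - t = s \<oplus>\<^bsub>FVW\<^esub> ((-1) \<odot>\<^bsub>FVW\<^esub> t)"
      by (auto intro!: poly_mapping_eqI simp: lookup_minus lookup_add)
    then show ?thesis
      using that Q_linear_closed[OF lin_ext_linear] FS.smult_closed[OF that(2), of "-1"]
      by (simp add: Q_linear_add[OF lin_ext_linear] Q_linear_smult[OF lin_ext_linear] a_minus_def Z.smult_minus_one
          del: free_space_simps)
  qed
  have z: "(u \<oplus>\<^bsub>Z\<^esub> v) \<ominus>\<^bsub>Z\<^esub> u \<ominus>\<^bsub>Z\<^esub> v = \<zero>\<^bsub>Z\<^esub>" if "u \<in> carrier Z" "v \<in> carrier Z" for u v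
    using Z.r_neg[of "u \<oplus>\<^bsub>Z\<^esub> v"] that by (simp add: a_minus_def Z.minus_add Z.a_assoc)
  note bl = Q_linear_add[OF Q_bilinear_left[OF bil]] Q_linear_smult[OF Q_bilinear_left[OF bil]]
    Q_linear_add[OF Q_bilinear_right[OF bil]] Q_linear_smult[OF Q_bilinear_right[OF bil]]
  have "tensor_null V W \<subseteq> {t \<in> carrier FVW. lin_ext t = \<zero>\<^bsub>Z\<^esub>}"
    unfolding tensor_null_def
  proof (rule FS.Q_span_least[OF kernel_submodule[OF Q_space_free_space Z lin_ext_linear]], intro Un_least subsetI)
  qed (elim CollectE exE conjE, simp add: d FVW_minus FVW_single s c bl z Z.minus_eq_zero_iff
      del: free_space_simps)+
  then show ?thesis
    using assms by auto
qed

lemma tensor_lift_coset: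
  assumes "t \<in> carrier FVW"
  shows "tensor_lift Z \<beta> (tensor_null V W +>\<^bsub>FVW\<^esub> t) = lin_ext t"
proof -
  have "tensor_lift Z \<beta> T = the_elem (lin_ext ` T)" for T
    by (simp add: tensor_lift_def lincomb_def keys.rep_eq)
  then show ?thesis
    using QT.coset_lift[OF Z lin_ext_linear lin_ext_null assms] by simp
qed

text \<open>
  Together with the next lemma this is the universal property of the tensor product.
\<close>

lemma tensor_lift_linear: "tensor_lift Z \<beta> \<in> Q_linear (tensor V W) Z"
proof (rule Q_linearI)
  note lin = Q_linear_closed[OF coset_linear] Q_linear_add[OF coset_linear, symmetric]
    Q_linear_smult[OF coset_linear, symmetric]
  note lin_ext = Q_linear_closed[OF lin_ext_linear] Q_linear_add[OF lin_ext_linear] Q_linear_smult[OF lin_ext_linear]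
  fix T assume "T \<in> carrier (tensor V W)"
  then obtain t where t: "t \<in> carrier FVW" "T = tensor_null V W +>\<^bsub>FVW\<^esub> t"
    by (rule tensor_carrierE)
  then show "tensor_lift Z \<beta> T \<in> carrier Z"
    by (simp add: tensor_lift_coset lin_ext del: free_space_simps)
  show "tensor_lift Z \<beta> (c \<odot>\<^bsub>tensor V W\<^esub> T) = c \<odot>\<^bsub>Z\<^esub> tensor_lift Z \<beta> T" for c
    using t by (simp add: tensor_lift_coset lin lin_ext del: free_space_simps)
  fix S assume "S \<in> carrier (tensor V W)"
  then obtain s where s: "s \<in> carrier FVW" "S = tensor_null V W +>\<^bsub>FVW\<^esub> s"
    by (rule tensor_carrierE)
  then show "tensor_lift Z \<beta> (T \<oplus>\<^bsub>tensor V W\<^esub> S) = tensor_lift Z \<beta> T \<oplus>\<^bsub>Z\<^esub> tensor_lift Z \<beta> S"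
    using t by (simp add: tensor_lift_coset lin lin_ext del: free_space_simps)
qed

lemma tensor_lift_tens:
  assumes "x \<in> carrier V" "y \<in> carrier W"
  shows "tensor_lift Z \<beta> (tens V W x y) = \<beta> x y"
  using tensor_lift_coset[of "Poly_Mapping.single (x, y) 1"] assms
    Z.lincomb_lookup_single[of "\<lambda>p. \<beta> (fst p) (snd p)" "(x, y)" 1]
    Q_linear_closed[OF Q_bilinear_right[OF bil]]
  by (simp add: tens_def)

end

end

section \<open>Tensor products of algebras\<close>

locale Q_alg =
  fixes B :: "(rat, 'v, 'c) module_scheme" (structure)
  assumes is_algebra: "Q_algebra B"
begin

sublocale ring B
  using is_algebra by (simp add: Q_algebra_def)

sublocale Q_space B
  by (rule Q_space.intro) (use is_algebra in \<open>simp add: Q_algebra_def\<close>)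

lemma smult_mult_left:
  "x \<in> carrier B \<Longrightarrow> y \<in> carrier B \<Longrightarrow> (c \<odot> x) \<otimes> y = c \<odot> (x \<otimes> y)"
  using is_algebra by (simp add: Q_algebra_def)

lemma smult_mult_right:
  "x \<in> carrier B \<Longrightarrow> y \<in> carrier B \<Longrightarrow> x \<otimes> (c \<odot> y) = c \<odot> (x \<otimes> y)"
  using is_algebra by (simp add: Q_algebra_def)

lemma mult_linear_left: "y \<in> carrier B \<Longrightarrow> (\<lambda>x. x \<otimes> y) \<in> Q_linear B B"
  by (rule Q_linearI) (auto simp: l_distr smult_mult_left)

lemma mult_linear_right: "x \<in> carrier B \<Longrightarrow> (\<lambda>y. x \<otimes> y) \<in> Q_linear B B"
  by (rule Q_linearI) (auto simp: r_distr smult_mult_right)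

lemma mult_bilinear: "(\<lambda>x y. x \<otimes> y) \<in> Q_bilinear B B B"
  by (rule Q_bilinearI) (auto intro: mult_linear_left mult_linear_right)

lemma smult_bilinear:
  assumes "e \<in> Q_linear B QQ"
  shows "(\<lambda>a b. e a \<odot> b) \<in> Q_bilinear B B B" "(\<lambda>a b. e b \<odot> a) \<in> Q_bilinear B B B"
  using Q_linear_add[OF assms] Q_linear_smult[OF assms]
  by (auto intro!: Q_bilinearI Q_linearI simp: smult_l_distr smult_r_distr smult_assoc[symmetric] mult.commute)

lemma smult_one_linear: "e \<in> Q_linear V QQ \<Longrightarrow> (\<lambda>x. e x \<odot> \<one>) \<in> Q_linear V B"
  by (auto intro!: Q_linearI simp: Q_linear_add Q_linear_smult smult_l_distr smult_assoc)

end

lemma Q_algebraI: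
  assumes "Q_space B" "\<one>\<^bsub>B\<^esub> \<in> carrier B" "(\<lambda>x y. x \<otimes>\<^bsub>B\<^esub> y) \<in> Q_bilinear B B B"
    and "\<And>x. x \<in> carrier B \<Longrightarrow> \<one>\<^bsub>B\<^esub> \<otimes>\<^bsub>B\<^esub> x = x" "\<And>x. x \<in> carrier B \<Longrightarrow> x \<otimes>\<^bsub>B\<^esub> \<one>\<^bsub>B\<^esub> = x"
    and "\<And>x y z. x \<in> carrier B \<Longrightarrow> y \<in> carrier B \<Longrightarrow> z \<in> carrier B \<Longrightarrow>
      (x \<otimes>\<^bsub>B\<^esub> y) \<otimes>\<^bsub>B\<^esub> z = x \<otimes>\<^bsub>B\<^esub> (y \<otimes>\<^bsub>B\<^esub> z)"
  shows "Q_algebra B"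
proof -
  interpret Q_space B by fact
  note l = Q_linear_closed[OF Q_bilinear_left[OF assms(3)]] Q_linear_add[OF Q_bilinear_left[OF assms(3)]]
    Q_linear_smult[OF Q_bilinear_left[OF assms(3)]]
    Q_linear_add[OF Q_bilinear_right[OF assms(3)]] Q_linear_smult[OF Q_bilinear_right[OF assms(3)]]
  have "ring B"
    by (intro ringI abelian_group_axioms monoidI) (auto simp: assms l)
  then show ?thesis
    using is_module by (auto simp: Q_algebra_def l)
qed

lemma ring_homE:
  assumes "h \<in> ring_hom R S"
  shows "x \<in> carrier R \<Longrightarrow> y \<in> carrier R \<Longrightarrow> h (x \<otimes>\<^bsub>R\<^esub> y) = h x \<otimes>\<^bsub>S\<^esub> h y" "h \<one>\<^bsub>R\<^esub> = \<one>\<^bsub>S\<^esub>"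
  using assms by (auto simp: ring_hom_def)

lemma Q_linear_ring_homI:
  assumes "h \<in> Q_linear R S" "h \<one>\<^bsub>R\<^esub> = \<one>\<^bsub>S\<^esub>"
    and "\<And>x y. x \<in> carrier R \<Longrightarrow> y \<in> carrier R \<Longrightarrow> h (x \<otimes>\<^bsub>R\<^esub> y) = h x \<otimes>\<^bsub>S\<^esub> h y"
  shows "h \<in> ring_hom R S"
  using assms by (auto simp: ring_hom_def Q_linear_def)

text \<open>
  The multiplication of a tensor product is defined by means of the lift into the vector space that
  does not yet carry it; the lift only sees the additive structure.
\<close>

lemma tensor_lift_tensor:
  "tensor_lift (tensor V W) \<beta> U = tensor_lift (tensor_space V W) \<beta> U"
  by (simp add: tensor_lift_def finsum_def tensor_def Let_def)

text \<open>
  The linear map induced by \<open>\<beta> c\<close> depends linearly on \<open>c\<close> if \<open>\<beta>\<close> does.  This gives the bilinearity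
  of maps that are defined by nested lifts, such as the product of two tensors and the
  associativity isomorphism.
\<close>

lemma tensor_lift_param:
  assumes V: "Q_space V" and W: "Q_space W" and Z: "Q_space Z" and C: "Q_space C"
    and bil: "\<And>c. c \<in> carrier C \<Longrightarrow> \<beta> c \<in> Q_bilinear V W Z"
    and lin: "\<And>x y. x \<in> carrier V \<Longrightarrow> y \<in> carrier W \<Longrightarrow> (\<lambda>c. \<beta> c x y) \<in> Q_linear C Z"
    and T: "T \<in> carrier (tensor V W)"
  shows "(\<lambda>c. tensor_lift Z (\<beta> c) T) \<in> Q_linear C Z"
  using T
proof (induction rule: tensor_induct[OF V W, consumes 1, case_names tens add])
  case (tens x y)
  then show ?case
    using Q_linear_cong[OF C, where f = "\<lambda>c. tensor_lift Z (\<beta> c) (tens V W x y)"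
        and g = "\<lambda>c. \<beta> c x y" and W = Z] lin[of x y] tensor_lift_tens[OF V W Z bil]
    by simp
next
  case (add S T)
  then show ?case
    using Q_linear_cong[OF C, where f = "\<lambda>c. tensor_lift Z (\<beta> c) (S \<oplus>\<^bsub>tensor V W\<^esub> T)"
        and g = "\<lambda>c. tensor_lift Z (\<beta> c) S \<oplus>\<^bsub>Z\<^esub> tensor_lift Z (\<beta> c) T" and W = Z]
      Q_linear_sum[OF Z add(3,4)] Q_linear_add[OF tensor_lift_linear[OF V W Z bil]]
    by simp
qed

context
  fixes V :: "(rat, 'v, 'c) module_scheme" and W :: "(rat, 'w, 'd) module_scheme"
  assumes V: "Q_algebra V" and W: "Q_algebra W"
begin

interpretation V: Q_alg V by unfold_locales (rule V)
interpretation W: Q_alg W by unfold_locales (rule W)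

abbreviation "TVW \<equiv> tensor V W"

interpretation T: Q_space TVW
  by (rule Q_space_tensor[OF V.Q_space_axioms W.Q_space_axioms])

lemmas VW = V.Q_space_axioms W.Q_space_axioms

abbreviation lmul where
  "lmul a b \<equiv> tensor_lift TVW (\<lambda>c d. tens V W (a \<otimes>\<^bsub>V\<^esub> c) (b \<otimes>\<^bsub>W\<^esub> d))"

lemma tensor_mult: "S \<otimes>\<^bsub>TVW\<^esub> T = tensor_lift TVW (\<lambda>a b. lmul a b T) S"
  unfolding tensor_lift_tensor by (simp add: tensor_def Let_def)

lemma lmul_bilinear:
  assumes "a \<in> carrier V" "b \<in> carrier W"
  shows "(\<lambda>c d. tens V W (a \<otimes>\<^bsub>V\<^esub> c) (b \<otimes>\<^bsub>W\<^esub> d)) \<in> Q_bilinear V W TVW"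
  by (rule Q_bilinear_comp[OF tens_bilinear[OF VW]])
    (use assms in \<open>auto intro: V.mult_linear_right W.mult_linear_right\<close>)

lemma lmul_linear: "a \<in> carrier V \<Longrightarrow> b \<in> carrier W \<Longrightarrow> lmul a b \<in> Q_linear TVW TVW"
  by (rule tensor_lift_linear[OF VW T.Q_space_axioms lmul_bilinear])

lemma lmul_tens:
  "a \<in> carrier V \<Longrightarrow> b \<in> carrier W \<Longrightarrow> c \<in> carrier V \<Longrightarrow> d \<in> carrier W \<Longrightarrow>
    lmul a b (tens V W c d) = tens V W (a \<otimes>\<^bsub>V\<^esub> c) (b \<otimes>\<^bsub>W\<^esub> d)"
  by (rule tensor_lift_tens[OF VW T.Q_space_axioms lmul_bilinear])

lemma lmul_param_bilinear:
  assumes "T \<in> carrier TVW"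
  shows "(\<lambda>a b. lmul a b T) \<in> Q_bilinear V W TVW"
  by (intro Q_bilinearI tensor_lift_param[OF VW T.Q_space_axioms _ _ _ assms]
      V.Q_space_axioms W.Q_space_axioms lmul_bilinear
      Q_linear_comp[OF V.mult_linear_left tens_linear_left[OF VW]]
      Q_linear_comp[OF W.mult_linear_left tens_linear_right[OF VW]]) auto

lemma tensor_mult_tens_left:
  "a \<in> carrier V \<Longrightarrow> b \<in> carrier W \<Longrightarrow> T \<in> carrier TVW \<Longrightarrow> tens V W a b \<otimes>\<^bsub>TVW\<^esub> T = lmul a b T"
  by (simp add: tensor_mult tensor_lift_tens[OF VW T.Q_space_axioms lmul_param_bilinear])

lemma tensor_mult_tens:
  "a \<in> carrier V \<Longrightarrow> b \<in> carrier W \<Longrightarrow> c \<in> carrier V \<Longrightarrow> d \<in> carrier W \<Longrightarrow>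
    tens V W a b \<otimes>\<^bsub>TVW\<^esub> tens V W c d = tens V W (a \<otimes>\<^bsub>V\<^esub> c) (b \<otimes>\<^bsub>W\<^esub> d)"
  by (simp add: tensor_mult_tens_left tens_closed[OF VW] lmul_tens)

lemma tensor_mult_linear_left: "T \<in> carrier TVW \<Longrightarrow> (\<lambda>S. S \<otimes>\<^bsub>TVW\<^esub> T) \<in> Q_linear TVW TVW"
  unfolding tensor_mult by (rule tensor_lift_linear[OF VW T.Q_space_axioms lmul_param_bilinear])

lemma tensor_mult_bilinear: "(\<lambda>S T. S \<otimes>\<^bsub>TVW\<^esub> T) \<in> Q_bilinear TVW TVW TVW"
proof (rule Q_bilinearI)
  fix S assume "S \<in> carrier TVW"
  then show "(\<lambda>T. S \<otimes>\<^bsub>TVW\<^esub> T) \<in> Q_linear TVW TVW"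
  proof (induction rule: tensor_induct[OF VW, consumes 1, case_names tens add])
    case (tens a b)
    then show ?case
      using lmul_linear[of a b]
        Q_linear_cong[OF T.Q_space_axioms, where f = "\<lambda>T. tens V W a b \<otimes>\<^bsub>TVW\<^esub> T" and g = "lmul a b"
            and W = TVW]
      by (simp add: tensor_mult_tens_left)
  next
    case (add S S')
    show ?case
      using Q_linear_sum[OF T.Q_space_axioms add(3,4)] add(1,2)
        Q_linear_add[OF tensor_mult_linear_left]
        Q_linear_cong[OF T.Q_space_axioms, where f = "\<lambda>T. (S \<oplus>\<^bsub>TVW\<^esub> S') \<otimes>\<^bsub>TVW\<^esub> T"
            and g = "\<lambda>T. (S \<otimes>\<^bsub>TVW\<^esub> T) \<oplus>\<^bsub>TVW\<^esub> (S' \<otimes>\<^bsub>TVW\<^esub> T)" and W = TVW] by simp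
  qed
qed (rule tensor_mult_linear_left)

text \<open>
  The product of tensors is bilinear, so the ring axioms need to be checked on pure tensors only,
  where they hold factor by factor.
\<close>

lemma Q_algebra_tensor: "Q_algebra (tensor V W)"
proof (rule Q_algebraI[OF T.Q_space_axioms _ tensor_mult_bilinear])
  note cl = Q_linear_closed[OF tensor_mult_linear_left] tens_closed[OF VW]
  note ml = Q_linear_add[OF tensor_mult_linear_left] Q_linear_add[OF Q_bilinear_right[OF tensor_mult_bilinear]]
  show one: "\<one>\<^bsub>TVW\<^esub> \<in> carrier TVW"
    by (simp add: tensor_one cl)
  fix S assume S: "S \<in> carrier TVW"
  then show "\<one>\<^bsub>TVW\<^esub> \<otimes>\<^bsub>TVW\<^esub> S = S"
    by (induction rule: tensor_induct[OF VW, consumes 1])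
      (auto simp: ml one, auto simp: tensor_one tensor_mult_tens)
  show "S \<otimes>\<^bsub>TVW\<^esub> \<one>\<^bsub>TVW\<^esub> = S"
    using S by (induction rule: tensor_induct[OF VW, consumes 1])
      (auto simp: ml one, auto simp: tensor_one tensor_mult_tens)
  fix T R assume T: "T \<in> carrier TVW" and R: "R \<in> carrier TVW"
  show "(S \<otimes>\<^bsub>TVW\<^esub> T) \<otimes>\<^bsub>TVW\<^esub> R = S \<otimes>\<^bsub>TVW\<^esub> (T \<otimes>\<^bsub>TVW\<^esub> R)"
    using S
  proof (induction rule: tensor_induct[OF VW, consumes 1])
    case (1 a b)
    show ?case
      using T
    proof (induction rule: tensor_induct[OF VW, consumes 1])
      case (1 c d)
      show ?case
        using R
        by (induction rule: tensor_induct[OF VW, consumes 1])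
          (use 1 \<open>a \<in> carrier V\<close> \<open>b \<in> carrier W\<close> in \<open>auto simp: ml cl tensor_mult_tens V.m_assoc W.m_assoc\<close>)
    qed (use 1 R in \<open>auto simp: ml cl\<close>)
  qed (use T R in \<open>auto simp: ml cl\<close>)
qed

end


subsection \<open>Tensor products of linear maps\<close>

lemma tensor_map_bilinear:
  assumes "Q_space V" "Q_space W" "f \<in> Q_linear A V" "g \<in> Q_linear B W"
  shows "(\<lambda>a b. tens V W (f a) (g b)) \<in> Q_bilinear A B (tensor V W)"
  by (rule Q_bilinear_comp[OF tens_bilinear]) (use assms in auto)

lemma
  assumes "Q_space A" "Q_space B" "Q_space V" "Q_space W" "f \<in> Q_linear A V" "g \<in> Q_linear B W"
  shows tensor_map_linear: "tensor_map V W f g \<in> Q_linear (tensor A B) (tensor V W)"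
    and tensor_map_tens: "a \<in> carrier A \<Longrightarrow> b \<in> carrier B \<Longrightarrow>
      tensor_map V W f g (tens A B a b) = tens V W (f a) (g b)"
  unfolding tensor_map_def
  by (rule tensor_lift_linear tensor_lift_tens; use assms in \<open>simp add: Q_space_tensor tensor_map_bilinear\<close>)+

text \<open>
  Again by reduction to pure tensors in both arguments.
\<close>

lemma tensor_map_ring_hom:
  assumes "Q_algebra A" "Q_algebra B" "Q_algebra V" "Q_algebra W"
    and f: "f \<in> Q_linear A V" "f \<in> ring_hom A V" and g: "g \<in> Q_linear B W" "g \<in> ring_hom B W"
  shows "tensor_map V W f g \<in> ring_hom (tensor A B) (tensor V W)"
proof (rule Q_linear_ring_homI)
  interpret A: Q_alg A by unfold_locales fact
  interpret B: Q_alg B by unfold_locales fact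
  interpret V: Q_alg V by unfold_locales fact
  interpret W: Q_alg W by unfold_locales fact
  interpret AB: Q_alg "tensor A B" by unfold_locales (rule Q_algebra_tensor; fact)
  interpret VW: Q_alg "tensor V W" by unfold_locales (rule Q_algebra_tensor; fact)
  let ?f = "tensor_map V W f g"
  note sp = A.Q_space_axioms B.Q_space_axioms
  show lin: "?f \<in> Q_linear (tensor A B) (tensor V W)"
    by (intro tensor_map_linear sp V.Q_space_axioms W.Q_space_axioms f g)
  have t: "a \<in> carrier A \<Longrightarrow> b \<in> carrier B \<Longrightarrow> ?f (tens A B a b) = tens V W (f a) (g b)" for a b
    by (intro tensor_map_tens sp V.Q_space_axioms W.Q_space_axioms f g)
  show "?f \<one>\<^bsub>tensor A B\<^esub> = \<one>\<^bsub>tensor V W\<^esub>"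
    by (simp add: tensor_one t ring_homE(2)[OF f(2)] ring_homE(2)[OF g(2)])
  fix S T assume S: "S \<in> carrier (tensor A B)" and T: "T \<in> carrier (tensor A B)"
  note l = Q_linear_add[OF lin] Q_linear_closed[OF lin]
  show "?f (S \<otimes>\<^bsub>tensor A B\<^esub> T) = ?f S \<otimes>\<^bsub>tensor V W\<^esub> ?f T"
    using S
  proof (induction rule: tensor_induct[OF sp, consumes 1, case_names tens add])
    case (tens a b)
    note ab = this
    show ?case
      using T
    proof (induction rule: tensor_induct[OF sp, consumes 1, case_names tens add])
      case (tens c d)
      then show ?case
        using ab Q_linear_closed[OF f(1)] Q_linear_closed[OF g(1)] assms(1-4)
        by (simp add: tensor_mult_tens t ring_homE(1)[OF f(2)] ring_homE(1)[OF g(2)])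
    next
      case (add T T')
      then show ?case
        using ab tens_closed[OF sp] by (simp add: l AB.r_distr VW.r_distr)
    qed
  next
    case (add S S')
    then show ?case
      using T by (simp add: l AB.l_distr VW.l_distr)
  qed
qed

text \<open>
  Linear maps on \<open>(A \<otimes> B) \<otimes> C\<close> are determined by their values on the elements \<open>(a \<otimes> b) \<otimes> c\<close>.
\<close>

lemma tensor_left_linear_eqI:
  assumes "Q_space A" "Q_space B" "Q_space C"
    and "f \<in> Q_linear (tensor (tensor A B) C) Z" "g \<in> Q_linear (tensor (tensor A B) C) Z"
    and "T \<in> carrier (tensor (tensor A B) C)"
    and "\<And>a b c. a \<in> carrier A \<Longrightarrow> b \<in> carrier B \<Longrightarrow> c \<in> carrier C \<Longrightarrow>
      f (tens (tensor A B) C (tens A B a b) c) = g (tens (tensor A B) C (tens A B a b) c)"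
  shows "f T = g T"
proof (rule tensor_linear_eqI[OF Q_space_tensor[OF assms(1,2)] assms(3-6)])
  fix w c assume w: "w \<in> carrier (tensor A B)" and c: "c \<in> carrier C"
  have tl: "(\<lambda>w. tens (tensor A B) C w c) \<in> Q_linear (tensor A B) (tensor (tensor A B) C)"
    by (rule tens_linear_left[OF Q_space_tensor[OF assms(1,2)] assms(3) c])
  show "f (tens (tensor A B) C w c) = g (tens (tensor A B) C w c)"
    by (rule tensor_linear_eqI[OF assms(1,2) Q_linear_comp[OF tl assms(4)] Q_linear_comp[OF tl assms(5)] w])
      (rule assms(7)[OF _ _ c])
qed

lemma
  assumes B: "Q_space B"
  shows tensor_assoc_linear:
      "tensor_assoc B \<in> Q_linear (tensor (tensor B B) B) (tensor B (tensor B B))"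
    and tensor_assoc_tens: "a \<in> carrier B \<Longrightarrow> b \<in> carrier B \<Longrightarrow> c \<in> carrier B \<Longrightarrow>
      tensor_assoc B (tens (tensor B B) B (tens B B a b) c) = tens B (tensor B B) a (tens B B b c)"
proof -
  let ?BB = "tensor B B" and ?P = "tensor B (tensor B B)"
  have BB: "Q_space ?BB" and P: "Q_space ?P"
    by (simp_all add: B Q_space_tensor)
  have bil: "(\<lambda>a b. tens B ?BB a (tens B B b c)) \<in> Q_bilinear B B ?P" if "c \<in> carrier B" for c
    by (rule Q_bilinear_comp[OF tens_bilinear[OF B BB] Q_linear_id tens_linear_left[OF B B that]])
  have bil2: "(\<lambda>T c. tensor_lift ?P (\<lambda>a b. tens B ?BB a (tens B B b c)) T) \<in> Q_bilinear ?BB B ?P"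
  proof (rule Q_bilinearI)
    show "(\<lambda>T. tensor_lift ?P (\<lambda>a b. tens B ?BB a (tens B B b c)) T) \<in> Q_linear ?BB ?P"
      if "c \<in> carrier B" for c
      by (rule tensor_lift_linear[OF B B P bil[OF that]])
    show "(\<lambda>c. tensor_lift ?P (\<lambda>a b. tens B ?BB a (tens B B b c)) T) \<in> Q_linear B ?P"
      if "T \<in> carrier ?BB" for T
      by (rule tensor_lift_param[OF B B P B bil _ that])
        (auto intro: Q_linear_comp[OF tens_linear_right[OF B B] tens_linear_right[OF B BB]])
  qed
  show "tensor_assoc B \<in> Q_linear (tensor (tensor B B) B) (tensor B (tensor B B))"
    unfolding tensor_assoc_def Let_def by (rule tensor_lift_linear[OF BB B P bil2])
  show "tensor_assoc B (tens ?BB B (tens B B a b) c) = tens B ?BB a (tens B B b c)"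
    if "a \<in> carrier B" "b \<in> carrier B" "c \<in> carrier B"
    unfolding tensor_assoc_def Let_def
    using that by (simp add: tensor_lift_tens[OF BB B P bil2] tensor_lift_tens[OF B B P bil] tens_closed[OF B B])
qed

section \<open>Isomorphisms of bialgebras and antipodes\<close>

lemma bialgebraD:
  assumes "bialgebra B"
  shows "Q_algebra B" "comult B \<in> Q_linear B (tensor B B)" "counit B \<in> Q_linear B QQ"
    "comult B \<in> ring_hom B (tensor B B)" "counit B \<in> ring_hom B QQ"
    "\<And>x. x \<in> carrier B \<Longrightarrow>
        tensor_assoc B (tensor_map (tensor B B) B (comult B) (\<lambda>b. b) (comult B x)) =
        tensor_map B (tensor B B) (\<lambda>a. a) (comult B) (comult B x)"
    "\<And>x. x \<in> carrier B \<Longrightarrow> tensor_lift B (\<lambda>a b. counit B a \<odot>\<^bsub>B\<^esub> b) (comult B x) = x"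
    "\<And>x. x \<in> carrier B \<Longrightarrow> tensor_lift B (\<lambda>a b. counit B b \<odot>\<^bsub>B\<^esub> a) (comult B x) = x"
  using assms unfolding bialgebra_def by auto

lemma antipodeD:
  assumes "antipode B S"
  shows "S \<in> Q_linear B B"
    "x \<in> carrier B \<Longrightarrow> tensor_lift B (\<lambda>a b. S a \<otimes>\<^bsub>B\<^esub> b) (comult B x) = counit B x \<odot>\<^bsub>B\<^esub> \<one>\<^bsub>B\<^esub>"
    "x \<in> carrier B \<Longrightarrow> tensor_lift B (\<lambda>a b. a \<otimes>\<^bsub>B\<^esub> S b) (comult B x) = counit B x \<odot>\<^bsub>B\<^esub> \<one>\<^bsub>B\<^esub>"
  using assms unfolding antipode_def by auto

text \<open>
  An antipode is a two-sided inverse of the identity for the convolution product, so it is unique by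
  the usual argument \<open>S = S * (id * T) = (S * id) * T = T\<close>, in which the associativity of the
  convolution product is the coassociativity of the coproduct.
\<close>

lemma antipode_unique:
  assumes C: "bialgebra C" and S: "antipode C S" and T: "antipode C T" and x: "x \<in> carrier C"
  shows "S x = T x"
proof -
  note D = bialgebraD[OF C]
  interpret Q_alg C by unfold_locales (rule D)
  note sp = Q_space_axioms
  let ?CC = "tensor C C" and ?P = "tensor C (tensor C C)" and ?Q = "tensor (tensor C C) C"
  have CC: "Q_space ?CC" and P: "Q_space ?P"
    by (simp_all add: sp Q_space_tensor)
  note Sl = antipodeD(1)[OF S] and Tl = antipodeD(1)[OF T]
  note Sc = Q_linear_closed[OF Sl] and Tc = Q_linear_closed[OF Tl]
  \<comment> \<open>the linear maps \<open>id * T\<close> on \<open>C \<otimes> C\<close> and, with \<open>m\<close>, \<open>S * (id * T)\<close> on \<open>C \<otimes> (C \<otimes> C)\<close>, before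
    composition with coproducts\<close>
  define n where "n = tensor_lift C (\<lambda>b c. b \<otimes>\<^bsub>C\<^esub> T c)"
  have nb: "(\<lambda>b c. b \<otimes>\<^bsub>C\<^esub> T c) \<in> Q_bilinear C C C"
    by (rule Q_bilinear_comp[OF mult_bilinear Q_linear_id Tl])
  have nl: "n \<in> Q_linear ?CC C"
    unfolding n_def by (rule tensor_lift_linear[OF sp sp sp nb])
  have nt: "n (tens C C b c) = b \<otimes>\<^bsub>C\<^esub> T c" if "b \<in> carrier C" "c \<in> carrier C" for b c
    unfolding n_def using that by (rule tensor_lift_tens[OF sp sp sp nb])
  define m where "m = tensor_lift C (\<lambda>a u. S a \<otimes>\<^bsub>C\<^esub> n u)"
  have mb: "(\<lambda>a u. S a \<otimes>\<^bsub>C\<^esub> n u) \<in> Q_bilinear C ?CC C"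
    by (rule Q_bilinear_comp[OF mult_bilinear Sl nl])
  have ml: "m \<in> Q_linear ?P C"
    unfolding m_def by (rule tensor_lift_linear[OF sp CC sp mb])
  have mt: "m (tens C ?CC a u) = S a \<otimes>\<^bsub>C\<^esub> n u" if "a \<in> carrier C" "u \<in> carrier ?CC" for a u
    unfolding m_def using that by (rule tensor_lift_tens[OF sp CC sp mb])
  note Dl = tensor_map_linear[OF sp sp sp CC Q_linear_id D(2)]
    and Dt = tensor_map_tens[OF sp sp sp CC Q_linear_id D(2)]
  note El = tensor_map_linear[OF sp sp CC sp D(2) Q_linear_id]
    and Et = tensor_map_tens[OF sp sp CC sp D(2) Q_linear_id]
  note Al = tensor_assoc_linear[OF sp] and At = tensor_assoc_tens[OF sp]
  note eb = smult_bilinear[OF D(3)]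
  note Dx = Q_linear_closed[OF D(2) x]
  note dc = Q_linear_closed[OF D(2)] and ec = Q_linear_closed[OF D(3)]
  \<comment> \<open>Both sides equal the convolution product of S, the identity and T, bracketed in two ways.\<close>
  have "S x = S (tensor_lift C (\<lambda>a b. counit C b \<odot>\<^bsub>C\<^esub> a) (comult C x))"
    by (simp add: D(8) x)
  also have "\<dots> = m (tensor_map C ?CC (\<lambda>a. a) (comult C) (comult C x))"
    by (rule tensor_linear_eqI[OF sp sp Q_linear_comp[OF tensor_lift_linear[OF sp sp sp eb(2)] Sl]
          Q_linear_comp[OF Dl ml] Dx])
      (simp add: Dt mt dc tensor_lift_tens[OF sp sp sp eb(2)] Q_linear_smult[OF Sl] n_def
        antipodeD(3)[OF T] smult_mult_right Sc)
  also have "\<dots> = m (tensor_assoc C (tensor_map ?CC C (comult C) (\<lambda>b. b) (comult C x)))"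
    by (simp add: D(6) x)
  also have "\<dots> = T (tensor_lift C (\<lambda>a b. counit C a \<odot>\<^bsub>C\<^esub> b) (comult C x))"
  proof (rule tensor_linear_eqI[OF sp sp Q_linear_comp[OF Q_linear_comp[OF El Al] ml]
          Q_linear_comp[OF tensor_lift_linear[OF sp sp sp eb(1)] Tl] Dx])
    fix a b assume ab: "a \<in> carrier C" "b \<in> carrier C"
    have Sb: "(\<lambda>a c. S a \<otimes>\<^bsub>C\<^esub> c) \<in> Q_bilinear C C C"
      by (rule Q_bilinear_comp[OF mult_bilinear Sl Q_linear_id])
    note Slin = tensor_lift_linear[OF sp sp sp Sb]
    have "m (tensor_assoc C (tens ?CC C (comult C a) b)) =
        tensor_lift C (\<lambda>a c. S a \<otimes>\<^bsub>C\<^esub> c) (comult C a) \<otimes>\<^bsub>C\<^esub> T b"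
      by (rule tensor_linear_eqI[OF sp sp
            Q_linear_comp[OF tens_linear_left[OF CC sp ab(2)] Q_linear_comp[OF Al ml]]
            Q_linear_comp[OF Slin mult_linear_left[OF Tc[OF ab(2)]]] dc[OF ab(1)]])
        (simp add: At mt nt ab Sc Tc tens_closed[OF sp sp] tensor_lift_tens[OF sp sp sp Sb] m_assoc)
    then show "m (tensor_assoc C (tensor_map ?CC C (comult C) (\<lambda>b. b) (tens C C a b))) =
        T (tensor_lift C (\<lambda>a b. counit C a \<odot>\<^bsub>C\<^esub> b) (tens C C a b))"
      using ab by (simp add: Et antipodeD(2)[OF S] tensor_lift_tens[OF sp sp sp eb(1)]
          Q_linear_smult[OF Tl] smult_mult_left Tc)
  qed
  also have "\<dots> = T x"
    by (simp add: D(7) x)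
  finally show ?thesis .
qed

text \<open>
  This is \<open>hopf_iso\<close> without the clause on antipodes, which is a consequence of the others
  when both sides are bialgebras.
\<close>

definition bialg_iso :: "('v, 'c) bialg_scheme \<Rightarrow> ('w, 'd) bialg_scheme \<Rightarrow> ('v \<Rightarrow> 'w) set" where
  "bialg_iso B C = {\<phi>. bij_betw \<phi> (carrier B) (carrier C) \<and> \<phi> \<in> Q_linear B C \<and> \<phi> \<in> ring_hom B C \<and>
     (\<forall>x \<in> carrier B. tensor_map C C \<phi> \<phi> (comult B x) = comult C (\<phi> x)) \<and>
     (\<forall>x \<in> carrier B. counit C (\<phi> x) = counit B x)}"

lemma bialg_isoD:
  assumes "\<phi> \<in> bialg_iso B C"
  shows "bij_betw \<phi> (carrier B) (carrier C)" "\<phi> \<in> Q_linear B C" "\<phi> \<in> ring_hom B C"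
    "\<And>x. x \<in> carrier B \<Longrightarrow> tensor_map C C \<phi> \<phi> (comult B x) = comult C (\<phi> x)"
    "\<And>x. x \<in> carrier B \<Longrightarrow> counit C (\<phi> x) = counit B x"
  using assms unfolding bialg_iso_def by auto

lemma Q_linear_inv_into:
  assumes "Q_space V" "bij_betw \<phi> (carrier V) (carrier W)" "\<phi> \<in> Q_linear V W"
  shows "inv_into (carrier V) \<phi> \<in> Q_linear W V"
proof -
  interpret V: Q_space V by fact
  let ?\<psi> = "inv_into (carrier V) \<phi>"
  note l = Q_linear_closed[OF assms(3)] Q_linear_add[OF assms(3), symmetric] Q_linear_smult[OF assms(3), symmetric]
  have inv: "?\<psi> (\<phi> x) = x" if "x \<in> carrier V" for x
    using assms(2) that by (rule bij_betw_inv_into_left)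
  have surj: "\<exists>x\<in>carrier V. y = \<phi> x" if "y \<in> carrier W" for y
    using assms(2) that by (auto simp: bij_betw_def)
  show ?thesis
    by (rule Q_linearI) (auto dest!: surj simp: l inv)
qed

text \<open>
  The inverse is compatible with the coproducts because \<open>\<psi> \<otimes> \<psi>\<close> is inverse to \<open>\<phi> \<otimes> \<phi>\<close>.
\<close>

lemma bialg_iso_inverse:
  fixes B :: "('v, 'c) bialg_scheme" and C :: "('w, 'd) bialg_scheme"
  assumes B: "Q_algebra B" "comult B \<in> Q_linear B (tensor B B)" and C: "Q_algebra C"
    and iso: "\<phi> \<in> bialg_iso B C"
  shows "inv_into (carrier B) \<phi> \<in> bialg_iso C B"
  unfolding bialg_iso_def mem_Collect_eq
proof (intro conjI ballI)
  interpret B: Q_alg B by unfold_locales fact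
  interpret C: Q_alg C by unfold_locales fact
  let ?\<psi> = "inv_into (carrier B) \<phi>"
  note sp = B.Q_space_axioms C.Q_space_axioms
  note \<phi> = bialg_isoD[OF iso]
  note \<phi>c = Q_linear_closed[OF \<phi>(2)]
  have \<psi>\<phi>: "x \<in> carrier B \<Longrightarrow> ?\<psi> (\<phi> x) = x" for x
    using \<phi>(1) by (rule bij_betw_inv_into_left)
  have \<phi>\<psi>: "y \<in> carrier C \<Longrightarrow> \<phi> (?\<psi> y) = y" for y
    using \<phi>(1) by (rule bij_betw_inv_into_right)
  show "bij_betw ?\<psi> (carrier C) (carrier B)"
    by (rule bij_betw_inv_into[OF \<phi>(1)])
  show \<psi>l: "?\<psi> \<in> Q_linear C B"
    by (rule Q_linear_inv_into[OF sp(1) \<phi>(1,2)])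
  note \<psi>c = Q_linear_closed[OF \<psi>l]
  show "?\<psi> \<in> ring_hom C B"
  proof (rule Q_linear_ring_homI[OF \<psi>l])
    show "?\<psi> \<one>\<^bsub>C\<^esub> = \<one>\<^bsub>B\<^esub>"
      using \<psi>\<phi>[OF B.one_closed] by (simp add: ring_homE[OF \<phi>(3)])
    fix y y' assume "y \<in> carrier C" "y' \<in> carrier C"
    then show "?\<psi> (y \<otimes>\<^bsub>C\<^esub> y') = ?\<psi> y \<otimes>\<^bsub>B\<^esub> ?\<psi> y'"
      using \<psi>\<phi>[of "?\<psi> y \<otimes>\<^bsub>B\<^esub> ?\<psi> y'"] by (simp add: ring_homE[OF \<phi>(3)] \<psi>c \<phi>\<psi>)
  qed
  fix y assume y: "y \<in> carrier C"
  note dc = Q_linear_closed[OF B(2) \<psi>c[OF y]]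
  note \<phi>\<phi>l = tensor_map_linear[OF sp(1,1,2,2) \<phi>(2,2)]
    and \<phi>\<phi>t = tensor_map_tens[OF sp(1,1,2,2) \<phi>(2,2)]
  note \<psi>\<psi>l = tensor_map_linear[OF sp(2,2,1,1) \<psi>l \<psi>l]
    and \<psi>\<psi>t = tensor_map_tens[OF sp(2,2,1,1) \<psi>l \<psi>l]
  have "tensor_map B B ?\<psi> ?\<psi> (tensor_map C C \<phi> \<phi> (comult B (?\<psi> y))) = comult B (?\<psi> y)"
    by (rule tensor_linear_eqI[OF sp(1,1) Q_linear_comp[OF \<phi>\<phi>l \<psi>\<psi>l] Q_linear_id dc])
      (simp add: \<phi>\<phi>t \<psi>\<psi>t \<phi>c \<psi>\<phi>)
  then show "tensor_map B B ?\<psi> ?\<psi> (comult C y) = comult B (?\<psi> y)"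
    by (simp add: \<phi>(4) \<psi>c \<phi>\<psi> y)
  show "counit B (?\<psi> y) = counit C y"
    using \<phi>(5)[OF \<psi>c[OF y]] by (simp add: \<phi>\<psi> y)
qed

text \<open>
  A bialgebra structure may be transported along an isomorphism of algebras that respects coproducts
  and counits.  The target is only required to be an algebra; that it is a bialgebra is proved below.
\<close>

locale bialg_isomorphism =
  fixes B :: "('v, 'c) bialg_scheme" and C :: "('w, 'd) bialg_scheme" and \<phi>
  assumes B: "bialgebra B" and C: "Q_algebra C" and iso: "\<phi> \<in> bialg_iso B C"
begin

interpretation B: Q_alg B by unfold_locales (rule bialgebraD(1)[OF B])
interpretation C: Q_alg C by unfold_locales (rule C)

abbreviation \<psi> where "\<psi> \<equiv> inv_into (carrier B) \<phi>"
abbreviation "BB \<equiv> tensor B B"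
abbreviation "CC \<equiv> tensor C C"

interpretation BB: Q_alg BB by unfold_locales (intro Q_algebra_tensor B.is_algebra)
interpretation CC: Q_alg CC by unfold_locales (intro Q_algebra_tensor C)

lemmas \<phi> = bialg_isoD[OF iso]
lemmas \<phi>c = Q_linear_closed[OF \<phi>(2)]
lemmas sp = B.Q_space_axioms C.Q_space_axioms BB.Q_space_axioms CC.Q_space_axioms
lemmas DB = bialgebraD[OF B]
lemmas \<phi>a = Q_linear_add[OF \<phi>(2)] Q_linear_smult[OF \<phi>(2)] ring_homE[OF \<phi>(3)]

lemma \<psi>\<phi>: "x \<in> carrier B \<Longrightarrow> \<psi> (\<phi> x) = x"
  using \<phi>(1) by (rule bij_betw_inv_into_left)

lemma \<phi>\<psi>: "y \<in> carrier C \<Longrightarrow> \<phi> (\<psi> y) = y"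
  using \<phi>(1) by (rule bij_betw_inv_into_right)

lemma \<phi>_surjE: assumes "y \<in> carrier C" obtains x where "x \<in> carrier B" "y = \<phi> x"
  using \<phi>(1) assms by (auto simp: bij_betw_def)

lemma \<psi>_linear: "\<psi> \<in> Q_linear C B"
  by (rule Q_linear_inv_into[OF sp(1) \<phi>(1,2)])

lemmas \<psi>c = Q_linear_closed[OF \<psi>_linear]

abbreviation "\<phi>\<phi> \<equiv> tensor_map C C \<phi> \<phi>"

lemmas \<phi>\<phi>l = tensor_map_linear[OF sp(1,1,2,2) \<phi>(2,2)]
lemmas \<phi>\<phi>t = tensor_map_tens[OF sp(1,1,2,2) \<phi>(2,2)]

lemma comult_linear: "comult C \<in> Q_linear C CC"
proof (rule Q_linearI)
  fix y assume "y \<in> carrier C"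
  then obtain x where x: "x \<in> carrier B" "y = \<phi> x" by (rule \<phi>_surjE)
  then show "comult C y \<in> carrier CC"
    using Q_linear_closed[OF \<phi>\<phi>l Q_linear_closed[OF DB(2)]] by (simp flip: \<phi>(4))
  show "comult C (c \<odot>\<^bsub>C\<^esub> y) = c \<odot>\<^bsub>CC\<^esub> comult C y" for c
    using x by (simp flip: \<phi>a(2) \<phi>(4) add: Q_linear_smult[OF DB(2)] Q_linear_smult[OF \<phi>\<phi>l]
        Q_linear_closed[OF DB(2)])
  fix y' assume "y' \<in> carrier C"
  then obtain x' where x': "x' \<in> carrier B" "y' = \<phi> x'" by (rule \<phi>_surjE)
  show "comult C (y \<oplus>\<^bsub>C\<^esub> y') = comult C y \<oplus>\<^bsub>CC\<^esub> comult C y'"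
    using x x' by (simp flip: \<phi>a(1) \<phi>(4) add: Q_linear_add[OF DB(2)] Q_linear_add[OF \<phi>\<phi>l]
        Q_linear_closed[OF DB(2)])
qed

lemma counit_linear: "counit C \<in> Q_linear C QQ"
proof (rule Q_linearI)
  fix y assume "y \<in> carrier C"
  then obtain x where x: "x \<in> carrier B" "y = \<phi> x" by (rule \<phi>_surjE)
  show "counit C (c \<odot>\<^bsub>C\<^esub> y) = c \<odot>\<^bsub>QQ\<^esub> counit C y" for c
    using x by (simp flip: \<phi>a(2) add: \<phi>(5) Q_linear_smult[OF DB(3)])
  fix y' assume "y' \<in> carrier C"
  then obtain x' where x': "x' \<in> carrier B" "y' = \<phi> x'" by (rule \<phi>_surjE)
  show "counit C (y \<oplus>\<^bsub>C\<^esub> y') = counit C y \<oplus>\<^bsub>QQ\<^esub> counit C y'"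
    using x x' by (simp flip: \<phi>a(1) add: \<phi>(5) Q_linear_add[OF DB(3)])
qed simp

text \<open>
  The naturality of lifts along \<open>\<phi>\<close>; both counit laws and both antipode laws are instances.
\<close>

lemma tensor_lift_\<phi>\<phi>:
  assumes "\<beta> \<in> Q_bilinear C C C" "\<gamma> \<in> Q_bilinear B B B" "t \<in> carrier BB"
    and "\<And>a b. a \<in> carrier B \<Longrightarrow> b \<in> carrier B \<Longrightarrow> \<beta> (\<phi> a) (\<phi> b) = \<phi> (\<gamma> a b)"
  shows "tensor_lift C \<beta> (\<phi>\<phi> t) = \<phi> (tensor_lift B \<gamma> t)"
  by (rule tensor_linear_eqI[OF sp(1,1) Q_linear_comp[OF \<phi>\<phi>l tensor_lift_linear[OF sp(2,2,2) assms(1)]]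
        Q_linear_comp[OF tensor_lift_linear[OF sp(1,1,1) assms(2)] \<phi>(2)] assms(3)])
    (simp add: \<phi>\<phi>t \<phi>c tensor_lift_tens[OF sp(2,2,2) assms(1)] tensor_lift_tens[OF sp(1,1,1) assms(2)] assms(4))

text \<open>
  Each of the two iterated coproducts of \<open>\<phi> x\<close> is the image of the corresponding iterated coproduct
  of \<open>x\<close> under the map induced by \<open>\<phi>\<close> on threefold tensor products.
\<close>

lemma comult_coassociative:
  assumes x: "x \<in> carrier B"
  shows "tensor_assoc C (tensor_map CC C (comult C) (\<lambda>b. b) (comult C (\<phi> x))) =
        tensor_map C CC (\<lambda>a. a) (comult C) (comult C (\<phi> x))"
proof -
  note Dl = tensor_map_linear[OF sp(1,1,1,3) Q_linear_id DB(2)]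
    and Dt = tensor_map_tens[OF sp(1,1,1,3) Q_linear_id DB(2)]
  note El = tensor_map_linear[OF sp(1,1,3,1) DB(2) Q_linear_id]
    and Et = tensor_map_tens[OF sp(1,1,3,1) DB(2) Q_linear_id]
  note Dl' = tensor_map_linear[OF sp(2,2,2,4) Q_linear_id comult_linear]
    and Dt' = tensor_map_tens[OF sp(2,2,2,4) Q_linear_id comult_linear]
  note El' = tensor_map_linear[OF sp(2,2,4,2) comult_linear Q_linear_id]
    and Et' = tensor_map_tens[OF sp(2,2,4,2) comult_linear Q_linear_id]
  note Ll = tensor_map_linear[OF sp(3,1,4,2) \<phi>\<phi>l \<phi>(2)] and Lt = tensor_map_tens[OF sp(3,1,4,2) \<phi>\<phi>l \<phi>(2)]
  note Rl = tensor_map_linear[OF sp(1,3,2,4) \<phi>(2) \<phi>\<phi>l] and Rt = tensor_map_tens[OF sp(1,3,2,4) \<phi>(2) \<phi>\<phi>l]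
  note Al = tensor_assoc_linear[OF sp(1)] and At = tensor_assoc_tens[OF sp(1)]
  note Al' = tensor_assoc_linear[OF sp(2)] and At' = tensor_assoc_tens[OF sp(2)]
  note dc = Q_linear_closed[OF DB(2)]
  have 1: "tensor_map CC C (comult C) (\<lambda>b. b) (\<phi>\<phi> t) =
      tensor_map CC C \<phi>\<phi> \<phi> (tensor_map BB B (comult B) (\<lambda>b. b) t)" if "t \<in> carrier BB" for t
    by (rule tensor_linear_eqI[OF sp(1,1) Q_linear_comp[OF \<phi>\<phi>l El'] Q_linear_comp[OF El Ll] that])
      (simp add: \<phi>\<phi>t Et Et' Lt \<phi>c dc \<phi>(4))
  have 2: "tensor_map C CC (\<lambda>b. b) (comult C) (\<phi>\<phi> t) =
      tensor_map C CC \<phi> \<phi>\<phi> (tensor_map B BB (\<lambda>b. b) (comult B) t)" if "t \<in> carrier BB" for t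
    by (rule tensor_linear_eqI[OF sp(1,1) Q_linear_comp[OF \<phi>\<phi>l Dl'] Q_linear_comp[OF Dl Rl] that])
      (simp add: \<phi>\<phi>t Dt Dt' Rt \<phi>c dc \<phi>(4))
  have 3: "tensor_assoc C (tensor_map CC C \<phi>\<phi> \<phi> u) = tensor_map C CC \<phi> \<phi>\<phi> (tensor_assoc B u)"
    if "u \<in> carrier (tensor BB B)" for u
    by (rule tensor_left_linear_eqI[OF sp(1,1,1) Q_linear_comp[OF Ll Al'] Q_linear_comp[OF Al Rl] that])
      (simp add: Lt Rt At At' \<phi>\<phi>t \<phi>c tens_closed[OF sp(1,1)])
  show ?thesis
    using dc[OF x] Q_linear_closed[OF El dc[OF x]] by (simp add: \<phi>(4)[OF x, symmetric] 1 2 3 DB(6) x)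
qed

lemma bialgebra_target: "bialgebra C"
  unfolding bialgebra_def
proof (intro conjI ballI C comult_linear counit_linear)
  fix y assume "y \<in> carrier C"
  then obtain x where x: "x \<in> carrier B" "y = \<phi> x" by (rule \<phi>_surjE)
  show "tensor_assoc C (tensor_map CC C (comult C) (\<lambda>b. b) (comult C y)) =
        tensor_map C CC (\<lambda>a. a) (comult C) (comult C y)"
    using x comult_coassociative by simp
  show "tensor_lift C (\<lambda>a b. counit C a \<odot>\<^bsub>C\<^esub> b) (comult C y) = y"
    using x tensor_lift_\<phi>\<phi>[OF C.smult_bilinear(1)[OF counit_linear] B.smult_bilinear(1)[OF DB(3)]
        Q_linear_closed[OF DB(2) x(1)]]
    by (simp flip: \<phi>(4) add: \<phi>(5) \<phi>a DB(7))
  show "tensor_lift C (\<lambda>a b. counit C b \<odot>\<^bsub>C\<^esub> a) (comult C y) = y"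
    using x tensor_lift_\<phi>\<phi>[OF C.smult_bilinear(2)[OF counit_linear] B.smult_bilinear(2)[OF DB(3)]
        Q_linear_closed[OF DB(2) x(1)]]
    by (simp flip: \<phi>(4) add: \<phi>(5) \<phi>a DB(8))
next
  have \<phi>\<phi>h: "\<phi>\<phi> \<in> ring_hom BB CC"
    by (intro tensor_map_ring_hom B.is_algebra C \<phi>)
  show "comult C \<in> ring_hom C CC"
  proof (rule Q_linear_ring_homI[OF comult_linear])
    show "comult C \<one>\<^bsub>C\<^esub> = \<one>\<^bsub>CC\<^esub>"
      using \<phi>(4)[OF B.one_closed] by (simp add: \<phi>a(4) ring_homE(2)[OF DB(4)] ring_homE(2)[OF \<phi>\<phi>h])
    fix y y' assume "y \<in> carrier C" "y' \<in> carrier C"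
    then obtain x x' where x: "x \<in> carrier B" "y = \<phi> x" "x' \<in> carrier B" "y' = \<phi> x'"
      by (metis \<phi>_surjE)
    then show "comult C (y \<otimes>\<^bsub>C\<^esub> y') = comult C y \<otimes>\<^bsub>CC\<^esub> comult C y'"
      by (simp flip: \<phi>a(3) \<phi>(4) add: ring_homE(1)[OF DB(4)] ring_homE(1)[OF \<phi>\<phi>h] Q_linear_closed[OF DB(2)])
  qed
  show "counit C \<in> ring_hom C QQ"
  proof (rule Q_linear_ring_homI[OF counit_linear])
    show "counit C \<one>\<^bsub>C\<^esub> = \<one>\<^bsub>QQ\<^esub>"
      using \<phi>(5)[OF B.one_closed] ring_homE(2)[OF DB(5)] by (simp add: \<phi>a(4))
    fix y y' assume "y \<in> carrier C" "y' \<in> carrier C"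
    then obtain x x' where x: "x \<in> carrier B" "y = \<phi> x" "x' \<in> carrier B" "y' = \<phi> x'"
      by (metis \<phi>_surjE)
    then show "counit C (y \<otimes>\<^bsub>C\<^esub> y') = counit C y \<otimes>\<^bsub>QQ\<^esub> counit C y'"
      using ring_homE(1)[OF DB(5)] by (simp flip: \<phi>a(3) add: \<phi>(5))
  qed
qed

lemma antipode_transport:
  assumes S: "antipode B S"
  shows "antipode C (\<lambda>y. \<phi> (S (\<psi> y)))"
proof -
  note Sl = antipodeD(1)[OF S]
  note Sc = Q_linear_closed[OF Sl]
  have Tl: "(\<lambda>y. \<phi> (S (\<psi> y))) \<in> Q_linear C C"
    by (intro Q_linear_comp[OF \<psi>_linear] Q_linear_comp[OF Sl \<phi>(2)])
  show ?thesis
    unfolding antipode_def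
  proof (intro conjI ballI Tl)
    fix y assume "y \<in> carrier C"
    then obtain x where x: "x \<in> carrier B" "y = \<phi> x" by (rule \<phi>_surjE)
    note dx = Q_linear_closed[OF DB(2) x(1)]
    note b1 = Q_bilinear_comp[OF C.mult_bilinear Tl Q_linear_id] Q_bilinear_comp[OF B.mult_bilinear Sl Q_linear_id]
    note b2 = Q_bilinear_comp[OF C.mult_bilinear Q_linear_id Tl] Q_bilinear_comp[OF B.mult_bilinear Q_linear_id Sl]
    show "tensor_lift C (\<lambda>a b. \<phi> (S (\<psi> a)) \<otimes>\<^bsub>C\<^esub> b) (comult C y) = counit C y \<odot>\<^bsub>C\<^esub> \<one>\<^bsub>C\<^esub>"
      using tensor_lift_\<phi>\<phi>[OF b1 dx] x antipodeD(2)[OF S x(1)]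
      by (simp flip: \<phi>(4) add: \<psi>\<phi> \<phi>a Sc \<phi>(5))
    show "tensor_lift C (\<lambda>a b. a \<otimes>\<^bsub>C\<^esub> \<phi> (S (\<psi> b))) (comult C y) = counit C y \<odot>\<^bsub>C\<^esub> \<one>\<^bsub>C\<^esub>"
      using tensor_lift_\<phi>\<phi>[OF b2 dx] x antipodeD(3)[OF S x(1)]
      by (simp flip: \<phi>(4) add: \<psi>\<phi> \<phi>a Sc \<phi>(5))
  qed
qed

text \<open>
  The clause on antipodes holds because \<open>\<phi> \<circ> S \<circ> \<psi>\<close> is an antipode of the target, hence the only one.
\<close>

lemma hopf_isoI: "\<phi> \<in> hopf_iso B C"
  unfolding hopf_iso_def mem_Collect_eq
proof (intro conjI ballI allI impI \<phi>)
  fix S T x assume "antipode B S" "antipode C T" "x \<in> carrier B"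
  then show "\<phi> (S x) = T (\<phi> x)"
    using antipode_unique[OF bialgebra_target antipode_transport, of S T "\<phi> x"] by (simp add: \<psi>\<phi> \<phi>c)
qed

end

section \<open>Universal enveloping algebras\<close>

subsection \<open>The free algebra\<close>

lemma free_algebra_simps [simp]:
  "monoid.mult (free_algebra G) = (*)" "one (free_algebra G) = 1"
  "zero (free_algebra G) = 0" "add (free_algebra G) = (+)"
  "smult (free_algebra G) = (\<lambda>c. Poly_Mapping.map ((*) c))"
  by (simp_all add: free_algebra_def)

definition words_over :: "'g set \<Rightarrow> 'g word set" where
  "words_over G = {w. set (letters w) \<subseteq> G}"

lemma words_over_simps [simp]: "0 \<in> words_over G"
  "v \<in> words_over G \<Longrightarrow> w \<in> words_over G \<Longrightarrow> v + w \<in> words_over G"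
  "Word ws \<in> words_over G \<longleftrightarrow> set ws \<subseteq> G"
  by (auto simp: words_over_def zero_word_def plus_word_def)

lemma letters_zero [simp]: "letters 0 = []"
  by (simp add: zero_word_def)

lemma free_algebra_carrier: "carrier (free_algebra G) = carrier (free_space (words_over G))"
  by (auto simp: free_algebra_def words_over_def)

lemma Q_linear_free_algebra: "Q_linear (free_algebra G) Z = Q_linear (free_space (words_over G)) Z"
  by (simp add: Q_linear_def free_algebra_carrier del: free_space_simps(1))

lemma free_algebra_keys: "t \<in> carrier (free_algebra G) \<longleftrightarrow> Poly_Mapping.keys t \<subseteq> words_over G"
  by (simp add: free_algebra_carrier)

lemma free_algebra_single [simp]:
  "w \<in> words_over G \<Longrightarrow> Poly_Mapping.single w c \<in> carrier (free_algebra G)"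
  by (simp add: free_algebra_keys)

lemma free_algebra_closed [simp]:
  assumes "s \<in> carrier (free_algebra G)" "t \<in> carrier (free_algebra G)"
  shows "s + t \<in> carrier (free_algebra G)" "s - t \<in> carrier (free_algebra G)"
    "s * t \<in> carrier (free_algebra G)"
proof -
  show "s * t \<in> carrier (free_algebra G)"
    unfolding free_algebra_keys
  proof
    fix w assume "w \<in> Poly_Mapping.keys (s * t)"
    then obtain u v where "w = u + v" "u \<in> Poly_Mapping.keys s" "v \<in> Poly_Mapping.keys t"
      using Poly_Mapping.keys_mult[of s t] by blast
    then show "w \<in> words_over G"
      using assms words_over_simps(2)[of u G v] by (auto simp: free_algebra_keys simp del: words_over_simps)
  qed
qed (use assms Poly_Mapping.keys_add[of s t] Poly_Mapping.keys_diff[of s t]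
    in \<open>auto simp: free_algebra_keys\<close>)

lemma free_algebra_closed' [simp]:
  assumes "t \<in> carrier (free_algebra G)"
  shows "- t \<in> carrier (free_algebra G)" "Poly_Mapping.map ((*) c) t \<in> carrier (free_algebra G)"
  using assms keys_map_times[of c t] by (auto simp: free_algebra_keys)

lemma free_algebra_one [simp]: "1 \<in> carrier (free_algebra G)" "0 \<in> carrier (free_algebra G)"
  by (auto simp: free_algebra_keys simp flip: single_one)

lemma map_times_mult:
  "Poly_Mapping.map ((*) c) t = Poly_Mapping.single 0 c * (t :: 'g word \<Rightarrow>\<^sub>0 rat)"
  by (simp add: mult_map_scale_conv_mult)

lemma map_times_mult_right:
  "s * Poly_Mapping.map ((*) c) t = Poly_Mapping.map ((*) c) (s * t :: 'g word \<Rightarrow>\<^sub>0 rat)"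
proof -
  have "s * Poly_Mapping.single 0 c = Poly_Mapping.single 0 c * s"
    using subset_UNIV[of "Poly_Mapping.keys s"]
    by (induction s rule: keys_subset_induct)
      (simp_all add: distrib_left distrib_right mult_single mult.commute)
  then show ?thesis
    unfolding map_times_mult by (metis mult.assoc)
qed

lemma Q_algebra_free_algebra: "Q_algebra (free_algebra G)"
proof (rule Q_algebraI)
  show "Q_space (free_algebra G)"
  proof (intro Q_space.intro moduleI cring_QQ abelian_groupI)
    fix x assume "x \<in> carrier (free_algebra G)"
    then show "\<exists>y\<in>carrier (free_algebra G). y \<oplus>\<^bsub>free_algebra G\<^esub> x = \<zero>\<^bsub>free_algebra G\<^esub>"
      by (intro bexI[of _ "- x"]) auto
  qed (auto intro!: poly_mapping_eqI simp: lookup_add algebra_simps)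
  show "(\<lambda>x y. x \<otimes>\<^bsub>free_algebra G\<^esub> y) \<in> Q_bilinear (free_algebra G) (free_algebra G) (free_algebra G)"
    by (auto intro!: Q_bilinearI Q_linearI simp: distrib_left distrib_right map_times_mult_right)
      (simp add: map_times_mult mult.assoc)
qed (auto simp: mult.assoc)

subsection \<open>Products of words\<close>

definition word_prod :: "('z, 'c) ring_scheme \<Rightarrow> ('g \<Rightarrow> 'z) \<Rightarrow> 'g list \<Rightarrow> 'z" where
  "word_prod Z j ws = foldr (\<lambda>x z. j x \<otimes>\<^bsub>Z\<^esub> z) ws \<one>\<^bsub>Z\<^esub>"

lemma word_prod_simps [simp]:
  "word_prod Z j [] = \<one>\<^bsub>Z\<^esub>" "word_prod Z j (x # ws) = j x \<otimes>\<^bsub>Z\<^esub> word_prod Z j ws"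
  by (simp_all add: word_prod_def)

lemma (in ring) word_prod_closed: "j ` set ws \<subseteq> carrier R \<Longrightarrow> word_prod R j ws \<in> carrier R"
  by (induction ws) auto

lemma (in ring) word_prod_append:
  "j ` set vs \<subseteq> carrier R \<Longrightarrow> j ` set ws \<subseteq> carrier R \<Longrightarrow>
    word_prod R j (vs @ ws) = word_prod R j vs \<otimes> word_prod R j ws"
  by (induction vs) (auto simp: m_assoc word_prod_closed)

lemma word_prod_hom:
  assumes "h \<in> ring_hom R S" "ring R" "j ` set ws \<subseteq> carrier R"
  shows "h (word_prod R j ws) = word_prod S (\<lambda>x. h (j x)) ws"
proof -
  interpret ring R by fact
  show ?thesis
    using assms(3) by (induction ws) (auto simp: ring_homE[OF assms(1)] word_prod_closed)
qed

lemma word_prod_cong: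
  "(\<And>x. x \<in> set ws \<Longrightarrow> j x = k x) \<Longrightarrow> word_prod Z j ws = word_prod Z k ws"
  by (induction ws) auto

subsection \<open>The algebra map out of the free algebra\<close>

context
  fixes Z :: "(rat, 'z, 'c) module_scheme" and j :: "'g \<Rightarrow> 'z" and G
  assumes Z: "Q_algebra Z" and j: "j ` G \<subseteq> carrier Z"
begin

interpretation Z: Q_alg Z by unfold_locales (rule Z)
interpretation F: Q_alg "free_algebra G" by unfold_locales (rule Q_algebra_free_algebra)

definition free_lift where
  "free_lift t = lincomb Z (\<lambda>w. word_prod Z j (letters w)) (Poly_Mapping.lookup t)"

lemma word_prod_words_over: "w \<in> words_over G \<Longrightarrow> word_prod Z j (letters w) \<in> carrier Z"
  using j by (intro Z.word_prod_closed) (auto simp: words_over_def)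

lemma free_lift_linear: "free_lift \<in> Q_linear (free_algebra G) Z"
  unfolding Q_linear_free_algebra free_lift_def[abs_def]
  by (rule free_space_lincomb_linear[OF Z.Q_space_axioms]) (auto intro: word_prod_words_over)

lemma free_lift_single:
  "w \<in> words_over G \<Longrightarrow> free_lift (Poly_Mapping.single w c) = c \<odot>\<^bsub>Z\<^esub> word_prod Z j (letters w)"
  unfolding free_lift_def by (rule Z.lincomb_lookup_single) (rule word_prod_words_over)

lemma free_lift_one: "free_lift 1 = \<one>\<^bsub>Z\<^esub>"
  using free_lift_single[of 0 1] by simp

lemma free_lift_gen: "x \<in> G \<Longrightarrow> free_lift (gen x) = j x"
  using free_lift_single[of "Word [x]" 1] j by (auto simp: gen_def)

lemma free_lift_mult:
  assumes "s \<in> carrier (free_algebra G)" "t \<in> carrier (free_algebra G)"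
  shows "free_lift (s * t) = free_lift s \<otimes>\<^bsub>Z\<^esub> free_lift t"
proof -
  note l = Q_linear_closed[OF free_lift_linear] Q_linear_add[OF free_lift_linear, simplified]
  have z: "free_lift 0 = \<zero>\<^bsub>Z\<^esub>"
    using Q_linear_zero[OF F.Q_space_axioms Z.Q_space_axioms free_lift_linear] by simp
  show ?thesis
    using assms(1) unfolding free_algebra_keys
  proof (induction s rule: keys_subset_induct)
    case (add s s')
    then show ?case
      using assms(2) by (simp add: free_algebra_keys[symmetric] distrib_right l Z.l_distr)
  next
    case (single v c)
    show ?case
      using assms(2) unfolding free_algebra_keys
    proof (induction t rule: keys_subset_induct)
      case (add t t')
      then show ?case
        using single by (simp add: free_algebra_keys[symmetric] distrib_left l Z.r_distr)
    next
      case (single w d)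
      have "word_prod Z j (letters (v + w)) = word_prod Z j (letters v) \<otimes>\<^bsub>Z\<^esub> word_prod Z j (letters w)"
        using Z.word_prod_append[of j "letters v" "letters w"] j \<open>v \<in> words_over G\<close> single
        by (auto simp: words_over_def plus_word_def)
      then show ?case
        using single \<open>v \<in> words_over G\<close> word_prod_words_over
        by (simp add: mult_single free_lift_single Z.smult_mult_left Z.smult_mult_right
              Z.smult_assoc[symmetric] mult.commute)
    qed (use single l in \<open>simp add: z\<close>)
  qed (use assms(2) l in \<open>simp add: z\<close>)
qed

lemma free_lift_kernel_ideal:
  "ideal {t \<in> carrier (free_algebra G). free_lift t = \<zero>\<^bsub>Z\<^esub>} (free_algebra G)"
proof (rule idealI)
  show "ring (free_algebra G)" by (rule F.ring_axioms)
  show "subgroup {t \<in> carrier (free_algebra G). free_lift t = \<zero>\<^bsub>Z\<^esub>} (add_monoid (free_algebra G))"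
    using kernel_submodule[OF F.Q_space_axioms Z.Q_space_axioms free_lift_linear]
    by (rule submodule.axioms(1))
qed (auto simp: free_lift_mult Q_linear_closed[OF free_lift_linear])

lemma free_lift_diff:
  assumes "s \<in> carrier (free_algebra G)" "t \<in> carrier (free_algebra G)"
  shows "free_lift (s - t) = free_lift s \<ominus>\<^bsub>Z\<^esub> free_lift t"
proof -
  have "s - t = s + Poly_Mapping.map ((*) (-1)) t"
    by (auto intro!: poly_mapping_eqI simp: lookup_minus lookup_add)
  then have "free_lift (s - t) = free_lift (s + Poly_Mapping.map ((*) (-1)) t)"
    by (rule arg_cong)
  also have "\<dots> = free_lift s \<oplus>\<^bsub>Z\<^esub> (-1) \<odot>\<^bsub>Z\<^esub> free_lift t"
    using assms Q_linear_add[OF free_lift_linear, of s "Poly_Mapping.map ((*) (-1)) t"]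
      Q_linear_smult[OF free_lift_linear, of t "-1"] by simp
  finally show ?thesis
    using assms Q_linear_closed[OF free_lift_linear] by (simp add: a_minus_def Z.smult_minus_one)
qed

end


subsection \<open>The enveloping algebra and its universal property\<close>

text \<open>
  The coproduct of an enveloping algebra takes values in the tensor square of the underlying algebra.
  By this lemma the latter is the tensor square of the bialgebra itself.
\<close>

lemma tensor_cong:
  assumes "carrier V = carrier V'" "add V = add V'" "smult V = smult V'" "monoid.mult V = monoid.mult V'" "one V = one V'"
    and "carrier W = carrier W'" "add W = add W'" "smult W = smult W'" "monoid.mult W = monoid.mult W'" "one W = one W'"
  shows "tensor V W = tensor V' W'" "tens V W = tens V' W'"
  using assms
  by (simp_all add: tensor_def tensor_space_def tensor_null_def tens_def[abs_def] Let_def fun_eq_iff)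

text \<open>
  A rational vector space with a bracket: the setting in which the enveloping algebra is a Hopf
  algebra with the universal property for linear maps that turn brackets into commutators.
\<close>

locale Q_bracket = Q_space g for g :: "(rat, 'g, 'c) module_scheme" (structure) +
  fixes br :: "'g \<Rightarrow> 'g \<Rightarrow> 'g"
  assumes br_closed: "x \<in> carrier g \<Longrightarrow> y \<in> carrier g \<Longrightarrow> br x y \<in> carrier g"
begin

abbreviation "F \<equiv> free_algebra (carrier g)"
abbreviation "I \<equiv> env_ideal g br"
abbreviation "E \<equiv> enveloping g br"
abbreviation "\<iota> \<equiv> env_incl g br"

interpretation F: Q_alg F by unfold_locales (rule Q_algebra_free_algebra)

definition env_relations where
  "env_relations = {gen (x \<oplus> y) - gen x - gen y | x y. x \<in> carrier g \<and> y \<in> carrier g} \<union>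
      {gen (c \<odot> x) - Poly_Mapping.map ((*) c) (gen x) | c x. x \<in> carrier g} \<union>
      {gen x * gen y - gen y * gen x - gen (br x y) | x y. x \<in> carrier g \<and> y \<in> carrier g}"

lemma env_relationsI:
  "x \<in> carrier g \<Longrightarrow> y \<in> carrier g \<Longrightarrow> gen (x \<oplus> y) - (gen x + gen y) \<in> env_relations"
  "x \<in> carrier g \<Longrightarrow> gen (c \<odot> x) - Poly_Mapping.map ((*) c) (gen x) \<in> env_relations"
  "x \<in> carrier g \<Longrightarrow> y \<in> carrier g \<Longrightarrow>
    gen x * gen y - (gen y * gen x + gen (br x y)) \<in> env_relations"
  unfolding env_relations_def diff_diff_eq[symmetric] by blast+

lemma env_ideal_eq: "I = Idl\<^bsub>F\<^esub> env_relations"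
  by (simp add: env_ideal_def env_relations_def)

lemma gen_closed [simp]: "x \<in> carrier g \<Longrightarrow> gen x \<in> carrier F"
  by (simp add: gen_def)

lemma env_relations_subset: "env_relations \<subseteq> carrier F"
  unfolding env_relations_def
  by (intro Un_least subsetI; elim CollectE exE conjE; simp add: br_closed)

interpretation I: ideal I F
  unfolding env_ideal_eq by (rule F.genideal_ideal[OF env_relations_subset])

lemma env_ideal_submodule: "submodule I QQ F"
proof (rule F.submoduleI)
  show "c \<odot>\<^bsub>F\<^esub> x \<in> I" if "x \<in> I" for c x
    using I.I_l_closed[OF that, of "Poly_Mapping.single 0 c"] by (simp add: map_times_mult)
  show "I \<subseteq> carrier F" by (rule I.a_subset)
  show "\<zero>\<^bsub>F\<^esub> \<in> I" by (rule additive_subgroup.zero_closed[OF I.is_additive_subgroup])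
  show "a \<oplus>\<^bsub>F\<^esub> b \<in> I" if "a \<in> I" "b \<in> I" for a b
    by (rule additive_subgroup.a_closed[OF I.is_additive_subgroup that])
qed

interpretation Q: Q_quotient F I
  by (intro Q_quotient.intro F.Q_space_axioms Q_quotient_axioms.intro env_ideal_submodule)

definition quo where "quo t = I +>\<^bsub>F\<^esub> t"

lemma enveloping_simps:
  "carrier E = a_rcosets\<^bsub>F\<^esub> I" "zero E = I" "add E = set_add F"
  "smult E = (\<lambda>c T. \<Union>t\<in>T. I +>\<^bsub>F\<^esub> (c \<odot>\<^bsub>F\<^esub> t))"
  "monoid.mult E = rcoset_mult F I" "one E = quo 1"
  by (simp_all add: enveloping_def env_algebra_def Let_def FactRing_def ring.defs module.defs quo_def)

lemma env_algebra_simps: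
  "carrier (env_algebra g br) = carrier E" "zero (env_algebra g br) = zero E"
  "add (env_algebra g br) = add E" "smult (env_algebra g br) = smult E"
  "monoid.mult (env_algebra g br) = monoid.mult E" "one (env_algebra g br) = one E"
  by (simp_all add: enveloping_def Let_def module.defs)

lemma comult_enveloping:
  "comult E = env_lift (tensor E E) (\<lambda>x. tens E E (\<iota> x) \<one>\<^bsub>E\<^esub> \<oplus>\<^bsub>tensor E E\<^esub> tens E E \<one>\<^bsub>E\<^esub> (\<iota> x))"
proof -
  note c = tensor_cong[OF env_algebra_simps(1,3,4,5,6) env_algebra_simps(1,3,4,5,6)]
  have "comult E = env_lift (tensor (env_algebra g br) (env_algebra g br))
      (\<lambda>x. tens (env_algebra g br) (env_algebra g br) (\<iota> x) \<one>\<^bsub>env_algebra g br\<^esub>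
        \<oplus>\<^bsub>tensor (env_algebra g br) (env_algebra g br)\<^esub>
        tens (env_algebra g br) (env_algebra g br) \<one>\<^bsub>env_algebra g br\<^esub> (\<iota> x))"
    by (simp add: enveloping_def Let_def module.defs)
  then show ?thesis
    by (simp only: c env_algebra_simps)
qed

lemma counit_enveloping: "counit E = env_lift QQ (\<lambda>_. 0)"
  by (simp add: enveloping_def Let_def module.defs)

lemma Q_space_enveloping: "Q_space E"
  by (rule Q.quotient_space(1)) (simp_all only: enveloping_simps)

lemma quo_linear: "quo \<in> Q_linear F E"
  unfolding quo_def[abs_def] by (rule Q.quotient_space(2)) (simp_all only: enveloping_simps)

lemma quo_mult: "s \<in> carrier F \<Longrightarrow> t \<in> carrier F \<Longrightarrow> quo (s * t) = quo s \<otimes>\<^bsub>E\<^esub> quo t"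
  using I.rcoset_mult_add[of s t] by (simp add: enveloping_simps quo_def)

lemmas quo_simps = Q_linear_closed[OF quo_linear]
  Q_linear_add[OF quo_linear, simplified] Q_linear_smult[OF quo_linear, simplified]

lemma quo_surjE: assumes "u \<in> carrier E" obtains t where "t \<in> carrier F" "u = quo t"
  using assms by (auto simp: enveloping_simps Q.a_rcosets_eq quo_def)

lemma Q_algebra_enveloping: "Q_algebra E"
proof (rule Q_algebraI[OF Q_space_enveloping])
  have q: "quo s \<oplus>\<^bsub>E\<^esub> quo t = quo (s + t)" "quo s \<otimes>\<^bsub>E\<^esub> quo t = quo (s * t)"
    "c \<odot>\<^bsub>E\<^esub> quo s = quo (Poly_Mapping.map ((*) c) s)"
    if "s \<in> carrier F" "t \<in> carrier F" for s t c
    using that by (simp_all add: quo_simps quo_mult)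
  show "(\<lambda>x y. x \<otimes>\<^bsub>E\<^esub> y) \<in> Q_bilinear E E E"
    by (intro Q_bilinearI Q_linearI; elim quo_surjE;
        simp add: q quo_simps(1) distrib_left distrib_right map_times_mult_right;
        simp add: map_times_mult mult.assoc)
  fix x y z assume "x \<in> carrier E" "y \<in> carrier E" "z \<in> carrier E"
  then show "(x \<otimes>\<^bsub>E\<^esub> y) \<otimes>\<^bsub>E\<^esub> z = x \<otimes>\<^bsub>E\<^esub> (y \<otimes>\<^bsub>E\<^esub> z)"
    by (elim quo_surjE) (simp add: q mult.assoc)
next
  fix x assume "x \<in> carrier E"
  then show "\<one>\<^bsub>E\<^esub> \<otimes>\<^bsub>E\<^esub> x = x" "x \<otimes>\<^bsub>E\<^esub> \<one>\<^bsub>E\<^esub> = x"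
    by (elim quo_surjE; simp add: enveloping_simps(6) quo_mult[symmetric])+
qed (simp add: enveloping_simps(6) quo_simps(1))

interpretation E: Q_alg E by unfold_locales (rule Q_algebra_enveloping)

lemma incl_eq: "\<iota> x = quo (gen x)"
  by (simp add: env_incl_def quo_def)

lemma quo_eqI:
  assumes "s \<in> carrier F" "t \<in> carrier F" "s - t \<in> env_relations"
  shows "quo s = quo t"
proof -
  have "(- t) \<oplus>\<^bsub>F\<^esub> t = \<zero>\<^bsub>F\<^esub>" "- t \<in> carrier F"
    using assms(2) by auto
  then have "s \<ominus>\<^bsub>F\<^esub> t = s - t"
    using F.minus_equality[of "- t" t] assms(2) by (simp add: a_minus_def)
  moreover have "s - t \<in> I"
    using F.genideal_self[OF env_relations_subset] assms(3) by (auto simp: env_ideal_eq)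
  ultimately show ?thesis
    unfolding quo_def using Q.coset_eqI[OF assms(1,2)] by simp
qed

lemma incl_linear: "\<iota> \<in> Q_linear g E"
proof (rule Q_linearI)
  fix x y assume xy: "x \<in> carrier g" "y \<in> carrier g"
  have "quo (gen (x \<oplus> y)) = quo (gen x + gen y)"
    by (rule quo_eqI) (simp_all only: xy a_closed gen_closed free_algebra_closed env_relationsI)
  then show "\<iota> (x \<oplus> y) = \<iota> x \<oplus>\<^bsub>E\<^esub> \<iota> y"
    using xy by (simp add: incl_eq quo_simps)
next
  fix c x assume x: "x \<in> carrier g"
  have "quo (gen (c \<odot> x)) = quo (Poly_Mapping.map ((*) c) (gen x))"
    by (rule quo_eqI) (simp_all only: x smult_closed gen_closed free_algebra_closed' env_relationsI)
  then show "\<iota> (c \<odot> x) = c \<odot>\<^bsub>E\<^esub> \<iota> x"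
    using x by (simp add: incl_eq quo_simps)
qed (simp add: incl_eq quo_simps)

lemmas incl_closed = Q_linear_closed[OF incl_linear]

text \<open>
  The defining relation of the enveloping algebra, in the form \<open>x y = y x + [x, y]\<close>, which avoids
  differences.
\<close>

lemma incl_bracket:
  assumes xy: "x \<in> carrier g" "y \<in> carrier g"
  shows "\<iota> x \<otimes>\<^bsub>E\<^esub> \<iota> y = \<iota> y \<otimes>\<^bsub>E\<^esub> \<iota> x \<oplus>\<^bsub>E\<^esub> \<iota> (br x y)"
proof -
  have "quo (gen x * gen y) = quo (gen y * gen x + gen (br x y))"
    by (rule quo_eqI) (simp_all only: xy br_closed gen_closed free_algebra_closed env_relationsI)
  then show ?thesis
    using xy br_closed[OF xy] by (simp add: incl_eq quo_simps quo_mult)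
qed

lemma word_closed: "set ws \<subseteq> carrier g \<Longrightarrow> word_prod E \<iota> ws \<in> carrier E"
  by (rule E.word_prod_closed) (auto intro: incl_closed)

lemma quo_single:
  "set ws \<subseteq> carrier g \<Longrightarrow> quo (Poly_Mapping.single (Word ws) c) = c \<odot>\<^bsub>E\<^esub> word_prod E \<iota> ws"
proof -
  assume ws: "set ws \<subseteq> carrier g"
  then have 1: "quo (Poly_Mapping.single (Word ws) 1) = word_prod E \<iota> ws"
  proof (induction ws)
    case Nil
    have "Poly_Mapping.single (Word [] :: 'g word) (1::rat) = 1"
      by (simp flip: zero_word_def)
    then show ?case by (simp add: enveloping_simps(6))
  next
    case (Cons x ws)
    have "Poly_Mapping.single (Word (x # ws)) 1 = gen x * Poly_Mapping.single (Word ws) 1"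
      by (simp add: gen_def mult_single plus_word_def)
    then show ?case
      using Cons by (simp add: quo_mult incl_eq)
  qed
  have "quo (Poly_Mapping.map ((*) c) (Poly_Mapping.single (Word ws) 1)) =
      c \<odot>\<^bsub>E\<^esub> quo (Poly_Mapping.single (Word ws) 1)"
    by (rule quo_simps(3)) (use ws in simp)
  then show ?thesis using 1 by simp
qed

lemma enveloping_induct [consumes 1, case_names add smult word]:
  assumes "u \<in> carrier E"
    and "\<And>u v. u \<in> carrier E \<Longrightarrow> v \<in> carrier E \<Longrightarrow> P u \<Longrightarrow> P v \<Longrightarrow> P (u \<oplus>\<^bsub>E\<^esub> v)"
    and "\<And>c u. u \<in> carrier E \<Longrightarrow> P u \<Longrightarrow> P (c \<odot>\<^bsub>E\<^esub> u)"
    and word: "\<And>ws. set ws \<subseteq> carrier g \<Longrightarrow> P (word_prod E \<iota> ws)"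
  shows "P u"
proof -
  have sw: "P (c \<odot>\<^bsub>E\<^esub> word_prod E \<iota> ws)" if "set ws \<subseteq> carrier g" for c ws
    by (rule assms(3)[OF word_closed word]; fact that)
  obtain t where t: "t \<in> carrier F" "u = quo t"
    using assms(1) by (rule quo_surjE)
  have "Poly_Mapping.keys t \<subseteq> words_over (carrier g)"
    using t by (simp add: free_algebra_keys)
  then have "P (quo t)"
  proof (induction t rule: keys_subset_induct)
    case zero
    have "quo 0 = 0 \<odot>\<^bsub>E\<^esub> word_prod E \<iota> []"
      using quo_single[of "[]" 0] by simp
    then show ?case
      using sw[of "[]" 0] by simp
  next
    case (add s t)
    then show ?case
      using assms(2) quo_simps by (simp flip: free_algebra_keys)
  next
    case (single w c)
    then show ?case
      using quo_single[of "letters w" c] sw[of "letters w" c]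
      by (simp add: words_over_def)
  qed
  then show ?thesis by (simp add: t)
qed

lemma enveloping_linear_eqI:
  assumes "f \<in> Q_linear E Z" "h \<in> Q_linear E Z" "u \<in> carrier E"
    and "\<And>ws. set ws \<subseteq> carrier g \<Longrightarrow> f (word_prod E \<iota> ws) = h (word_prod E \<iota> ws)"
  shows "f u = h u"
  using assms(3)
  by (induction rule: enveloping_induct)
    (simp_all add: assms(4) Q_linear_add[OF assms(1)] Q_linear_add[OF assms(2)]
      Q_linear_smult[OF assms(1)] Q_linear_smult[OF assms(2)])

context
  fixes Z :: "(rat, 'z, 'e) module_scheme" and j :: "'g \<Rightarrow> 'z"
  assumes Z: "Q_algebra Z" and lin: "j \<in> Q_linear g Z"
    and lie: "\<And>x y. x \<in> carrier g \<Longrightarrow> y \<in> carrier g \<Longrightarrow> j x \<otimes>\<^bsub>Z\<^esub> j y = j y \<otimes>\<^bsub>Z\<^esub> j x \<oplus>\<^bsub>Z\<^esub> j (br x y)"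
begin

interpretation Z: Q_alg Z by unfold_locales (rule Z)

lemma j_image: "j ` carrier g \<subseteq> carrier Z"
  using Q_linear_closed[OF lin] by auto

abbreviation "fl \<equiv> free_lift Z j"

lemmas fl_linear = free_lift_linear[OF Z j_image]

text \<open>
  The multiplicative extension of \<open>j\<close> kills the generators of the ideal, and its kernel is an ideal.
\<close>

lemma fl_kernel: "t \<in> I \<Longrightarrow> fl t = \<zero>\<^bsub>Z\<^esub>"
proof -
  have z: "(u \<oplus>\<^bsub>Z\<^esub> v) \<ominus>\<^bsub>Z\<^esub> u \<ominus>\<^bsub>Z\<^esub> v = \<zero>\<^bsub>Z\<^esub>" if "u \<in> carrier Z" "v \<in> carrier Z" for u v
    using Z.r_neg[of "u \<oplus>\<^bsub>Z\<^esub> v"] that by (simp add: a_minus_def Z.minus_add Z.a_assoc)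
  have "env_relations \<subseteq> {t \<in> carrier F. fl t = \<zero>\<^bsub>Z\<^esub>}"
  proof
    fix t assume t: "t \<in> env_relations"
    note f = free_lift_diff[OF Z j_image] free_lift_gen[OF Z j_image] free_lift_mult[OF Z j_image]
      Q_linear_smult[OF fl_linear, simplified] Q_linear_closed[OF lin]
    consider x y where "x \<in> carrier g" "y \<in> carrier g" "t = gen (x \<oplus> y) - gen x - gen y"
      | c x where "x \<in> carrier g" "t = gen (c \<odot> x) - Poly_Mapping.map ((*) c) (gen x)"
      | x y where "x \<in> carrier g" "y \<in> carrier g" "t = gen x * gen y - gen y * gen x - gen (br x y)"
      using t unfolding env_relations_def by blast
    then have "fl t = \<zero>\<^bsub>Z\<^esub>"
    proof cases
      case (1 x y)
      then show ?thesis by (simp add: f Q_linear_add[OF lin] z)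
    next
      case (2 c x)
      then show ?thesis by (simp add: f Q_linear_smult[OF lin] Z.minus_eq_zero_iff)
    next
      case (3 x y)
      then have "fl t = (j x \<otimes>\<^bsub>Z\<^esub> j y) \<ominus>\<^bsub>Z\<^esub> (j y \<otimes>\<^bsub>Z\<^esub> j x) \<ominus>\<^bsub>Z\<^esub> j (br x y)"
        by (simp add: f br_closed)
      then show ?thesis
        using 3(1,2) by (simp only: lie[OF 3(1,2)]) (simp add: f z br_closed)
    qed
    then show "t \<in> {t \<in> carrier F. fl t = \<zero>\<^bsub>Z\<^esub>}"
      using t env_relations_subset by auto
  qed
  then have "I \<subseteq> {t \<in> carrier F. fl t = \<zero>\<^bsub>Z\<^esub>}"
    unfolding env_ideal_eq by (rule F.genideal_minimal[OF free_lift_kernel_ideal[OF Z j_image]])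
  then show "t \<in> I \<Longrightarrow> fl t = \<zero>\<^bsub>Z\<^esub>" by auto
qed

lemma env_lift_quo: "t \<in> carrier F \<Longrightarrow> env_lift Z j (quo t) = fl t"
proof -
  assume t: "t \<in> carrier F"
  have "env_lift Z j X = the_elem (fl ` X)" for X
    by (simp add: env_lift_def free_lift_def[OF Z j_image] lincomb_def keys.rep_eq word_prod_def)
  then show ?thesis
    using Q.coset_lift[OF Z.Q_space_axioms fl_linear fl_kernel t] by (simp add: quo_def)
qed

lemma env_lift_linear: "env_lift Z j \<in> Q_linear E Z"
proof (rule Q_linearI)
  have q: "quo s \<oplus>\<^bsub>E\<^esub> quo t = quo (s + t)"
    "c \<odot>\<^bsub>E\<^esub> quo s = quo (Poly_Mapping.map ((*) c) s)"
    if "s \<in> carrier F" "t \<in> carrier F" for s t c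
    using that by (simp_all add: quo_simps)
  note f = Q_linear_closed[OF fl_linear] Q_linear_add[OF fl_linear, simplified]
    Q_linear_smult[OF fl_linear, simplified]
  fix x assume x: "x \<in> carrier E"
  then show "env_lift Z j x \<in> carrier Z" "env_lift Z j (c \<odot>\<^bsub>E\<^esub> x) = c \<odot>\<^bsub>Z\<^esub> env_lift Z j x" for c
    by (elim quo_surjE; simp add: q env_lift_quo f)+
  fix y assume "y \<in> carrier E"
  with x show "env_lift Z j (x \<oplus>\<^bsub>E\<^esub> y) = env_lift Z j x \<oplus>\<^bsub>Z\<^esub> env_lift Z j y"
    by (elim quo_surjE; simp add: q env_lift_quo f)+
qed

lemma env_lift_mult:
  "x \<in> carrier E \<Longrightarrow> y \<in> carrier E \<Longrightarrow> env_lift Z j (x \<otimes>\<^bsub>E\<^esub> y) = env_lift Z j x \<otimes>\<^bsub>Z\<^esub> env_lift Z j y"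
  by (elim quo_surjE; simp add: env_lift_quo free_lift_mult[OF Z j_image] flip: quo_mult)

lemma env_lift_one: "env_lift Z j \<one>\<^bsub>E\<^esub> = \<one>\<^bsub>Z\<^esub>"
  by (simp add: enveloping_simps(6) env_lift_quo free_lift_one[OF Z j_image])

lemma env_lift_ring_hom: "env_lift Z j \<in> ring_hom E Z"
  by (rule Q_linear_ring_homI[OF env_lift_linear env_lift_one env_lift_mult])

lemma env_lift_incl: "x \<in> carrier g \<Longrightarrow> env_lift Z j (\<iota> x) = j x"
  by (simp add: incl_eq env_lift_quo free_lift_gen[OF Z j_image])

end


subsection \<open>Coproduct, counit and antipode of the enveloping algebra\<close>

abbreviation "EE \<equiv> tensor E E"

interpretation EE: Q_alg EE by unfold_locales (intro Q_algebra_tensor Q_algebra_enveloping)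

lemmas spE = Q_space_enveloping Q_space_enveloping

definition diag where
  "diag x = tens E E (\<iota> x) \<one>\<^bsub>E\<^esub> \<oplus>\<^bsub>EE\<^esub> tens E E \<one>\<^bsub>E\<^esub> (\<iota> x)"

lemma diag_linear: "diag \<in> Q_linear g EE"
  unfolding diag_def[abs_def]
  by (intro Q_linear_sum EE.Q_space_axioms Q_linear_comp[OF incl_linear] tens_linear_left[OF spE]
      tens_linear_right[OF spE] E.one_closed)

lemma diag_mult_tens:
  assumes "x \<in> carrier g" "a \<in> carrier E" "b \<in> carrier E"
  shows "diag x \<otimes>\<^bsub>EE\<^esub> tens E E a b = tens E E (\<iota> x \<otimes>\<^bsub>E\<^esub> a) b \<oplus>\<^bsub>EE\<^esub> tens E E a (\<iota> x \<otimes>\<^bsub>E\<^esub> b)"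
    "tens E E a b \<otimes>\<^bsub>EE\<^esub> diag x = tens E E (a \<otimes>\<^bsub>E\<^esub> \<iota> x) b \<oplus>\<^bsub>EE\<^esub> tens E E a (b \<otimes>\<^bsub>E\<^esub> \<iota> x)"
  using assms
  by (simp_all add: diag_def EE.l_distr EE.r_distr tens_closed[OF spE] incl_closed
      tensor_mult_tens[OF Q_algebra_enveloping Q_algebra_enveloping])

text \<open>
  In the product of \<open>x \<otimes> 1 + 1 \<otimes> x\<close> and \<open>y \<otimes> 1 + 1 \<otimes> y\<close> the mixed terms \<open>x \<otimes> y + y \<otimes> x\<close> are symmetric
  in \<open>x\<close> and \<open>y\<close>, so that the commutator is that of \<open>x\<close> and \<open>y\<close> in each tensor factor.
\<close>

lemma diag_bracket:
  assumes xy: "x \<in> carrier g" "y \<in> carrier g"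
  shows "diag x \<otimes>\<^bsub>EE\<^esub> diag y = diag y \<otimes>\<^bsub>EE\<^esub> diag x \<oplus>\<^bsub>EE\<^esub> diag (br x y)"
proof -
  have d: "diag x \<otimes>\<^bsub>EE\<^esub> diag y =
      (tens E E (\<iota> x \<otimes>\<^bsub>E\<^esub> \<iota> y) \<one>\<^bsub>E\<^esub> \<oplus>\<^bsub>EE\<^esub> tens E E (\<iota> y) (\<iota> x)) \<oplus>\<^bsub>EE\<^esub>
      (tens E E (\<iota> x) (\<iota> y) \<oplus>\<^bsub>EE\<^esub> tens E E \<one>\<^bsub>E\<^esub> (\<iota> x \<otimes>\<^bsub>E\<^esub> \<iota> y))"
    if "x \<in> carrier g" "y \<in> carrier g" for x y
  proof -
    have "diag x \<in> carrier EE"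
      by (rule Q_linear_closed[OF diag_linear that(1)])
    then show ?thesis
      using that by (simp add: diag_def[of y] EE.r_distr diag_mult_tens tens_closed[OF spE] incl_closed)
  qed
  note c = incl_closed[OF xy(1)] incl_closed[OF xy(2)] incl_closed[OF br_closed[OF xy]]
  show ?thesis
    unfolding d[OF xy] d[OF xy(2,1)] incl_bracket[OF xy] diag_def[of "br x y"]
    using c by (simp add: Q_linear_add[OF tens_linear_left[OF spE]] Q_linear_add[OF tens_linear_right[OF spE]]
        tens_closed[OF spE] EE.a_ac)
qed

lemma comult_eq: "comult E = env_lift EE diag"
  by (simp add: comult_enveloping diag_def[abs_def])

lemmas comult_lift = EE.is_algebra diag_linear diag_bracket

lemma comult_enveloping_linear: "comult E \<in> Q_linear E EE"
  unfolding comult_eq by (rule env_lift_linear[OF comult_lift])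

lemma comult_enveloping_ring_hom: "comult E \<in> ring_hom E EE"
  unfolding comult_eq by (rule env_lift_ring_hom[OF comult_lift])

lemma comult_incl: "x \<in> carrier g \<Longrightarrow> comult E (\<iota> x) = diag x"
  unfolding comult_eq by (rule env_lift_incl[OF comult_lift])

lemma comult_one: "comult E \<one>\<^bsub>E\<^esub> = tens E E \<one>\<^bsub>E\<^esub> \<one>\<^bsub>E\<^esub>"
  using ring_homE(2)[OF comult_enveloping_ring_hom] by (simp add: tensor_one)

lemma Q_algebra_QQ: "Q_algebra QQ"
  using module_QQ cring_QQ by (simp add: Q_algebra_def cring_def)

lemma counit_lift:
  "Q_algebra QQ" "(\<lambda>_. 0) \<in> Q_linear g QQ"
  "(0::rat) \<otimes>\<^bsub>QQ\<^esub> 0 = 0 \<otimes>\<^bsub>QQ\<^esub> 0 \<oplus>\<^bsub>QQ\<^esub> 0"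
  by (auto intro!: Q_linearI simp: Q_algebra_QQ)

lemma counit_enveloping_linear: "counit E \<in> Q_linear E QQ"
  unfolding counit_enveloping by (rule env_lift_linear[OF counit_lift])

lemma counit_enveloping_ring_hom: "counit E \<in> ring_hom E QQ"
  unfolding counit_enveloping by (rule env_lift_ring_hom[OF counit_lift])

lemma counit_incl: "x \<in> carrier g \<Longrightarrow> counit E (\<iota> x) = 0"
  unfolding counit_enveloping by (rule env_lift_incl[OF counit_lift])

text \<open>
  The antipode is the anti-automorphism with \<open>x \<mapsto> - x\<close> on generators, that is, an algebra
  homomorphism into the opposite algebra.
\<close>

definition "opposite = E\<lparr>mult := \<lambda>x y. y \<otimes>\<^bsub>E\<^esub> x\<rparr>"

lemma opposite_simps [simp]:
  "carrier opposite = carrier E" "zero opposite = zero E" "one opposite = one E"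
  "add opposite = add E" "smult opposite = smult E" "x \<otimes>\<^bsub>opposite\<^esub> y = y \<otimes>\<^bsub>E\<^esub> x"
  by (simp_all add: opposite_def)

lemma Q_linear_opposite [simp]: "Q_linear V opposite = Q_linear V E"
  by (simp add: Q_linear_def)

lemma Q_algebra_opposite: "Q_algebra opposite"
proof (rule Q_algebraI)
  show "Q_space opposite"
    by (intro Q_space.intro moduleI cring_QQ abelian_groupI)
      (auto simp: E.a_ac E.smult_l_distr E.smult_r_distr E.smult_assoc intro: E.l_neg E.a_inv_closed)
  show "(\<lambda>x y. x \<otimes>\<^bsub>opposite\<^esub> y) \<in> Q_bilinear opposite opposite opposite"
    by (auto intro!: Q_bilinearI Q_linearI simp: E.l_distr E.r_distr E.smult_mult_left E.smult_mult_right)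
qed (auto simp: E.m_assoc)

definition "neg x = \<ominus>\<^bsub>E\<^esub> \<iota> x"

lemma neg_lift:
  "neg \<in> Q_linear g opposite"
  "x \<in> carrier g \<Longrightarrow> y \<in> carrier g \<Longrightarrow>
    neg x \<otimes>\<^bsub>opposite\<^esub> neg y = neg y \<otimes>\<^bsub>opposite\<^esub> neg x \<oplus>\<^bsub>opposite\<^esub> neg (br x y)"
proof -
  show "neg \<in> Q_linear g opposite"
    using incl_closed
    by (auto intro!: Q_linearI simp: neg_def Q_linear_add[OF incl_linear] Q_linear_smult[OF incl_linear]
        E.minus_add E.smult_minus_right)
  assume xy: "x \<in> carrier g" "y \<in> carrier g"
  note c = incl_closed[OF xy(1)] incl_closed[OF xy(2)] incl_closed[OF br_closed[OF xy]]
  show "neg x \<otimes>\<^bsub>opposite\<^esub> neg y = neg y \<otimes>\<^bsub>opposite\<^esub> neg x \<oplus>\<^bsub>opposite\<^esub> neg (br x y)"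
    using c by (simp add: neg_def E.l_minus E.r_minus incl_bracket[OF xy] E.a_assoc E.r_neg)
qed

definition "env_antipode = env_lift opposite neg"

lemmas antipode_lift = Q_algebra_opposite neg_lift

lemma env_antipode_linear: "env_antipode \<in> Q_linear E E"
  using env_lift_linear[OF antipode_lift] by (simp add: env_antipode_def)

lemma env_antipode_mult:
  "x \<in> carrier E \<Longrightarrow> y \<in> carrier E \<Longrightarrow> env_antipode (x \<otimes>\<^bsub>E\<^esub> y) = env_antipode y \<otimes>\<^bsub>E\<^esub> env_antipode x"
  using env_lift_mult[OF antipode_lift] by (simp add: env_antipode_def)

lemma env_antipode_one: "env_antipode \<one>\<^bsub>E\<^esub> = \<one>\<^bsub>E\<^esub>"
  using env_lift_one[OF antipode_lift] by (simp add: env_antipode_def)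

lemma env_antipode_incl: "x \<in> carrier g \<Longrightarrow> env_antipode (\<iota> x) = \<ominus>\<^bsub>E\<^esub> \<iota> x"
  unfolding env_antipode_def neg_def[symmetric] by (rule env_lift_incl[OF antipode_lift])

text \<open>
  The identities are checked on words of generators.  For a primitive generator \<open>x\<close> the coproduct of
  \<open>x u\<close> is \<open>(x \<otimes> 1 + 1 \<otimes> x) \<Delta>(u)\<close>, and \<open>S(x a) b + S(a) (x b) = 0\<close>; so the left identity holds for
  all words that begin with a generator.  The right identity is treated from the other end.
\<close>

lemma antipode_enveloping: "antipode E env_antipode"
  unfolding antipode_def
proof (intro conjI ballI env_antipode_linear)
  let ?S = env_antipode
  note Sc = Q_linear_closed[OF env_antipode_linear]
  note Dc = Q_linear_closed[OF comult_enveloping_linear]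
  note D = ring_homE[OF comult_enveloping_ring_hom]
  have \<epsilon>: "counit E \<one>\<^bsub>E\<^esub> = 1"
    "u \<in> carrier E \<Longrightarrow> v \<in> carrier E \<Longrightarrow> counit E (u \<otimes>\<^bsub>E\<^esub> v) = counit E u * counit E v" for u v
    using ring_homE[OF counit_enveloping_ring_hom] by auto
  have b1: "(\<lambda>a b. ?S a \<otimes>\<^bsub>E\<^esub> b) \<in> Q_bilinear E E E"
    by (rule Q_bilinear_comp[OF E.mult_bilinear env_antipode_linear Q_linear_id])
  have b2: "(\<lambda>a b. a \<otimes>\<^bsub>E\<^esub> ?S b) \<in> Q_bilinear E E E"
    by (rule Q_bilinear_comp[OF E.mult_bilinear Q_linear_id env_antipode_linear])
  define l where "l = tensor_lift E (\<lambda>a b. ?S a \<otimes>\<^bsub>E\<^esub> b)"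
  define r where "r = tensor_lift E (\<lambda>a b. a \<otimes>\<^bsub>E\<^esub> ?S b)"
  have ll: "l \<in> Q_linear EE E" and rl: "r \<in> Q_linear EE E"
    unfolding l_def r_def using tensor_lift_linear[OF spE E.Q_space_axioms] b1 b2 by auto
  have lt: "l (tens E E a b) = ?S a \<otimes>\<^bsub>E\<^esub> b" and rt: "r (tens E E a b) = a \<otimes>\<^bsub>E\<^esub> ?S b"
    if "a \<in> carrier E" "b \<in> carrier E" for a b
    unfolding l_def r_def
    using that tensor_lift_tens[OF spE E.Q_space_axioms] b1 b2 by auto
  note cl = tens_closed[OF spE] incl_closed Sc
  have dc: "diag x \<in> carrier EE" if "x \<in> carrier g" for x
    by (rule Q_linear_closed[OF diag_linear that])
  have kill_l: "l (diag x \<otimes>\<^bsub>EE\<^esub> t) = \<zero>\<^bsub>E\<^esub>" if x: "x \<in> carrier g" and t: "t \<in> carrier EE" for x t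
    using t
    by (induction rule: tensor_induct[OF spE, consumes 1])
      (use x in \<open>simp_all add: diag_mult_tens Q_linear_add[OF ll] lt cl env_antipode_mult env_antipode_incl
        E.m_assoc E.l_minus E.r_minus E.l_neg EE.r_distr dc\<close>)
  have kill_r: "r (t \<otimes>\<^bsub>EE\<^esub> diag x) = \<zero>\<^bsub>E\<^esub>" if x: "x \<in> carrier g" and t: "t \<in> carrier EE" for x t
    using t
    by (induction rule: tensor_induct[OF spE, consumes 1])
      (use x in \<open>simp_all add: diag_mult_tens Q_linear_add[OF rl] rt cl env_antipode_mult env_antipode_incl
        E.m_assoc E.l_minus E.r_minus E.r_neg EE.l_distr dc\<close>)
  fix u assume u: "u \<in> carrier E"
  have el: "(\<lambda>u. counit E u \<odot>\<^bsub>E\<^esub> \<one>\<^bsub>E\<^esub>) \<in> Q_linear E E"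
    by (rule E.smult_one_linear[OF counit_enveloping_linear])
  have "l (comult E u) = counit E u \<odot>\<^bsub>E\<^esub> \<one>\<^bsub>E\<^esub>"
  proof (rule enveloping_linear_eqI[OF Q_linear_comp[OF comult_enveloping_linear ll] el u])
    fix ws assume "set ws \<subseteq> carrier g"
    then show "l (comult E (word_prod E \<iota> ws)) = counit E (word_prod E \<iota> ws) \<odot>\<^bsub>E\<^esub> \<one>\<^bsub>E\<^esub>"
      by (cases ws)
        (simp_all add: comult_one lt env_antipode_one \<epsilon> D(1) comult_incl counit_incl cl word_closed
          kill_l Dc)
  qed
  then show "tensor_lift E (\<lambda>a b. ?S a \<otimes>\<^bsub>E\<^esub> b) (comult E u) = counit E u \<odot>\<^bsub>E\<^esub> \<one>\<^bsub>E\<^esub>"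
    by (simp add: l_def)
  have "r (comult E u) = counit E u \<odot>\<^bsub>E\<^esub> \<one>\<^bsub>E\<^esub>"
  proof (rule enveloping_linear_eqI[OF Q_linear_comp[OF comult_enveloping_linear rl] el u])
    fix ws assume ws: "set ws \<subseteq> carrier g"
    show "r (comult E (word_prod E \<iota> ws)) = counit E (word_prod E \<iota> ws) \<odot>\<^bsub>E\<^esub> \<one>\<^bsub>E\<^esub>"
    proof (cases ws rule: rev_cases)
      case Nil
      then show ?thesis by (simp add: comult_one rt env_antipode_one \<epsilon>)
    next
      case (snoc vs x)
      then have "word_prod E \<iota> ws = word_prod E \<iota> vs \<otimes>\<^bsub>E\<^esub> \<iota> x"
        using E.word_prod_append[of \<iota> vs "[x]"] ws incl_closed by auto
      then show ?thesis
        using ws snoc by (simp add: D(1) \<epsilon> comult_incl counit_incl cl word_closed kill_r Dc)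
    qed
  qed
  then show "tensor_lift E (\<lambda>a b. a \<otimes>\<^bsub>E\<^esub> ?S b) (comult E u) = counit E u \<odot>\<^bsub>E\<^esub> \<one>\<^bsub>E\<^esub>"
    by (simp add: r_def)
qed

end

section \<open>Finite modules and their isomorphism classes\<close>

lemma amoduleD:
  assumes "amodule M"
  shows "bpt M \<in> pts M" "m \<in> pts M \<Longrightarrow> act M a m \<in> pts M"
    "m \<in> pts M \<Longrightarrow> act M (a * b) m = act M a (act M b m)"
    "m \<in> pts M \<Longrightarrow> act M 0 m = bpt M"
    "is_identity e \<Longrightarrow> m \<in> pts M \<Longrightarrow> act M e m = m"
    "act M a (bpt M) = bpt M"
proof -
  show *: "bpt M \<in> pts M" "m \<in> pts M \<Longrightarrow> act M a m \<in> pts M"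
    "m \<in> pts M \<Longrightarrow> act M (a * b) m = act M a (act M b m)"
    "m \<in> pts M \<Longrightarrow> act M 0 m = bpt M"
    "is_identity e \<Longrightarrow> m \<in> pts M \<Longrightarrow> act M e m = m" for m a b e
    using assms by (auto simp: amodule_def)
  show "act M a (bpt M) = bpt M"
    using *(3)[OF *(1), of a 0] *(4)[OF *(1)] by simp
qed

lemma finite_amoduleD:
  assumes "finite_amodule M" shows "amodule M" "finite (pts M)"
  using assms by (auto simp: finite_amodule_def)

lemma amod_isoI:
  assumes "amodule M" "f ` pts M \<subseteq> pts N" "g ` pts N \<subseteq> pts M"
    and gf: "\<And>m. m \<in> pts M \<Longrightarrow> g (f m) = m" and fg: "\<And>n. n \<in> pts N \<Longrightarrow> f (g n) = n"
    and b: "f (bpt M) = bpt N"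
    and act: "\<And>a m. m \<in> pts M \<Longrightarrow> f (act M a m) = act N a (f m)"
  shows "M \<cong>\<^sub>A N"
proof -
  note M = amoduleD[OF assms(1)]
  have "g (bpt N) = bpt M"
    using gf[OF M(1)] b by simp
  moreover have "g (act N a n) = act M a (g n)" if "n \<in> pts N" for a n
    using act[of "g n" a] gf[of "act M a (g n)"] fg[OF that] M(2)[of "g n" a] assms(3) that by auto
  ultimately show ?thesis
    unfolding amod_iso_def normal_hom_def amod_hom_def
    using assms by (intro bexI[of _ f] bexI[of _ g]) (auto, metis+)
qed

definition amod_inverse_isos ::
    "('a, 'm) amod \<Rightarrow> ('a, 'n) amod \<Rightarrow> ('m \<Rightarrow> 'n) \<Rightarrow> ('n \<Rightarrow> 'm) \<Rightarrow> bool" where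
  "amod_inverse_isos M N f g \<longleftrightarrow> f ` pts M \<subseteq> pts N \<and> g ` pts N \<subseteq> pts M \<and>
     (\<forall>m\<in>pts M. g (f m) = m) \<and> (\<forall>n\<in>pts N. f (g n) = n) \<and> f (bpt M) = bpt N \<and> g (bpt N) = bpt M \<and>
     (\<forall>a. \<forall>m\<in>pts M. f (act M a m) = act N a (f m)) \<and>
     (\<forall>a. \<forall>n\<in>pts N. g (act N a n) = act M a (g n))"

lemma amod_inverse_isosD:
  assumes "amod_inverse_isos M N f g"
  shows "f ` pts M \<subseteq> pts N" "g ` pts N \<subseteq> pts M"
    "\<And>m. m \<in> pts M \<Longrightarrow> g (f m) = m" "\<And>n. n \<in> pts N \<Longrightarrow> f (g n) = n"
    "f (bpt M) = bpt N" "g (bpt N) = bpt M"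
    "\<And>a m. m \<in> pts M \<Longrightarrow> f (act M a m) = act N a (f m)"
    "\<And>a n. n \<in> pts N \<Longrightarrow> g (act N a n) = act M a (g n)"
  using assms by (auto simp: amod_inverse_isos_def)

lemma amod_isoE:
  assumes "M \<cong>\<^sub>A N"
  obtains f g where "amod_inverse_isos M N f g"
proof -
  obtain f g where "f \<in> normal_hom M N" "g \<in> normal_hom N M"
    "\<forall>m \<in> pts M. g (f m) = m" "\<forall>n \<in> pts N. f (g n) = n"
    using assms unfolding amod_iso_def by blast
  then show ?thesis
    by (intro that[of f g]) (auto simp: amod_inverse_isos_def normal_hom_def amod_hom_def)
qed

lemma amod_iso_amodule:
  assumes "amodule M" "M \<cong>\<^sub>A N"
  shows "amodule N"
proof -
  note M = amoduleD[OF assms(1)]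
  obtain f g where "amod_inverse_isos M N f g"
    using assms(2) by (rule amod_isoE)
  note fg = amod_inverse_isosD[OF this]
  have n: "\<exists>m. m \<in> pts M \<and> n = f m" if "n \<in> pts N" for n
    using fg that by (intro exI[of _ "g n"]) auto
  have a: "act N a (f m) = f (act M a m)" if "m \<in> pts M" for a m
    using fg(7) that by simp
  have fc: "f m \<in> pts N" if "m \<in> pts M" for m
    using fg(1) that by auto
  show ?thesis
    unfolding amodule_def
    by (intro conjI allI ballI impI; (drule n)?; (elim exE conjE)?)
      (simp_all add: a fc M flip: fg(5))
qed

lemma amod_iso_card:
  assumes "M \<cong>\<^sub>A N"
  shows "card (pts M) = card (pts N)" "finite (pts M) = finite (pts N)"
proof -
  obtain f g where "amod_inverse_isos M N f g"
    using assms by (rule amod_isoE)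
  note fg = amod_inverse_isosD[OF this]
  have "bij_betw f (pts M) (pts N)"
    by (rule bij_betw_byWitness[where f' = g]) (use fg in auto)
  then show "card (pts M) = card (pts N)" "finite (pts M) = finite (pts N)"
    by (auto dest: bij_betw_same_card bij_betw_finite)
qed

lemma finite_amodule_iso: "finite_amodule M \<Longrightarrow> M \<cong>\<^sub>A N \<Longrightarrow> finite_amodule N"
  using amod_iso_amodule amod_iso_card(2) unfolding finite_amodule_def by metis

text \<open>
  Transport of structure along an injection of the points.  It provides copies with natural numbers
  as points, and copies whose points are an initial segment.
\<close>

definition amod_image :: "('m \<Rightarrow> 'n) \<Rightarrow> ('a, 'm) amod \<Rightarrow> ('a, 'n) amod" where
  "amod_image h M = \<lparr>pts = h ` pts M, bpt = h (bpt M), act = \<lambda>a n. h (act M a (inv_into (pts M) h n))\<rparr>"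

lemma amod_image_iso:
  assumes "amodule M" "inj_on h (pts M)"
  shows "M \<cong>\<^sub>A amod_image h M"
  by (rule amod_isoI[where f = h and g = "inv_into (pts M) h"])
    (use assms in \<open>auto simp: amod_image_def\<close>)

lemma finite_amodule_nat_copy:
  assumes "finite_amodule M"
  shows "\<exists>N :: ('a::{semigroup_mult,mult_zero}, nat) amod. finite_amodule N \<and> N \<cong>\<^sub>A M"
proof -
  obtain h :: "_ \<Rightarrow> nat" where "inj_on h (pts M)"
    using finite_imp_inj_to_nat_seg[OF finite_amoduleD(2)[OF assms]] by blast
  then show ?thesis
    using amod_image_iso[of M h] finite_amodule_iso[OF assms] amod_iso_sym finite_amoduleD(1)[OF assms]
    by blast
qed

lemma isoclass_abs:
  assumes "finite_amodule M"
  obtains N :: "('a::{semigroup_mult,mult_zero}, nat) amod"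
  where "finite_amodule N" "N \<cong>\<^sub>A M" "isoclass M = abs_isoclass N"
  using someI_ex[OF finite_amodule_nat_copy[OF assms]] that unfolding isoclass_def by blast

text \<open>
  The points of the two modules may have different types, so both sides are compared through
  copies with natural numbers as points.
\<close>

lemma isoclass_eq_iff:
  assumes "finite_amodule M" "finite_amodule N"
  shows "isoclass M = isoclass N \<longleftrightarrow> M \<cong>\<^sub>A N"
proof -
  obtain M' :: "('a, nat) amod" where M': "finite_amodule M'" "M' \<cong>\<^sub>A M" "isoclass M = abs_isoclass M'"
    by (rule isoclass_abs[OF assms(1)])
  obtain N' :: "('a, nat) amod" where N': "finite_amodule N'" "N' \<cong>\<^sub>A N" "isoclass N = abs_isoclass N'"
    by (rule isoclass_abs[OF assms(2)])
  have "abs_isoclass M' = abs_isoclass N' \<longleftrightarrow> M' \<cong>\<^sub>A N'"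
    using Quotient3_rel[OF Quotient3_isoclass, of M' N'] M'(1) N'(1)
    by (simp add: isoclass_rel_def amod_iso_refl)
  then show ?thesis
    using M' N' amod_iso_sym amod_iso_trans by metis
qed

lemma isoclass_eqI: "finite_amodule M \<Longrightarrow> M \<cong>\<^sub>A N \<Longrightarrow> isoclass M = isoclass N"
  using isoclass_eq_iff finite_amodule_iso by metis

lemma finite_amodule_rep [simp]: "finite_amodule (rep_isoclass X)"
  using Quotient3_rep_reflp[OF Quotient3_isoclass, of X] by (simp add: isoclass_rel_def)

lemma amodule_rep [simp]: "amodule (rep_isoclass X)"
  using finite_amoduleD(1)[OF finite_amodule_rep] .

lemma isoclass_rep [simp]: "isoclass (rep_isoclass X) = X"
proof -
  obtain N :: "('a, nat) amod" where N: "finite_amodule N" "N \<cong>\<^sub>A rep_isoclass X"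
    "isoclass (rep_isoclass X) = abs_isoclass N"
    by (rule isoclass_abs[OF finite_amodule_rep[of X]])
  have "abs_isoclass N = abs_isoclass (rep_isoclass X)"
    using Quotient3_rel[OF Quotient3_isoclass, of N "rep_isoclass X"] N
    by (simp add: isoclass_rel_def amod_iso_refl)
  then show ?thesis
    using N Quotient3_abs_rep[OF Quotient3_isoclass] by simp
qed

lemma rep_isoclass_iso: "finite_amodule M \<Longrightarrow> rep_isoclass (isoclass M) \<cong>\<^sub>A M"
  by (simp flip: isoclass_eq_iff)

lemma isoclassE: obtains M :: "('a::{semigroup_mult,mult_zero}, nat) amod"
  where "finite_amodule M" "X = isoclass M"
  using that[of "rep_isoclass X"] by simp

subsection \<open>Wedge sums\<close>

lemma wedge_simps [simp]:
  "pts (wedge M N) = Inl ` pts M \<union> Inr ` (pts N - {bpt N})"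
  "bpt (wedge M N) = Inl (bpt M)"
  "act (wedge M N) a (Inl m) = Inl (act M a m)"
  "act (wedge M N) a (Inr n) = (if act N a n = bpt N then Inl (bpt M) else Inr (act N a n))"
  by (simp_all add: wedge_def)

lemma amodule_wedge: "amodule M \<Longrightarrow> amodule N \<Longrightarrow> amodule (wedge M N)"
  unfolding amodule_def[of "wedge M N"] by (auto simp: amoduleD split: if_splits)

lemma finite_amodule_wedge [simp]:
  "finite_amodule M \<Longrightarrow> finite_amodule N \<Longrightarrow> finite_amodule (wedge M N)"
  by (simp add: finite_amodule_def amodule_wedge)

lemma wedge_cong:
  assumes "amodule M" "amodule N" "M \<cong>\<^sub>A M'" "N \<cong>\<^sub>A N'"
  shows "wedge M N \<cong>\<^sub>A wedge M' N'"
proof -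
  note M = amoduleD[OF assms(1)] and N = amoduleD[OF assms(2)]
  obtain f g where "amod_inverse_isos M M' f g"
    using assms(3) by (rule amod_isoE)
  note f = amod_inverse_isosD[OF this]
  obtain h k where "amod_inverse_isos N N' h k"
    using assms(4) by (rule amod_isoE)
  note h = amod_inverse_isosD[OF this]
  have hb: "h n = bpt N' \<longleftrightarrow> n = bpt N" if "n \<in> pts N" for n
    using h(3)[OF that] h(5,6) by auto
  have kb: "k n = bpt N \<longleftrightarrow> n = bpt N'" if "n \<in> pts N'" for n
    using h(4)[OF that] h(5,6) by auto
  have ab: "act N' a (h n) = bpt N' \<longleftrightarrow> act N a n = bpt N" if "n \<in> pts N" for a n
    using hb[of "act N a n"] N(2)[OF that, of a] h(7)[OF that, of a] by simp
  show ?thesis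
    by (rule amod_isoI[where f = "map_sum f h" and g = "map_sum g k"])
      (use f h N in \<open>auto simp: amodule_wedge assms hb kb ab image_subset_iff split: if_splits\<close>)
qed

lemma wedge_commute:
  assumes "amodule M" "amodule N"
  shows "wedge M N \<cong>\<^sub>A wedge N M"
proof (rule amod_isoI)
  let ?f = "\<lambda>M N x. case x of Inl m \<Rightarrow> if m = bpt M then Inl (bpt N) else Inr m | Inr n \<Rightarrow> Inl n"
  show "?f M N (act (wedge M N) a x) = act (wedge N M) a (?f M N x)" if "x \<in> pts (wedge M N)" for a x
    using that by (auto simp: amoduleD assms split: if_splits)
  show "?f M N ` pts (wedge M N) \<subseteq> pts (wedge N M)" "?f N M ` pts (wedge N M) \<subseteq> pts (wedge M N)"
    by (auto simp: amoduleD assms)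
  show "?f N M (?f M N x) = x" if "x \<in> pts (wedge M N)" for x
    using that by (auto simp: amoduleD assms split: if_splits)
  show "?f M N (?f N M x) = x" if "x \<in> pts (wedge N M)" for x
    using that by (auto simp: amoduleD assms split: if_splits)
qed (auto simp: amodule_wedge assms)

lemma wedge_assoc:
  assumes "amodule M" "amodule N" "amodule L"
  shows "wedge (wedge M N) L \<cong>\<^sub>A wedge M (wedge N L)"
proof (rule amod_isoI)
  let ?f = "\<lambda>x. case x of Inl y \<Rightarrow> (case y of Inl m \<Rightarrow> Inl m | Inr n \<Rightarrow> Inr (Inl n)) | Inr l \<Rightarrow> Inr (Inr l)"
  let ?g = "\<lambda>x. case x of Inl m \<Rightarrow> Inl (Inl m) | Inr y \<Rightarrow> (case y of Inl n \<Rightarrow> Inl (Inr n) | Inr l \<Rightarrow> Inr l)"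
  show "?f (act (wedge (wedge M N) L) a x) = act (wedge M (wedge N L)) a (?f x)"
    if "x \<in> pts (wedge (wedge M N) L)" for a x
    using that by (auto simp: amoduleD assms split: if_splits)
  show "?g (?f x) = x" if "x \<in> pts (wedge (wedge M N) L)" for x
    using that by auto
  show "?f (?g x) = x" if "x \<in> pts (wedge M (wedge N L))" for x
    using that by auto
qed (auto simp: amodule_wedge assms)

lemma wedge_zero:
  assumes "amodule N"
  shows "wedge zero_amod N \<cong>\<^sub>A N"
  by (rule amod_isoI[where f = "\<lambda>x. case x of Inl m \<Rightarrow> bpt N | Inr n \<Rightarrow> n"
        and g = "\<lambda>n. if n = bpt N then Inl 0 else Inr n"])
    (auto simp: amodule_wedge assms amoduleD finite_amoduleD(1)[OF finite_amodule_zero] split: if_splits,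
      auto simp: zero_amod_def assms amoduleD)

instantiation isoclass :: ("{semigroup_mult,mult_zero}") comm_monoid_add
begin

definition zero_isoclass :: "'a isoclass" where
  "0 = isoclass zero_amod"

definition plus_isoclass :: "'a isoclass \<Rightarrow> 'a isoclass \<Rightarrow> 'a isoclass" where
  "X + Y = isoclass (wedge (rep_isoclass X) (rep_isoclass Y))"

lemma isoclass_wedge:
  "finite_amodule M \<Longrightarrow> finite_amodule N \<Longrightarrow> isoclass (wedge M N) = isoclass M + isoclass (N :: ('a, 'n) amod)"
  unfolding plus_isoclass_def
  by (rule isoclass_eqI[symmetric])
    (auto intro: wedge_cong rep_isoclass_iso)

instance
proof
  fix X Y Z :: "'a isoclass"
  show "X + Y = Y + X"
    unfolding plus_isoclass_def by (rule isoclass_eqI) (simp_all add: wedge_commute)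
  show "X + Y + Z = X + (Y + Z)"
    using isoclass_eqI[OF _ wedge_assoc, of "rep_isoclass X" "rep_isoclass Y" "rep_isoclass Z"]
    by (simp add: isoclass_wedge)
  show "0 + X = X"
    using isoclass_eqI[OF _ wedge_zero, of "rep_isoclass X"]
    by (simp add: isoclass_wedge finite_amodule_zero zero_isoclass_def)
qed

end

lemma isoclass_zero_iff:
  assumes "finite_amodule M"
  shows "isoclass M = 0 \<longleftrightarrow> pts M = {bpt M}"
proof
  assume "isoclass M = 0"
  then have "M \<cong>\<^sub>A (zero_amod :: ('a, nat) amod)"
    by (simp add: zero_isoclass_def isoclass_eq_iff assms finite_amodule_zero)
  then have "card (pts M) = 1"
    using amod_iso_card(1) by (fastforce simp: zero_amod_def)
  then show "pts M = {bpt M}"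
    using amoduleD(1)[OF finite_amoduleD(1)[OF assms]] by (auto simp: card_1_singleton_iff)
next
  assume p: "pts M = {bpt M}"
  have "M \<cong>\<^sub>A (zero_amod :: ('a, nat) amod)"
    by (rule amod_isoI[where f = "\<lambda>_. 0" and g = "\<lambda>_. bpt M"])
      (use p finite_amoduleD(1)[OF assms] in \<open>auto simp: zero_amod_def amoduleD\<close>)
  then show "isoclass M = 0"
    by (simp add: zero_isoclass_def isoclass_eq_iff assms finite_amodule_zero)
qed

definition cdim :: "'a::{semigroup_mult,mult_zero} isoclass \<Rightarrow> nat" where
  "cdim X = card (pts (rep_isoclass X)) - 1"

lemma cdim_isoclass: "finite_amodule M \<Longrightarrow> cdim (isoclass M) = card (pts M) - 1"
  unfolding cdim_def using amod_iso_card(1)[OF rep_isoclass_iso] by metis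

lemma card_pts: "finite_amodule M \<Longrightarrow> card (pts M) = Suc (cdim (isoclass M))"
  using amoduleD(1)[of M] card_gt_0_iff[of "pts M"]
  by (auto simp: cdim_isoclass finite_amodule_def)

lemma cdim_plus [simp]: "cdim (X + Y) = cdim X + cdim Y"
proof (cases rule: isoclassE[of X])
  case (1 M)
  show ?thesis
  proof (cases rule: isoclassE[of Y])
    case (1 N)
    note N = this
    have fin: "finite (pts M)" "finite (pts N)"
      using finite_amoduleD \<open>finite_amodule M\<close> N by auto
    have "card (pts (wedge M N)) = card (pts M) + (card (pts N) - 1)"
      using fin amoduleD(1)[OF finite_amoduleD(1)[OF N(1)]]
      by (subst wedge_simps, subst card_Un_disjoint) (auto simp: card_image)
    then show ?thesis
      using \<open>finite_amodule M\<close> \<open>X = isoclass M\<close> N card_pts[of M] card_pts[of N] card_pts[of "wedge M N"]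
      by (simp add: isoclass_wedge)
  qed
qed

lemma cdim_eq_0_iff [simp]: "cdim X = 0 \<longleftrightarrow> X = 0"
proof (cases rule: isoclassE[of X])
  case (1 M)
  then have "bpt M \<in> pts M" "finite (pts M)" "card (pts M) = Suc (cdim X)"
    using amoduleD(1) finite_amoduleD card_pts by auto
  then show ?thesis
    using 1 isoclass_zero_iff[OF 1(1)] by (auto simp: card_1_singleton_iff)
qed

lemma plus_isoclass_eq_0_iff [simp]: "(X::'a::{semigroup_mult,mult_zero} isoclass) + Y = 0 \<longleftrightarrow> X = 0 \<and> Y = 0"
  using cdim_eq_0_iff[of "X + Y"] by (simp del: cdim_eq_0_iff) simp

text \<open>
  Indecomposability, expressed in the monoid of classes.
\<close>

definition indec :: "'a::{semigroup_mult,mult_zero} isoclass \<Rightarrow> bool" where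
  "indec X \<longleftrightarrow> X \<noteq> 0 \<and> (\<forall>Y Z. X = Y + Z \<longrightarrow> Y = 0 \<or> Z = 0)"

text \<open>
  The summands of a decomposition of \<open>M\<close> are finite, and so have classes: they embed into the wedge
  sum, which is isomorphic to the finite module \<open>M\<close>.
\<close>

lemma indec_isoclass:
  fixes M :: "('a::{semigroup_mult,mult_zero}, nat) amod"
  assumes "finite_amodule M"
  shows "indec (isoclass M) \<longleftrightarrow> indecomposable M"
proof
  assume ind: "indec (isoclass M)"
  have False if NL: "amodule N" "amodule L" "pts N \<noteq> {bpt N}" "pts L \<noteq> {bpt L}" "M \<cong>\<^sub>A wedge N L"
    for N L :: "('a, nat) amod"
  proof -
    have "finite (pts (wedge N L))"
      using finite_amodule_iso[OF assms NL(5)] finite_amoduleD(2) by blast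
    then have "finite (Inl ` pts N :: (nat + nat) set)" "finite (Inr ` (pts L - {bpt L}) :: (nat + nat) set)"
      by auto
    then have fin: "finite_amodule N" "finite_amodule L"
      using NL by (auto simp: finite_amodule_def finite_image_iff)
    have "isoclass M = isoclass N + isoclass L"
      using isoclass_eqI[OF assms NL(5)] fin by (simp add: isoclass_wedge)
    then have "isoclass N = 0 \<or> isoclass L = 0"
      using ind unfolding indec_def by blast
    then show False
      using NL(3,4) isoclass_zero_iff fin by blast
  qed
  then show "indecomposable M"
    using ind assms by (auto simp: indecomposable_def indec_def isoclass_zero_iff finite_amodule_def)
next
  assume ind: "indecomposable M"
  have "Y = 0 \<or> Z = 0" if "isoclass M = Y + Z" for Y Z
  proof -
    have "M \<cong>\<^sub>A wedge (rep_isoclass Y) (rep_isoclass Z)"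
      using that assms by (simp flip: isoclass_eq_iff add: isoclass_wedge)
    then have "pts (rep_isoclass Y) = {bpt (rep_isoclass Y)} \<or> pts (rep_isoclass Z) = {bpt (rep_isoclass Z)}"
      using ind amodule_rep unfolding indecomposable_def by blast
    then show ?thesis
      using isoclass_zero_iff[OF finite_amodule_rep, of Y] isoclass_zero_iff[OF finite_amodule_rep, of Z]
      by auto
  qed
  then show "indec (isoclass M)"
    using ind assms by (auto simp: indec_def indecomposable_def isoclass_zero_iff)
qed

text \<open>
  By induction on the dimension: the summands of a proper decomposition have smaller dimension.
\<close>

lemma indec_decomposition:
  "\<exists>Xs. (\<forall>X\<in>set Xs. indec X) \<and> X = sum_list Xs"
proof (induction "cdim X" arbitrary: X rule: less_induct)
  case less
  consider "X = 0" | "indec X" | Y Z where "X = Y + Z" "Y \<noteq> 0" "Z \<noteq> 0"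
    unfolding indec_def by blast
  then show ?case
  proof cases
    case 1
    then show ?thesis by (intro exI[of _ "[]"]) simp
  next
    case 2
    then show ?thesis by (intro exI[of _ "[X]"]) simp
  next
    case (3 Y Z)
    then have "0 < cdim Y" "0 < cdim Z" by (metis cdim_eq_0_iff neq0_conv)+
    with 3 have "cdim Y < cdim X" "cdim Z < cdim X" by simp_all
    then obtain Ys Zs where "\<forall>X\<in>set Ys. indec X" "Y = sum_list Ys" "\<forall>X\<in>set Zs. indec X" "Z = sum_list Zs"
      using less by metis
    with 3 show ?thesis by (intro exI[of _ "Ys @ Zs"]) auto
  qed
qed


subsection \<open>Submodules and quotients\<close>

abbreviation restrict_pts :: "('a, 'm) amod \<Rightarrow> 'm set \<Rightarrow> ('a, 'm) amod" where
  "restrict_pts M N \<equiv> M\<lparr>pts := N\<rparr>"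

lemma subamodsD:
  assumes "N \<in> subamods M"
  shows "N \<subseteq> pts M" "bpt M \<in> N" "n \<in> N \<Longrightarrow> act M a n \<in> N"
  using assms by (auto simp: subamods_def)

lemma finite_subamods [simp]: "finite_amodule M \<Longrightarrow> finite (subamods M)"
  by (rule finite_subset[of _ "Pow (pts M)"]) (auto simp: subamods_def finite_amodule_def)

lemma quot_amod_simps [simp]:
  "pts (quot_amod M N) = (pts M - N) \<union> {bpt M}" "bpt (quot_amod M N) = bpt M"
  "act (quot_amod M N) a m = (if act M a m \<in> N then bpt M else act M a m)"
  by (simp_all add: quot_amod_def)

lemma finite_amodule_sub [simp]:
  assumes "finite_amodule M" "N \<in> subamods M"
  shows "finite_amodule (restrict_pts M N)"
proof -
  note M = amoduleD[OF finite_amoduleD(1)[OF assms(1)]] and N = subamodsD[OF assms(2)]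
  have "m \<in> pts M" if "m \<in> N" for m
    using that N(1) by auto
  moreover have "finite N"
    using finite_subset[OF N(1)] finite_amoduleD(2)[OF assms(1)] by simp
  ultimately show ?thesis
    using M N(2,3) by (simp add: finite_amodule_def amodule_def)
qed

lemma finite_amodule_quot [simp]:
  assumes "finite_amodule M" "N \<in> subamods M"
  shows "finite_amodule (quot_amod M N)"
proof -
  note M = amoduleD[OF finite_amoduleD(1)[OF assms(1)]] and N = subamodsD[OF assms(2)]
  have "finite (pts M)"
    using finite_amoduleD(2)[OF assms(1)] .
  then show ?thesis
    using N(2,3) by (auto simp: finite_amodule_def amodule_def M)
qed

lemma cdim_sub_quot:
  assumes "finite_amodule M" "N \<in> subamods M"
  shows "cdim (isoclass (quot_amod M N)) + cdim (isoclass (restrict_pts M N)) = cdim (isoclass M)"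
proof -
  note N = subamodsD[OF assms(2)]
  have fin: "finite (pts M)" "finite N"
    using finite_amoduleD(2)[OF assms(1)] finite_subset[OF N(1)] by auto
  have "card (pts (quot_amod M N)) = Suc (card (pts M - N))"
    using fin N by (simp add: card_insert_if)
  moreover have "card (pts M) = card (pts M - N) + card N"
    using fin N card_mono[OF fin(1) N(1)] by (simp add: card_Diff_subset)
  ultimately show ?thesis
    using card_pts[OF assms(1)] card_pts[OF finite_amodule_quot[OF assms]]
      card_pts[OF finite_amodule_sub[OF assms]] by simp
qed

lemma isoclass_quot_zero_iff:
  assumes "finite_amodule M" "N \<in> subamods M"
  shows "isoclass (quot_amod M N) = 0 \<longleftrightarrow> N = pts M"
  using subamodsD[OF assms(2)] by (auto simp: isoclass_zero_iff[OF finite_amodule_quot[OF assms]])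

lemma isoclass_sub_zero_iff:
  assumes "finite_amodule M" "N \<in> subamods M"
  shows "isoclass (restrict_pts M N) = 0 \<longleftrightarrow> N = {bpt M}"
  by (simp add: isoclass_zero_iff[OF finite_amodule_sub[OF assms]])

lemma trivial_subamods [simp]:
  assumes "finite_amodule M"
  shows "pts M \<in> subamods M" "{bpt M} \<in> subamods M"
  using amoduleD[OF finite_amoduleD(1)[OF assms]] by (auto simp: subamods_def)

lemma isoclass_quot_bpt:
  assumes "finite_amodule M"
  shows "isoclass (quot_amod M {bpt M}) = isoclass M"
proof (rule isoclass_eqI)
  note M = amoduleD[OF finite_amoduleD(1)[OF assms]]
  show "quot_amod M {bpt M} \<cong>\<^sub>A M"
    by (rule amod_isoI[where f = "\<lambda>x. x" and g = "\<lambda>x. x"])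
      (use assms M finite_amoduleD(1)[OF finite_amodule_quot[OF assms trivial_subamods(2)[OF assms]]] in auto)
qed (use assms in simp)

text \<open>
  An isomorphism matches submodules, and induces isomorphisms of the submodules and of the quotients.
\<close>

lemma sum_subamods_iso:
  assumes M: "finite_amodule M" and "M \<cong>\<^sub>A M'"
  shows "(\<Sum>N\<in>subamods M. h (isoclass (quot_amod M N)) (isoclass (restrict_pts M N))) =
    (\<Sum>N\<in>subamods M'. h (isoclass (quot_amod M' N)) (isoclass (restrict_pts M' N)))"
proof -
  obtain f g where "amod_inverse_isos M M' f g"
    using assms(2) by (rule amod_isoE)
  note f = amod_inverse_isosD[OF this]
  note MD = amoduleD[OF finite_amoduleD(1)[OF M]]
  have M': "finite_amodule M'"
    using finite_amodule_iso[OF assms] .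
  note MD' = amoduleD[OF finite_amoduleD(1)[OF M']]
  have gf: "g ` f ` N = N" if "N \<subseteq> pts M" for N
    using that f(3) by (force simp: image_image)
  have fg: "f ` g ` N = N" if "N \<subseteq> pts M'" for N
    using that f(4) by (force simp: image_image)
  have fS: "f ` N \<in> subamods M'" if "N \<in> subamods M" for N
  proof -
    note N = subamodsD[OF that]
    have "act M' a (f n) \<in> f ` N" if "n \<in> N" for a n
      using N(3)[OF that, of a] f(7)[of n a] that N(1) by (metis imageI subsetD)
    then show ?thesis
      using N(2) f(5) subset_trans[OF image_mono[OF N(1)] f(1)]
      by (auto simp: subamods_def image_subset_iff intro: rev_image_eqI)
  qed
  have gS: "g ` N \<in> subamods M" if "N \<in> subamods M'" for N
  proof -
    note N = subamodsD[OF that]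
    have "act M a (g n) \<in> g ` N" if "n \<in> N" for a n
      using N(3)[OF that, of a] f(8)[of n a] that N(1) by (metis imageI subsetD)
    then show ?thesis
      using N(2) f(6) subset_trans[OF image_mono[OF N(1)] f(2)]
      by (auto simp: subamods_def image_subset_iff intro: rev_image_eqI)
  qed
  have inj: "f m \<in> f ` N \<longleftrightarrow> m \<in> N" if "m \<in> pts M" "N \<subseteq> pts M" for m N
    using f(3) that by (metis gf image_eqI)
  have q: "isoclass (quot_amod M N) = isoclass (quot_amod M' (f ` N))" if N: "N \<in> subamods M" for N
  proof (rule isoclass_eqI)
    note ND = subamodsD[OF N]
    have in_g: "g n \<in> N \<longleftrightarrow> n \<in> f ` N" if "n \<in> pts M'" for n
      using inj[of "g n" N] f(2,4) that ND by auto
    have sub: "m \<in> pts (quot_amod M N) \<Longrightarrow> m \<in> pts M" "n \<in> pts (quot_amod M' (f ` N)) \<Longrightarrow> n \<in> pts M'" for m n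
      using MD(1) MD'(1) by auto
    show "quot_amod M N \<cong>\<^sub>A quot_amod M' (f ` N)"
    proof (rule amod_isoI[where f = f and g = g])
      show "f ` pts (quot_amod M N) \<subseteq> pts (quot_amod M' (f ` N))"
        using f(1,5) ND(1) by (auto simp: inj) (metis f(3) subsetD)
      show "g ` pts (quot_amod M' (f ` N)) \<subseteq> pts (quot_amod M N)"
        using f(2,6) by (auto simp: in_g)
      fix a m assume "m \<in> pts (quot_amod M N)"
      then show "f (act (quot_amod M N) a m) = act (quot_amod M' (f ` N)) a (f m)"
        using sub(1) MD(2) ND(1) by (simp add: inj f(5) del: quot_amod_simps(1) flip: f(7))
    qed (use sub f(3,4,5) finite_amoduleD(1)[OF finite_amodule_quot[OF M N]]
        in \<open>simp_all del: quot_amod_simps(1)\<close>)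
  qed (use M N in simp)
  have s: "isoclass (restrict_pts M N) = isoclass (restrict_pts M' (f ` N))" if N: "N \<in> subamods M" for N
  proof (rule isoclass_eqI)
    note ND = subamodsD[OF N]
    show "restrict_pts M N \<cong>\<^sub>A restrict_pts M' (f ` N)"
      by (rule amod_isoI[where f = f and g = g])
        (use ND f(3,4,5,7) in \<open>auto simp: finite_amoduleD(1)[OF finite_amodule_sub[OF M N]] subset_iff\<close>)
  qed (use M N in simp)
  show ?thesis
    by (rule sum.reindex_bij_witness[where i = "image g" and j = "image f"])
      (simp_all only: gf fg fS gS q s subamodsD(1))
qed

text \<open>
  This is where \<open>A\<close> has to be finitely generated.  A module of dimension at most \<open>d\<close> is isomorphic to one
  with points in \<open>{..d}\<close>, and the action is determined by the action of the generators, for which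
  there are only finitely many possibilities.
\<close>

lemma finite_isoclasses_bounded:
  assumes "finitely_generated TYPE('a::{semigroup_mult,mult_zero})"
  shows "finite {X :: 'a isoclass. cdim X \<le> d}"
proof -
  obtain S :: "'a set" where S: "finite S" "words S = UNIV"
    using assms unfolding finitely_generated_def by blast
  let ?std = "\<lambda>M :: ('a, nat) amod. finite_amodule M \<and> pts M \<subseteq> {..d} \<and> bpt M \<in> {..d}"
  \<comment> \<open>the multiplication table, restricted to the generators\<close>
  define code :: "('a, nat) amod \<Rightarrow> nat set \<times> nat \<times> ('a \<times> nat \<Rightarrow> nat)" where
    "code M = (pts M, bpt M, restrict (\<lambda>(a, m). act M a m) (S \<times> pts M))" for M
  have "\<exists>M. ?std M \<and> X = isoclass M" if X: "cdim X \<le> d" for X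
  proof -
    obtain M :: "('a, nat) amod" where M: "finite_amodule M" "X = isoclass M"
      by (rule isoclassE)
    have "card (pts M) = Suc (cdim X)"
      using M card_pts by simp
    then obtain h where h: "bij_betw h (pts M) {..cdim X}"
      using finite_same_card_bij[of "pts M" "{..cdim X}"] finite_amoduleD[OF M(1)] by auto
    let ?M = "amod_image h M"
    have iso: "M \<cong>\<^sub>A ?M"
      by (rule amod_image_iso) (use h M finite_amoduleD in \<open>auto simp: bij_betw_def\<close>)
    have "finite_amodule ?M"
      using finite_amodule_iso[OF M(1) iso] .
    moreover have "pts ?M \<subseteq> {..d}"
      using h X by (auto simp: amod_image_def bij_betw_def)
    moreover have "isoclass M = isoclass ?M"
      by (rule isoclass_eqI[OF M(1) iso])
    ultimately show ?thesis
      using M(2) amoduleD(1)[of ?M] finite_amoduleD(1) by blast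
  qed
  then have sub: "{X :: 'a isoclass. cdim X \<le> d} \<subseteq> isoclass ` {M. ?std M}"
    by blast
  have eq: "isoclass M = isoclass N" if M: "?std M" and N: "?std N" and "code M = code N" for M N
  proof (rule isoclass_eqI)
    have MN: "pts M = pts N" "bpt M = bpt N"
      using that by (auto simp: code_def)
    note MD = amoduleD[OF finite_amoduleD(1)[OF conjunct1[OF M]]]
      and ND = amoduleD[OF finite_amoduleD(1)[OF conjunct1[OF N]]]
    have gen: "act M a m = act N a m" if "a \<in> S" "m \<in> pts M" for a m
    proof -
      have "restrict (\<lambda>(a, m). act M a m) (S \<times> pts M) = restrict (\<lambda>(a, m). act N a m) (S \<times> pts N)"
        using \<open>code M = code N\<close> unfolding code_def prod.inject by blast
      from fun_cong[OF this, of "(a, m)"] show ?thesis using that MN by simp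
    qed
    have "\<forall>m\<in>pts M. act M a m = act N a m" if "a \<in> words S" for a
      using that
    proof (induction rule: words.induct)
      case (letter a)
      then show ?case using gen by simp
    next
      case (prepend a b)
      then show ?case
        using MD(2,3) ND(2,3) MN gen by auto
    qed
    then show "M \<cong>\<^sub>A N"
      by (intro amod_isoI[where f = "\<lambda>x. x" and g = "\<lambda>x. x"])
        (use S MN M finite_amoduleD(1) in auto)
  qed (use M in simp)
  have "finite (Pow {..d} \<times> {..d} \<times> (\<Union>P\<in>Pow {..d}. (S \<times> P) \<rightarrow>\<^sub>E {..d}))"
  proof (intro finite_cartesian_product finite_UN_I finite_PiE)
    show "finite P" if "P \<in> Pow {..d}" for P
      using that by (auto intro: finite_subset)
  qed (use S(1) in auto)
  moreover have "code ` {M. ?std M} \<subseteq> Pow {..d} \<times> {..d} \<times> (\<Union>P\<in>Pow {..d}. (S \<times> P) \<rightarrow>\<^sub>E {..d})"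
  proof
    fix c assume "c \<in> code ` {M. ?std M}"
    then obtain M where M: "?std M" "c = code M" by blast
    have "restrict (\<lambda>(a, m). act M a m) (S \<times> pts M) \<in> (S \<times> pts M) \<rightarrow>\<^sub>E {..d}"
      using M(1) amoduleD(2)[OF finite_amoduleD(1), of M] by auto
    then show "c \<in> Pow {..d} \<times> {..d} \<times> (\<Union>P\<in>Pow {..d}. (S \<times> P) \<rightarrow>\<^sub>E {..d})"
      unfolding M(2) code_def mem_Times_iff fst_conv snd_conv using M(1) by blast
  qed
  ultimately have "finite (code ` {M. ?std M})"
    by (rule rev_finite_subset)
  moreover have "isoclass ` {M. ?std M} = (\<lambda>c. isoclass (SOME M. ?std M \<and> code M = c)) ` code ` {M. ?std M}"
  proof -
    have "isoclass M = isoclass (SOME N. ?std N \<and> code N = code M)" if "?std M" for M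
      using someI_ex[of "\<lambda>N. ?std N \<and> code N = code M"] eq that by (metis (no_types, lifting))
    then show ?thesis by (auto simp: image_image)
  qed
  ultimately show ?thesis
    using finite_subset[OF sub] by simp
qed

section \<open>Finitely supported functions\<close>

definition fun_space :: "(rat, 'i \<Rightarrow> rat) module" where
  "fun_space = \<lparr>carrier = {f. finite {X. f X \<noteq> 0}}, monoid.mult = undefined, one = undefined,
     zero = (\<lambda>_. 0), add = (\<lambda>f g X. f X + g X), smult = (\<lambda>c f X. c * f X)\<rparr>"

lemma fun_space_simps [simp]:
  "carrier fun_space = {f. finite {X. f X \<noteq> 0}}" "zero fun_space = (\<lambda>_. 0)"
  "add fun_space = (\<lambda>f g X. f X + g X)" "smult fun_space = (\<lambda>c f X. c * f X)"
  by (simp_all add: fun_space_def)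

lemma finite_support_add:
  "finite {X. f X \<noteq> 0} \<Longrightarrow> finite {X. g X \<noteq> 0} \<Longrightarrow> finite {X. f X + g X \<noteq> (0::rat)}"
  by (rule finite_subset[of _ "{X. f X \<noteq> 0} \<union> {X. g X \<noteq> 0}"]) auto

lemma finite_support_smult: "finite {X. f X \<noteq> 0} \<Longrightarrow> finite {X. c * f X \<noteq> (0::rat)}"
  by (rule finite_subset[of _ "{X. f X \<noteq> 0}"]) auto

lemma finite_support_delta [simp]: "finite {X. delta q X \<noteq> 0}"
  by (rule finite_subset[of _ "{q}"]) (auto simp: delta_def)

lemma finite_support_vimage:
  assumes "finite {q. f q \<noteq> 0}" "\<And>q. finite {p. h p = q}"
  shows "finite {p. f (h p) \<noteq> (0::rat)}"
proof -
  have "{p. f (h p) \<noteq> 0} = (\<Union>q\<in>{q. f q \<noteq> 0}. {p. h p = q})" by auto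
  then show ?thesis using assms by simp
qed

lemma finite_support_product:
  assumes "finite {X. f X \<noteq> 0}" "finite {Y. g Y \<noteq> 0}"
  shows "finite {p. f (fst p) * g (snd p) \<noteq> (0::rat)}" "finite {p. f (fst p) \<noteq> 0 \<and> g (snd p) \<noteq> (0::rat)}"
    "finite {p. g (snd p) \<noteq> 0 \<and> f (fst p) \<noteq> (0::rat)}"
  by (rule finite_subset[of _ "{X. f X \<noteq> 0} \<times> {Y. g Y \<noteq> 0}"]; use assms in auto)+

lemma Q_space_functions:
  fixes V :: "(rat, 'i \<Rightarrow> rat, 'c) module_scheme"
  assumes V: "carrier V = {f. finite {X. f X \<noteq> 0}}" "zero V = (\<lambda>_. 0)"
    "add V = (\<lambda>f g X. f X + g X)" "smult V = (\<lambda>c f X. c * f X)"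
  shows "Q_space V"
proof (intro Q_space.intro moduleI cring_QQ abelian_groupI)
  fix x assume "x \<in> carrier V"
  then show "\<exists>y\<in>carrier V. y \<oplus>\<^bsub>V\<^esub> x = \<zero>\<^bsub>V\<^esub>"
    using finite_support_smult[of x "-1"] by (intro bexI[of _ "\<lambda>X. - 1 * x X"]) (auto simp: V)
qed (auto simp: V algebra_simps intro: finite_support_add finite_support_smult)

lemma Q_space_fun_space: "Q_space fun_space"
  by (rule Q_space_functions) simp_all

text \<open>
  The identities for the product and the coproduct of the Hall algebra are linear in finitely supported
  functions, and are proved by comparing both sides on delta functions.
\<close>

lemma fun_space_linear_eqI:
  assumes "Q_space Z" "f \<in> Q_linear fun_space Z" "h \<in> Q_linear fun_space Z" "finite {X. F X \<noteq> 0}"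
    and "\<And>q. F q \<noteq> 0 \<Longrightarrow> f (delta q) = h (delta q)"
  shows "f F = h F"
  using assms(4)
proof (induction rule: finsupp_induct)
  case zero
  then show ?case
    using Q_linear_zero[OF Q_space_fun_space assms(1,2)] Q_linear_zero[OF Q_space_fun_space assms(1,3)]
    by simp
next
  case (step c q G)
  have "f (\<lambda>p. c * delta q p + G p) = h (\<lambda>p. c * delta q p + G p)"
    using step assms(5)[OF step(2)]
      Q_linear_add[OF assms(2), of "\<lambda>p. c * delta q p" G] Q_linear_add[OF assms(3), of "\<lambda>p. c * delta q p" G]
      Q_linear_smult[OF assms(2), of "delta q" c] Q_linear_smult[OF assms(3), of "delta q" c]
    by (simp add: finite_support_smult)
  then show ?case .
qed

lemma lincomb_linear:
  assumes "Q_space Z" "\<And>p. v p \<in> carrier Z"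
  shows "lincomb Z v \<in> Q_linear fun_space Z"
proof -
  interpret Z: Q_space Z by fact
  show ?thesis
    by (rule Q_linearI)
      (use assms(2) in \<open>auto intro!: Z.lincomb_closed simp: Z.lincomb_add Z.lincomb_smult Pi_iff\<close>)
qed

lemma lincomb_delta:
  assumes "Q_space Z" "v q \<in> carrier Z"
  shows "lincomb Z v (delta q) = v q"
  using Q_space.lincomb_single[of Z v q 1] assms Q_space.smult_one[OF assms]
  by (simp add: delta_def[abs_def])

section \<open>The Hall algebra\<close>

definition hmul ::
    "('a::{semigroup_mult,mult_zero} isoclass \<Rightarrow> rat) \<Rightarrow> ('a isoclass \<Rightarrow> rat) \<Rightarrow> 'a isoclass \<Rightarrow> rat" where
  "hmul f g X = (\<Sum>N\<in>subamods (rep_isoclass X).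
     f (isoclass (quot_amod (rep_isoclass X) N)) * g (isoclass (restrict_pts (rep_isoclass X) N)))"

lemma hmul_isoclass:
  assumes "finite_amodule M"
  shows "hmul f g (isoclass M) =
    (\<Sum>N\<in>subamods M. f (isoclass (quot_amod M N)) * g (isoclass (restrict_pts M N)))"
  unfolding hmul_def
  using sum_subamods_iso[OF finite_amodule_rep rep_isoclass_iso[OF assms], of "\<lambda>P Q. f P * g Q"] .

lemma hall_simps [simp]:
  "carrier hall = {f. finite {X. f X \<noteq> 0}}" "monoid.mult hall = hmul" "one hall = delta 0"
  "zero hall = (\<lambda>_. 0)" "add hall = (\<lambda>f g X. f X + g X)" "smult hall = (\<lambda>c f X. c * f X)"
  "counit hall = (\<lambda>f. f 0)"
  by (simp_all add: hall_def hall_algebra_def module.defs zero_isoclass_def hmul_def[abs_def] Let_def)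

lemma Q_linear_hall: "Q_linear hall Z = Q_linear fun_space Z" "Q_linear V hall = Q_linear V fun_space"
  by (simp_all add: Q_linear_def)

lemma hall_algebra_eq:
  "carrier hall_algebra = carrier hall" "add hall_algebra = add hall" "smult hall_algebra = smult hall"
  "monoid.mult hall_algebra = monoid.mult hall" "one hall_algebra = one hall"
  by (simp_all add: hall_def module.defs)

abbreviation "HH \<equiv> tensor hall hall"

text \<open>
  A finitely supported function on pairs of classes, viewed as an element of the tensor square.
\<close>

definition pair_tensor :: "('a::{semigroup_mult,mult_zero} isoclass \<times> 'a isoclass \<Rightarrow> rat)
       \<Rightarrow> (('a isoclass \<Rightarrow> rat) \<times> ('a isoclass \<Rightarrow> rat) \<Rightarrow>\<^sub>0 rat) set" where
  "pair_tensor = lincomb HH (\<lambda>p. tens hall hall (delta (fst p)) (delta (snd p)))"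

lemma comult_hall: "comult hall f = pair_tensor (\<lambda>(X, Y). f (X + Y))"
proof -
  note c = tensor_cong[OF hall_algebra_eq hall_algebra_eq]
  have "pairs_to_tensor F = pair_tensor F" for F :: "'a isoclass \<times> 'a isoclass \<Rightarrow> rat"
    unfolding pairs_to_tensor_def pair_tensor_def lincomb_def Let_def c ..
  then show ?thesis
    by (simp add: hall_def module.defs plus_isoclass_def)
qed

subsection \<open>The product\<close>

text \<open>
  Both sides count chains of submodules \<open>N \<subseteq> N'\<close> of \<open>M\<close>, weighted by \<open>f (M / N') g (N' / N) h (N)\<close>.  The
  submodule \<open>P\<close> of \<open>M / N\<close> corresponds to \<open>N' = N \<union> P\<close>, and conversely \<open>P = (N' - N) \<union> {*}\<close>.
\<close>

lemma hmul_assoc: "hmul (hmul f g) h = hmul f (hmul g h)"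
proof
  fix X :: "'a isoclass"
  obtain M :: "('a, nat) amod" where M: "finite_amodule M" "X = isoclass M"
    by (rule isoclassE)
  note MD = amoduleD[OF finite_amoduleD(1)[OF M(1)]]
  let ?S = "SIGMA N:subamods M. subamods (quot_amod M N)"
  let ?T = "SIGMA N':subamods M. subamods (restrict_pts M N')"
  let ?F = "\<lambda>N P. f (isoclass (quot_amod (quot_amod M N) P)) * g (isoclass (restrict_pts (quot_amod M N) P))
      * h (isoclass (restrict_pts M N))"
  let ?G = "\<lambda>N' N. f (isoclass (quot_amod M N')) * g (isoclass (quot_amod (restrict_pts M N') N))
      * h (isoclass (restrict_pts (restrict_pts M N') N))"
  have "hmul (hmul f g) h X = (\<Sum>N\<in>subamods M. \<Sum>P\<in>subamods (quot_amod M N). ?F N P)"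
    using M by (simp add: hmul_isoclass sum_distrib_right)
  also have "\<dots> = (\<Sum>(N, P)\<in>?S. ?F N P)"
    by (rule sum.Sigma) (use M in auto)
  also have "\<dots> = (\<Sum>(N', N)\<in>?T. ?G N' N)"
  proof (rule sum.reindex_bij_witness[where i = "\<lambda>(N', N). (N, (N' - N) \<union> {bpt M})" and j = "\<lambda>(N, P). (N \<union> P, N)"])
    fix a assume "a \<in> ?S"
    then obtain N P where a: "a = (N, P)" "N \<in> subamods M" "P \<in> subamods (quot_amod M N)" by auto
    note N = subamodsD[OF a(2)] and P = subamodsD[OF a(3)]
    show "(\<lambda>(N', N). (N, (N' - N) \<union> {bpt M})) ((\<lambda>(N, P). (N \<union> P, N)) a) = a"
      using N P unfolding a by auto
    have Pc: "act M b m \<in> N \<union> P" if "m \<in> P" for b m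
      using P(3)[OF that, of b] by (auto split: if_splits)
    show "(\<lambda>(N, P). (N \<union> P, N)) a \<in> ?T"
      using N P(1,2) unfolding a by (auto simp: subamods_def dest: Pc[unfolded Un_iff])
    have "quot_amod (quot_amod M N) P = quot_amod M (N \<union> P)"
      using N(2) P(2) by (auto simp: quot_amod_def fun_eq_iff)
    moreover have "restrict_pts (quot_amod M N) P = quot_amod (restrict_pts M (N \<union> P)) N"
      using N P by (auto simp: quot_amod_def fun_eq_iff)
    ultimately show "(\<lambda>(N', N). ?G N' N) ((\<lambda>(N, P). (N \<union> P, N)) a) = (\<lambda>(N, P). ?F N P) a"
      unfolding a by simp
  next
    fix b assume "b \<in> ?T"
    then obtain N' N where b: "b = (N', N)" "N' \<in> subamods M" "N \<in> subamods (restrict_pts M N')" by auto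
    note N' = subamodsD[OF b(2)] and N = subamodsD[OF b(3), simplified]
    show "(\<lambda>(N, P). (N \<union> P, N)) ((\<lambda>(N', N). (N, (N' - N) \<union> {bpt M})) b) = b"
      using N N' unfolding b by auto
    show "(\<lambda>(N', N). (N, (N' - N) \<union> {bpt M})) b \<in> ?S"
      using N N' MD(6) unfolding b by (auto simp: subamods_def)
  qed
  also have "\<dots> = (\<Sum>N'\<in>subamods M. \<Sum>N\<in>subamods (restrict_pts M N'). ?G N' N)"
    by (rule sum.Sigma[symmetric]) (use M in auto)
  also have "\<dots> = hmul f (hmul g h) X"
    using M by (simp add: hmul_isoclass sum_distrib_left mult.assoc)
  finally show "hmul (hmul f g) h X = hmul f (hmul g h) X" .
qed

lemma hmul_linear_simps:
  "hmul (\<lambda>X. f X + f' X) g = (\<lambda>X. hmul f g X + hmul f' g X)"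
  "hmul f (\<lambda>X. g X + g' X) = (\<lambda>X. hmul f g X + hmul f g' X)"
  "hmul (\<lambda>X. c * f X) g = (\<lambda>X. c * hmul f g X)"
  "hmul f (\<lambda>X. c * g X) = (\<lambda>X. c * hmul f g X)"
  by (auto simp: hmul_def fun_eq_iff sum.distrib sum_distrib_left algebra_simps)

lemma hmul_one_left: "hmul (delta 0) f = f"
proof
  fix X :: "'a isoclass"
  obtain M :: "('a, nat) amod" where M: "finite_amodule M" "X = isoclass M"
    by (rule isoclassE)
  have "hmul (delta 0) f X = (\<Sum>N\<in>subamods M. if N = pts M then f (isoclass (restrict_pts M N)) else 0)"
    unfolding M(2) hmul_isoclass[OF M(1)]
    by (rule sum.cong) (simp_all add: delta_def isoclass_quot_zero_iff M(1))
  then show "hmul (delta 0) f X = f X"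
    using M by (simp add: sum.delta)
qed

lemma hmul_one_right: "hmul f (delta 0) = f"
proof
  fix X :: "'a isoclass"
  obtain M :: "('a, nat) amod" where M: "finite_amodule M" "X = isoclass M"
    by (rule isoclassE)
  have "hmul f (delta 0) X = (\<Sum>N\<in>subamods M. if N = {bpt M} then f (isoclass (quot_amod M N)) else 0)"
    unfolding M(2) hmul_isoclass[OF M(1)]
    by (rule sum.cong) (simp_all add: delta_def isoclass_sub_zero_iff M(1))
  then show "hmul f (delta 0) X = f X"
    using M by (simp add: sum.delta isoclass_quot_bpt)
qed

lemma hmul_zero_class: "hmul f g 0 = f 0 * g 0"
proof -
  let ?Z = "zero_amod :: ('a, nat) amod"
  have Z: "finite_amodule ?Z" "isoclass ?Z = 0"
    by (simp_all add: finite_amodule_zero zero_isoclass_def)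
  have "subamods ?Z = {pts ?Z}"
    using trivial_subamods(1)[OF Z(1)] by (auto simp: subamods_def zero_amod_def)
  moreover have "isoclass (quot_amod ?Z (pts ?Z)) = 0"
    using Z(1) by (simp add: isoclass_quot_zero_iff)
  moreover have "isoclass (restrict_pts ?Z (pts ?Z)) = 0"
    using Z by simp
  ultimately show ?thesis
    using hmul_isoclass[OF Z(1), of f g] Z(2) by simp
qed

text \<open>The submodules of a wedge sum are the wedge sums of submodules of the two summands.\<close>

lemma hmul_wedge:
  fixes M :: "('a::{semigroup_mult,mult_zero}, 'm) amod" and N :: "('a, 'n) amod"
  assumes M: "finite_amodule M" and N: "finite_amodule N"
  shows "hmul f g (isoclass M + isoclass N) = (\<Sum>K\<in>subamods M. \<Sum>L\<in>subamods N.
    f (isoclass (quot_amod M K) + isoclass (quot_amod N L)) *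
    g (isoclass (restrict_pts M K) + isoclass (restrict_pts N L)))"
proof -
  let ?W = "wedge M N"
  let ?w = "\<lambda>(K, L). Inl ` K \<union> Inr ` (L - {bpt N})"
  note MD = amoduleD[OF finite_amoduleD(1)[OF M]] and ND = amoduleD[OF finite_amoduleD(1)[OF N]]
  have "hmul f g (isoclass M + isoclass N) =
      (\<Sum>U\<in>subamods ?W. f (isoclass (quot_amod ?W U)) * g (isoclass (restrict_pts ?W U)))"
    using hmul_isoclass[of ?W f g] M N by (simp add: isoclass_wedge)
  also have "\<dots> = (\<Sum>(K, L)\<in>subamods M \<times> subamods N.
      f (isoclass (quot_amod M K) + isoclass (quot_amod N L)) *
      g (isoclass (restrict_pts M K) + isoclass (restrict_pts N L)))"
  proof (rule sum.reindex_bij_witness[symmetric, where j = ?w and i = "\<lambda>U. (Inl -` U, insert (bpt N) (Inr -` U))"])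
    fix a assume "a \<in> subamods M \<times> subamods N"
    then obtain K L where a: "a = (K, L)" "K \<in> subamods M" "L \<in> subamods N" by auto
    note K = subamodsD[OF a(2)] and L = subamodsD[OF a(3)]
    show "(Inl -` ?w a, insert (bpt N) (Inr -` ?w a)) = a"
      using L(2) unfolding a by auto
    show w: "?w a \<in> subamods ?W"
      using K L MD(1,6) unfolding a by (auto simp: subamods_def split: if_splits)
    have "quot_amod ?W (?w a) \<cong>\<^sub>A wedge (quot_amod M K) (quot_amod N L)"
    proof (rule amod_isoI[where f = "\<lambda>x. x" and g = "\<lambda>x. x"])
      show "amodule (quot_amod ?W (?w a))"
        using finite_amodule_quot[OF finite_amodule_wedge[OF M N] w] finite_amoduleD(1) by blast
      show "act (quot_amod ?W (?w a)) b x = act (wedge (quot_amod M K) (quot_amod N L)) b x"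
        if "x \<in> pts (quot_amod ?W (?w a))" for b x
        using that K(2) L(2) unfolding a by (auto split: if_splits)
    qed (use K L in \<open>auto simp: a\<close>)
    then have "isoclass (quot_amod ?W (?w a)) = isoclass (wedge (quot_amod M K) (quot_amod N L))"
      by (rule isoclass_eqI[OF finite_amodule_quot[OF finite_amodule_wedge[OF M N] w]])
    then have "isoclass (quot_amod ?W (?w a)) = isoclass (quot_amod M K) + isoclass (quot_amod N L)"
      using a M N by (simp only: isoclass_wedge finite_amodule_quot)
    moreover have "restrict_pts ?W (?w a) = wedge (restrict_pts M K) (restrict_pts N L)"
      by (auto simp: wedge_def a fun_eq_iff split: sum.split)
    then have "isoclass (restrict_pts ?W (?w a)) = isoclass (restrict_pts M K) + isoclass (restrict_pts N L)"
      using a M N by (simp add: isoclass_wedge)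
    ultimately show "f (isoclass (quot_amod ?W (?w a))) * g (isoclass (restrict_pts ?W (?w a))) =
        (\<lambda>(K, L). f (isoclass (quot_amod M K) + isoclass (quot_amod N L)) *
          g (isoclass (restrict_pts M K) + isoclass (restrict_pts N L))) a"
      by (simp add: a)
  next
    fix U assume "U \<in> subamods ?W"
    note U = subamodsD[OF this]
    show "?w (Inl -` U, insert (bpt N) (Inr -` U)) = U"
      using U(1) by (auto simp: image_iff)
    have "act N b n \<in> insert (bpt N) (Inr -` U)" if "Inr n \<in> U" for b n
      using U(3)[OF that, of b] by (auto split: if_splits)
    then show "(Inl -` U, insert (bpt N) (Inr -` U)) \<in> subamods M \<times> subamods N"
      using U ND(1,6) U(3)[of "Inl m" for m] by (auto simp: subamods_def)
  qed
  also have "\<dots> = (\<Sum>K\<in>subamods M. \<Sum>L\<in>subamods N.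
      f (isoclass (quot_amod M K) + isoclass (quot_amod N L)) *
      g (isoclass (restrict_pts M K) + isoclass (restrict_pts N L)))"
    by (simp add: sum.cartesian_product)
  finally show ?thesis .
qed


text \<open>
  The product of the tensor square, on finitely supported functions on pairs of classes.
\<close>

definition pmul :: "('a::{semigroup_mult,mult_zero} isoclass \<times> 'a isoclass \<Rightarrow> rat) \<Rightarrow> ('a isoclass \<times> 'a isoclass \<Rightarrow> rat)
    \<Rightarrow> 'a isoclass \<times> 'a isoclass \<Rightarrow> rat" where
  "pmul F G = (\<lambda>(X, Y). let M = rep_isoclass X; N = rep_isoclass Y in
    \<Sum>K\<in>subamods M. \<Sum>L\<in>subamods N. F (isoclass (quot_amod M K), isoclass (quot_amod N L)) *
      G (isoclass (restrict_pts M K), isoclass (restrict_pts N L)))"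

text \<open>
  The compatibility of product and coproduct, before the passage to tensors: restricting a function
  to sums \<open>X + Y\<close> turns the Hall product into the product on pairs.
\<close>

lemma hmul_plus:
  "hmul f g ((\<lambda>(X, Y). X + Y) p) = pmul (\<lambda>p. f ((\<lambda>(X, Y). X + Y) p)) (\<lambda>p. g ((\<lambda>(X, Y). X + Y) p)) p"
  using hmul_wedge[OF finite_amodule_rep finite_amodule_rep, of f g "fst p" "snd p"]
  by (simp add: pmul_def split_beta Let_def)

lemma pmul_linear_simps:
  "pmul (\<lambda>p. F p + F' p) G p = pmul F G p + pmul F' G p" "pmul (\<lambda>p. c * F p) G p = c * pmul F G p"
  "pmul F (\<lambda>p. G p + G' p) p = pmul F G p + pmul F G' p" "pmul F (\<lambda>p. c * G p) p = c * pmul F G p"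
  by (simp_all add: pmul_def split_beta Let_def sum.distrib sum_distrib_left algebra_simps)

lemma pmul_product:
  "pmul (\<lambda>p. a (fst p) * b (snd p)) (\<lambda>p. c (fst p) * d (snd p)) p = hmul a c (fst p) * hmul b d (snd p)"
  unfolding pmul_def split_beta Let_def hmul_def sum_product
  by (intro sum.cong refl) (simp add: algebra_simps)

subsection \<open>The bialgebra structure\<close>

lemma Q_space_hall: "Q_space hall"
  by (rule Q_space_functions) simp_all

lemma Q_linear_fun_spaceI:
  assumes "\<And>F. finite {p. F p \<noteq> 0} \<Longrightarrow> finite {p. h F p \<noteq> 0}"
    and "\<And>F G p. h (\<lambda>p. F p + G p) p = h F p + h G p" "\<And>c F p. h (\<lambda>p. c * F p) p = c * h F p"
  shows "h \<in> Q_linear fun_space fun_space"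
  by (rule Q_linearI) (use assms in auto)

context
  assumes fg: "finitely_generated TYPE('a::{semigroup_mult,mult_zero})"
begin

lemma finite_classes_bounded: "finite {X :: 'a isoclass. cdim X \<le> d}"
  using finite_isoclasses_bounded[OF fg] .

text \<open>
  The coproduct stays in the finitely supported functions because a class has only finitely many
  decompositions into two summands.
\<close>

lemma finite_fibres:
  "finite {p :: 'a isoclass \<times> 'a isoclass. (\<lambda>(X, Y). X + Y) p = Z}"
  "finite {p :: 'a isoclass \<times> 'a isoclass \<times> 'a isoclass. (\<lambda>(X, Y, Z). (X + Y, Z)) p = q}"
  "finite {p :: 'a isoclass \<times> 'a isoclass \<times> 'a isoclass. (\<lambda>(X, Y, Z). (X, Y + Z)) p = q}"
proof -
  let ?B = "\<lambda>d. {X :: 'a isoclass. cdim X \<le> d}"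
  show "finite {p :: 'a isoclass \<times> 'a isoclass. (\<lambda>(X, Y). X + Y) p = Z}"
    by (rule finite_subset[of _ "?B (cdim Z) \<times> ?B (cdim Z)"]) (auto simp: finite_classes_bounded)
  show "finite {p :: 'a isoclass \<times> 'a isoclass \<times> 'a isoclass. (\<lambda>(X, Y, Z). (X + Y, Z)) p = q}"
    by (rule finite_subset[of _ "?B (cdim (fst q)) \<times> ?B (cdim (fst q)) \<times> {snd q}"])
      (auto simp: finite_classes_bounded)
  show "finite {p :: 'a isoclass \<times> 'a isoclass \<times> 'a isoclass. (\<lambda>(X, Y, Z). (X, Y + Z)) p = q}"
    by (rule finite_subset[of _ "{fst q} \<times> ?B (cdim (snd q)) \<times> ?B (cdim (snd q))"])
      (auto simp: finite_classes_bounded)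
qed

lemma support_bounded:
  assumes "finite {X :: 'a isoclass. f X \<noteq> (0::rat)}"
  shows "\<exists>d. \<forall>X. f X \<noteq> 0 \<longrightarrow> cdim X \<le> d"
proof -
  have "finite (cdim ` {X. f X \<noteq> 0})" using assms by simp
  then show ?thesis
    unfolding finite_nat_set_iff_bounded_le by blast
qed

text \<open>
  The dimension of a module is the sum of those of a submodule and of the quotient, so the support of
  a product is bounded in dimension.
\<close>

lemma finite_support_hmul:
  fixes f g :: "'a isoclass \<Rightarrow> rat"
  assumes "finite {X. f X \<noteq> 0}" "finite {X. g X \<noteq> 0}"
  shows "finite {X. hmul f g X \<noteq> 0}"
proof -
  obtain d where d: "\<And>X. f X \<noteq> 0 \<Longrightarrow> cdim X \<le> d" using support_bounded[OF assms(1)] by blast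
  obtain e where e: "\<And>X. g X \<noteq> 0 \<Longrightarrow> cdim X \<le> e" using support_bounded[OF assms(2)] by blast
  have "cdim X \<le> d + e" if nz: "hmul f g X \<noteq> 0" for X
  proof -
    let ?M = "rep_isoclass X"
    obtain N where N: "N \<in> subamods ?M" "f (isoclass (quot_amod ?M N)) * g (isoclass (restrict_pts ?M N)) \<noteq> 0"
      using nz unfolding hmul_def by (rule sum.not_neutral_contains_not_neutral)
    then have "cdim (isoclass (quot_amod ?M N)) \<le> d" "cdim (isoclass (restrict_pts ?M N)) \<le> e"
      using d e by auto
    then show ?thesis
      using cdim_sub_quot[OF finite_amodule_rep N(1)] by simp
  qed
  then show ?thesis
    by (intro finite_subset[OF _ finite_classes_bounded[of "d + e"]]) auto
qed

lemma Q_algebra_hall: "Q_algebra (hall :: ('a isoclass \<Rightarrow> rat) bialg)"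
proof (rule Q_algebraI[OF Q_space_hall])
  show "(\<lambda>x y. x \<otimes>\<^bsub>hall\<^esub> y) \<in> Q_bilinear hall hall (hall :: ('a isoclass \<Rightarrow> rat) bialg)"
    by (auto intro!: Q_bilinearI Q_linearI finite_support_hmul simp: hmul_linear_simps)
qed (auto simp: hmul_one_left hmul_one_right hmul_assoc finite_support_hmul)

interpretation H: Q_alg "hall :: ('a isoclass \<Rightarrow> rat) bialg"
  by unfold_locales (rule Q_algebra_hall)

lemmas spH = H.Q_space_axioms H.Q_space_axioms

interpretation HH: Q_alg "HH :: (rat, (('a isoclass \<Rightarrow> rat) \<times> ('a isoclass \<Rightarrow> rat) \<Rightarrow>\<^sub>0 rat) set) module"
  by unfold_locales (intro Q_algebra_tensor Q_algebra_hall)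

lemma delta_closed [simp]: "delta X \<in> carrier (hall :: ('a isoclass \<Rightarrow> rat) bialg)"
  by simp

abbreviation delta_tens :: "'a isoclass \<times> 'a isoclass \<Rightarrow> _" where
  "delta_tens \<equiv> \<lambda>p. tens hall hall (delta (fst p)) (delta (snd p))"

lemma delta_tens_closed: "delta_tens p \<in> carrier HH"
  by (rule tens_closed[OF spH]) auto

lemma pair_tensor_linear: "pair_tensor \<in> Q_linear fun_space (HH :: (rat, (('a isoclass \<Rightarrow> rat) \<times> ('a isoclass \<Rightarrow> rat) \<Rightarrow>\<^sub>0 rat) set) module)"
  unfolding pair_tensor_def by (rule lincomb_linear[OF HH.Q_space_axioms delta_tens_closed])

lemma pair_tensor_delta: "pair_tensor (delta p) = delta_tens p"
  unfolding pair_tensor_def by (rule lincomb_delta[OF HH.Q_space_axioms, of delta_tens, OF delta_tens_closed])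

lemma pair_tensor_product:
  fixes f g :: "'a isoclass \<Rightarrow> rat"
  assumes f: "finite {X. f X \<noteq> 0}" and g: "finite {X. g X \<noteq> 0}"
  shows "pair_tensor (\<lambda>p. f (fst p) * g (snd p)) = tens hall hall f g"
proof -
  have step: "pair_tensor (\<lambda>p. f (fst p) * g (snd p)) = tens hall hall f g"
    if f: "finite {X. f X \<noteq> 0}" and g: "finite {X. g X \<noteq> 0}"
      and d: "\<And>q. pair_tensor (\<lambda>p. delta q (fst p) * g (snd p)) = tens hall hall (delta q) g"
    for f g :: "'a isoclass \<Rightarrow> rat"
  proof (rule fun_space_linear_eqI[where f = "\<lambda>f. pair_tensor (\<lambda>p. f (fst p) * g (snd p))" and h = "\<lambda>f. tens hall hall f g",
        OF HH.Q_space_axioms Q_linear_comp[OF Q_linear_fun_spaceI pair_tensor_linear] _ f d])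
    show "(\<lambda>f :: 'a isoclass \<Rightarrow> rat. tens hall hall f g) \<in> Q_linear fun_space HH"
      using tens_linear_left[OF spH, of g] g by (simp add: Q_linear_hall)
  qed (use g in \<open>auto simp: algebra_simps intro: finite_support_product\<close>)
  have "pair_tensor (\<lambda>p. delta q (fst p) * g (snd p)) = tens hall hall (delta q) g" for q
  proof (rule fun_space_linear_eqI[where f = "\<lambda>g. pair_tensor (\<lambda>p. delta q (fst p) * g (snd p))" and h = "\<lambda>g. tens hall hall (delta q) g",
        OF HH.Q_space_axioms Q_linear_comp[OF Q_linear_fun_spaceI pair_tensor_linear] _ g])
    show "(\<lambda>g :: 'a isoclass \<Rightarrow> rat. tens hall hall (delta q) g) \<in> Q_linear fun_space HH"
      using tens_linear_right[OF spH, of "delta q"] by (simp add: Q_linear_hall)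
    fix r :: "'a isoclass"
    have "(\<lambda>p. delta q (fst p) * delta r (snd p)) = delta (q, r)"
      by (auto simp: delta_def)
    then show "pair_tensor (\<lambda>p. delta q (fst p) * delta r (snd p)) = tens hall hall (delta q) (delta r)"
      by (simp add: pair_tensor_delta)
  qed (auto simp: algebra_simps intro: finite_support_product)
  then show ?thesis by (rule step[OF f g])
qed

lemma finite_support_pmul:
  fixes F G :: "'a isoclass \<times> 'a isoclass \<Rightarrow> rat"
  assumes "finite {p. F p \<noteq> 0}" "finite {p. G p \<noteq> 0}"
  shows "finite {p. pmul F G p \<noteq> 0}"
proof -
  have bnd: "\<exists>d. \<forall>p. H p \<noteq> 0 \<longrightarrow> cdim (fst p) \<le> d \<and> cdim (snd p) \<le> d"
    if "finite {p. H p \<noteq> 0}" for H :: "'a isoclass \<times> 'a isoclass \<Rightarrow> rat"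
  proof -
    have "finite ((\<lambda>p. cdim (fst p) + cdim (snd p)) ` {p. H p \<noteq> 0})" using that by simp
    then obtain d where "\<forall>n\<in>(\<lambda>p. cdim (fst p) + cdim (snd p)) ` {p. H p \<noteq> 0}. n \<le> d"
      unfolding finite_nat_set_iff_bounded_le by blast
    then show ?thesis by (intro exI[of _ d]) fastforce
  qed
  obtain d where d: "\<And>p. F p \<noteq> 0 \<Longrightarrow> cdim (fst p) \<le> d \<and> cdim (snd p) \<le> d" using bnd[OF assms(1)] by blast
  obtain e where e: "\<And>p. G p \<noteq> 0 \<Longrightarrow> cdim (fst p) \<le> e \<and> cdim (snd p) \<le> e" using bnd[OF assms(2)] by blast
  have "cdim (fst p) \<le> d + e \<and> cdim (snd p) \<le> d + e" if p: "pmul F G p \<noteq> 0" for p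
  proof -
    let ?M = "rep_isoclass (fst p)" and ?N = "rep_isoclass (snd p)"
    obtain K where K: "K \<in> subamods ?M" and nzK: "(\<Sum>L\<in>subamods ?N. F (isoclass (quot_amod ?M K), isoclass (quot_amod ?N L)) *
      G (isoclass (restrict_pts ?M K), isoclass (restrict_pts ?N L))) \<noteq> 0"
      using p unfolding pmul_def split_beta Let_def by (rule sum.not_neutral_contains_not_neutral)
    from nzK obtain L where L: "L \<in> subamods ?N" and nz: "F (isoclass (quot_amod ?M K), isoclass (quot_amod ?N L)) *
      G (isoclass (restrict_pts ?M K), isoclass (restrict_pts ?N L)) \<noteq> 0"
      by (rule sum.not_neutral_contains_not_neutral)
    show ?thesis
      using d[of "(isoclass (quot_amod ?M K), isoclass (quot_amod ?N L))"]
        e[of "(isoclass (restrict_pts ?M K), isoclass (restrict_pts ?N L))"] nz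
        cdim_sub_quot[OF finite_amodule_rep K] cdim_sub_quot[OF finite_amodule_rep L] by auto
  qed
  then show ?thesis
    by (intro finite_subset[OF _ finite_cartesian_product[OF finite_classes_bounded[of "d + e"] finite_classes_bounded[of "d + e"]]])
      auto
qed

text \<open>
  Both sides are bilinear.  For delta functions, \<open>pmul\<close> factors into a function of the first and a
  function of the second class, and the product of pure tensors is taken factor by factor.
\<close>

lemma pair_tensor_pmul:
  fixes F G :: "'a isoclass \<times> 'a isoclass \<Rightarrow> rat"
  assumes F: "finite {p. F p \<noteq> 0}" and G: "finite {p. G p \<noteq> 0}"
  shows "pair_tensor (pmul F G) = pair_tensor F \<otimes>\<^bsub>HH\<^esub> pair_tensor G"
proof -
  have dd: "pair_tensor (pmul (delta p) (delta q)) = pair_tensor (delta p) \<otimes>\<^bsub>HH\<^esub> pair_tensor (delta q)"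
    for p q :: "'a isoclass \<times> 'a isoclass"
  proof -
    have e: "delta p = (\<lambda>r. delta (fst p) (fst r) * delta (snd p) (snd r))"
      for p :: "'a isoclass \<times> 'a isoclass"
      by (auto simp: delta_def prod_eq_iff)
    have "pmul (delta p) (delta q) r =
        hmul (delta (fst p)) (delta (fst q)) (fst r) * hmul (delta (snd p)) (delta (snd q)) (snd r)" for r
      by (subst e[of p], subst e[of q]) (rule pmul_product)
    then have "pmul (delta p) (delta q) = (\<lambda>r. hmul (delta (fst p)) (delta (fst q)) (fst r) *
        hmul (delta (snd p)) (delta (snd q)) (snd r))" ..
    then have "pair_tensor (pmul (delta p) (delta q)) = tens hall hall (hmul (delta (fst p)) (delta (fst q)))
        (hmul (delta (snd p)) (delta (snd q)))"
      by (simp only: pair_tensor_product finite_support_hmul finite_support_delta)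
    then show ?thesis
      using tensor_mult_tens[OF Q_algebra_hall Q_algebra_hall, of "delta (fst p)" "delta (snd p)"
          "delta (fst q)" "delta (snd q)"]
      by (simp add: pair_tensor_delta)
  qed
  have c: "pair_tensor F \<in> carrier HH" if "finite {p. F p \<noteq> 0}" for F :: "'a isoclass \<times> 'a isoclass \<Rightarrow> rat"
    using Q_linear_closed[OF pair_tensor_linear] that by simp
  have d: "pair_tensor (pmul (delta p) G) = pair_tensor (delta p) \<otimes>\<^bsub>HH\<^esub> pair_tensor G"
    for p :: "'a isoclass \<times> 'a isoclass"
    by (rule fun_space_linear_eqI[OF HH.Q_space_axioms Q_linear_comp[OF Q_linear_fun_spaceI pair_tensor_linear]
          Q_linear_comp[OF pair_tensor_linear HH.mult_linear_right] G dd])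
      (auto simp: pmul_linear_simps finite_support_pmul intro: c)
  show ?thesis
    by (rule fun_space_linear_eqI[where f = "\<lambda>F. pair_tensor (pmul F G)" and h = "\<lambda>F. pair_tensor F \<otimes>\<^bsub>HH\<^esub> pair_tensor G",
          OF HH.Q_space_axioms Q_linear_comp[OF Q_linear_fun_spaceI pair_tensor_linear]
          Q_linear_comp[OF pair_tensor_linear HH.mult_linear_left] F d])
      (use G in \<open>auto simp: pmul_linear_simps finite_support_pmul intro: c\<close>)
qed

lemma comult_hall_eq: "comult hall f = pair_tensor (\<lambda>p. f ((\<lambda>(X, Y). X + Y) p))"
  by (simp add: comult_hall case_prod_unfold)

lemma finite_support_plus:
  "finite {X. f X \<noteq> 0} \<Longrightarrow> finite {p. f ((\<lambda>(X, Y :: 'a isoclass). X + Y) p) \<noteq> (0::rat)}"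
  by (rule finite_support_vimage[OF _ finite_fibres(1)])

lemma comult_hall_linear: "comult hall \<in> Q_linear hall (HH :: (rat, (('a isoclass \<Rightarrow> rat) \<times> ('a isoclass \<Rightarrow> rat) \<Rightarrow>\<^sub>0 rat) set) module)"
  unfolding comult_hall_eq[abs_def] Q_linear_hall
  by (rule Q_linear_comp[OF Q_linear_fun_spaceI pair_tensor_linear]) (auto intro: finite_support_plus)

lemma comult_hall_ring_hom: "comult hall \<in> ring_hom hall (HH :: (rat, (('a isoclass \<Rightarrow> rat) \<times> ('a isoclass \<Rightarrow> rat) \<Rightarrow>\<^sub>0 rat) set) module)"
proof (rule Q_linear_ring_homI[OF comult_hall_linear])
  have "(\<lambda>p. delta 0 ((\<lambda>(X, Y :: 'a isoclass). X + Y) p)) = delta (0, 0)"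
    by (auto simp: delta_def fun_eq_iff)
  then show "comult hall \<one>\<^bsub>hall\<^esub> = \<one>\<^bsub>(HH :: (rat, (('a isoclass \<Rightarrow> rat) \<times> ('a isoclass \<Rightarrow> rat) \<Rightarrow>\<^sub>0 rat) set) module)\<^esub>"
    unfolding comult_hall_eq by (simp add: pair_tensor_delta tensor_one)
  fix f g :: "'a isoclass \<Rightarrow> rat" assume "f \<in> carrier hall" "g \<in> carrier hall"
  then show "comult hall (f \<otimes>\<^bsub>hall\<^esub> g) = comult hall f \<otimes>\<^bsub>HH\<^esub> comult hall g"
    unfolding comult_hall_eq by (simp only: hall_simps hmul_plus pair_tensor_pmul[symmetric] finite_support_plus mem_Collect_eq)
qed

lemma counit_hall_linear: "counit hall \<in> Q_linear (hall :: ('a isoclass \<Rightarrow> rat) bialg) QQ"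
  by (rule Q_linearI) auto

lemma counit_hall_ring_hom: "counit hall \<in> ring_hom (hall :: ('a isoclass \<Rightarrow> rat) bialg) QQ"
  by (rule Q_linear_ring_homI[OF counit_hall_linear]) (auto simp: hmul_zero_class delta_def)

text \<open>
  Applying the counit to one factor of the tensor with coefficients \<open>F (X, Y)\<close> leaves \<open>F (0, Y)\<close> or
  \<open>F (X, 0)\<close>; for \<open>F (X, Y) = f (X + Y)\<close> this is \<open>f\<close>.
\<close>

lemma hall_counit_laws:
  assumes f: "f \<in> carrier (hall :: ('a isoclass \<Rightarrow> rat) bialg)"
  shows "tensor_lift hall (\<lambda>a b. counit hall a \<odot>\<^bsub>hall\<^esub> b) (comult hall f) = f"
    "tensor_lift hall (\<lambda>a b. counit hall b \<odot>\<^bsub>hall\<^esub> a) (comult hall f) = f"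
proof -
  note b = H.smult_bilinear[OF counit_hall_linear]
  have fin: "finite {X. F (0, X) \<noteq> 0}" "finite {X. F (X, 0) \<noteq> 0}"
    if "finite {p. F p \<noteq> 0}" for F :: "'a isoclass \<times> 'a isoclass \<Rightarrow> rat"
    by (rule finite_subset[OF _ finite_imageI[OF that, of snd]], force,
        rule finite_subset[OF _ finite_imageI[OF that, of fst]], force)
  have t: "tensor_lift hall (\<lambda>a b. counit hall a \<odot>\<^bsub>hall\<^esub> b) (pair_tensor (delta q)) = (\<lambda>X. delta q (0, X))"
    "tensor_lift hall (\<lambda>a b. counit hall b \<odot>\<^bsub>hall\<^esub> a) (pair_tensor (delta q)) = (\<lambda>X. delta q (X, 0))"
    for q :: "'a isoclass \<times> 'a isoclass"
    unfolding pair_tensor_delta tensor_lift_tens[OF spH Q_space_hall b(1) delta_closed delta_closed]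
      tensor_lift_tens[OF spH Q_space_hall b(2) delta_closed delta_closed]
    by (auto simp: delta_def fun_eq_iff prod_eq_iff)
  have l: "tensor_lift hall (\<lambda>a b. counit hall a \<odot>\<^bsub>hall\<^esub> b) (pair_tensor F) = (\<lambda>X. F (0, X))"
    if "finite {p. F p \<noteq> 0}" for F :: "'a isoclass \<times> 'a isoclass \<Rightarrow> rat"
    by (rule fun_space_linear_eqI[OF Q_space_hall Q_linear_comp[OF pair_tensor_linear tensor_lift_linear[OF spH Q_space_hall b(1)]] _ that t(1)])
      (auto intro!: Q_linearI simp: fin)
  have r: "tensor_lift hall (\<lambda>a b. counit hall b \<odot>\<^bsub>hall\<^esub> a) (pair_tensor F) = (\<lambda>X. F (X, 0))"
    if "finite {p. F p \<noteq> 0}" for F :: "'a isoclass \<times> 'a isoclass \<Rightarrow> rat"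
    by (rule fun_space_linear_eqI[OF Q_space_hall Q_linear_comp[OF pair_tensor_linear tensor_lift_linear[OF spH Q_space_hall b(2)]] _ that t(2)])
      (auto intro!: Q_linearI simp: fin)
  have "finite {p. f ((\<lambda>(X, Y). X + Y) p) \<noteq> 0}"
    using f by (intro finite_support_plus) simp
  then show "tensor_lift hall (\<lambda>a b. counit hall a \<odot>\<^bsub>hall\<^esub> b) (comult hall f) = f"
    "tensor_lift hall (\<lambda>a b. counit hall b \<odot>\<^bsub>hall\<^esub> a) (comult hall f) = f"
    unfolding comult_hall_eq by (simp_all only: l r) simp_all
qed


text \<open>
  Both iterated coproducts have the coefficients \<open>f (X + Y + Z)\<close>.  To see this, the two maps out of
  the tensor square are described on tensors with arbitrary coefficients, which reduces the claim to
  delta functions, and the associativity of the sum of classes is used at the very end.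
\<close>

lemma hall_coassociative:
  assumes f: "f \<in> carrier (hall :: ('a isoclass \<Rightarrow> rat) bialg)"
  shows "tensor_assoc hall (tensor_map HH hall (comult hall) (\<lambda>b. b) (comult hall f)) =
    tensor_map hall HH (\<lambda>a. a) (comult hall) (comult hall f)"
proof -
  let ?H = "hall :: ('a isoclass \<Rightarrow> rat) bialg"
  let ?HH = "tensor ?H ?H"
  let ?P = "tensor ?H ?HH"
  have P: "Q_space ?P"
    by (rule Q_space_tensor[OF Q_space_hall HH.Q_space_axioms])
  \<comment> \<open>\<open>\<Lambda>\<close> sends a function on triples to the tensor with these coefficients\<close>
  define v where "v p = tens ?H ?HH (delta (fst p)) (delta_tens (snd p))" for p
  define \<Lambda> where "\<Lambda> = lincomb ?P v"
  have vc: "v p \<in> carrier ?P" for p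
    unfolding v_def by (rule tens_closed[OF spH(1) HH.Q_space_axioms delta_closed delta_tens_closed])
  have \<Lambda>l: "\<Lambda> \<in> Q_linear fun_space ?P"
    unfolding \<Lambda>_def by (rule lincomb_linear[OF P vc])
  have \<Lambda>d: "\<Lambda> (delta p) = v p" for p
    unfolding \<Lambda>_def by (rule lincomb_delta[OF P, of v, OF vc])
  note HHs = HH.Q_space_axioms
  note Al = tensor_assoc_linear[OF spH(1)] and At = tensor_assoc_tens[OF spH(1)]
  note Dl = tensor_map_linear[OF spH spH(1) HHs Q_linear_id comult_hall_linear]
    and Dt = tensor_map_tens[OF spH spH(1) HHs Q_linear_id comult_hall_linear]
  note El = tensor_map_linear[OF spH HHs spH(1) comult_hall_linear Q_linear_id]
    and Et = tensor_map_tens[OF spH HHs spH(1) comult_hall_linear Q_linear_id]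
  let ?l = "\<lambda>(X :: 'a isoclass, Y, Z :: 'a isoclass). (X + Y, Z)"
  let ?r = "\<lambda>(X :: 'a isoclass, Y, Z :: 'a isoclass). (X, Y + Z)"
  have fl: "finite {p. F (?l p) \<noteq> 0}" and fr: "finite {p. F (?r p) \<noteq> 0}"
    if "finite {p. F p \<noteq> 0}" for F :: "_ \<Rightarrow> rat"
    using finite_support_vimage[OF that finite_fibres(2)] finite_support_vimage[OF that finite_fibres(3)]
    by auto
  have fa: "finite {p. F (fst p, fst (snd p)) * delta z (snd (snd p)) \<noteq> (0::rat)}"
    if "finite {p. F p \<noteq> 0}" for F :: "'a isoclass \<times> 'a isoclass \<Rightarrow> rat" and z :: "'a isoclass"
    by (rule finite_subset[OF _ finite_imageI[OF that, of "\<lambda>p. (fst p, snd p, z)"]])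
      (force simp: delta_def split: if_splits)
  have fb: "finite {p. delta z (fst p) * F (snd p) \<noteq> (0::rat)}"
    if "finite {p. F p \<noteq> 0}" for F :: "'a isoclass \<times> 'a isoclass \<Rightarrow> rat" and z :: "'a isoclass"
    by (rule finite_support_product(1)[OF finite_support_delta that])
  have 1: "tensor_assoc ?H (tens ?HH ?H (pair_tensor F) (delta z)) =
      \<Lambda> (\<lambda>p. F (fst p, fst (snd p)) * delta z (snd (snd p)))"
    if "finite {p. F p \<noteq> 0}" for F z
  proof (rule fun_space_linear_eqI[OF P Q_linear_comp[OF pair_tensor_linear Q_linear_comp[OF
        tens_linear_left[OF HHs spH(1) delta_closed] Al]] Q_linear_comp[OF Q_linear_fun_spaceI \<Lambda>l] that])
    fix q :: "'a isoclass \<times> 'a isoclass"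
    have "(\<lambda>p. delta q (fst p, fst (snd p)) * delta z (snd (snd p))) = delta (fst q, snd q, z)"
      by (auto simp: delta_def fun_eq_iff)
    then show "tensor_assoc ?H (tens ?HH ?H (pair_tensor (delta q)) (delta z)) =
        \<Lambda> (\<lambda>p. delta q (fst p, fst (snd p)) * delta z (snd (snd p)))"
      by (simp only: pair_tensor_delta \<Lambda>d v_def At delta_closed fst_conv snd_conv)
  qed (use fa in \<open>auto simp: algebra_simps\<close>)
  have 2: "tens ?H ?HH (delta z) (pair_tensor F) = \<Lambda> (\<lambda>p. delta z (fst p) * F (snd p))"
    if "finite {p. F p \<noteq> 0}" for F z
  proof (rule fun_space_linear_eqI[OF P Q_linear_comp[OF pair_tensor_linear
        tens_linear_right[OF spH(1) HHs delta_closed]] Q_linear_comp[OF Q_linear_fun_spaceI \<Lambda>l] that])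
    fix q :: "'a isoclass \<times> 'a isoclass"
    have "(\<lambda>p. delta z (fst p) * delta q (snd p)) = delta (z, q)"
      by (auto simp: delta_def fun_eq_iff)
    then show "tens ?H ?HH (delta z) (pair_tensor (delta q)) = \<Lambda> (\<lambda>p. delta z (fst p) * delta q (snd p))"
      by (simp only: pair_tensor_delta \<Lambda>d v_def fst_conv snd_conv)
  qed (use fb in \<open>auto simp: algebra_simps\<close>)
  have 3: "tensor_assoc ?H (tensor_map ?HH ?H (comult ?H) (\<lambda>b. b) (pair_tensor F)) = \<Lambda> (\<lambda>p. F (?l p))"
    if "finite {p. F p \<noteq> 0}" for F
  proof (rule fun_space_linear_eqI[OF P Q_linear_comp[OF pair_tensor_linear Q_linear_comp[OF El Al]]
        Q_linear_comp[OF Q_linear_fun_spaceI \<Lambda>l] that])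
    fix q :: "'a isoclass \<times> 'a isoclass"
    have "(\<lambda>p. delta (fst q) ((\<lambda>(X, Y). X + Y) (fst p, fst (snd p))) * delta (snd q) (snd (snd p))) =
        (\<lambda>p. delta q (?l p))"
      by (auto simp: delta_def fun_eq_iff prod_eq_iff split_beta)
    then show "tensor_assoc ?H (tensor_map ?HH ?H (comult ?H) (\<lambda>b. b) (pair_tensor (delta q))) = \<Lambda> (\<lambda>p. delta q (?l p))"
      by (simp only: pair_tensor_delta Et delta_closed comult_hall_eq 1 finite_support_plus finite_support_delta)
  qed (use fl in \<open>auto\<close>)
  have 4: "tensor_map ?H ?HH (\<lambda>b. b) (comult ?H) (pair_tensor F) = \<Lambda> (\<lambda>p. F (?r p))"
    if "finite {p. F p \<noteq> 0}" for F
  proof (rule fun_space_linear_eqI[OF P Q_linear_comp[OF pair_tensor_linear Dl]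
        Q_linear_comp[OF Q_linear_fun_spaceI \<Lambda>l] that])
    fix q :: "'a isoclass \<times> 'a isoclass"
    have "(\<lambda>p. delta (fst q) (fst p) * delta (snd q) ((\<lambda>(X, Y). X + Y) (snd p))) =
        (\<lambda>p. delta q (?r p))"
      by (auto simp: delta_def fun_eq_iff prod_eq_iff split_beta)
    then show "tensor_map ?H ?HH (\<lambda>b. b) (comult ?H) (pair_tensor (delta q)) = \<Lambda> (\<lambda>p. delta q (?r p))"
      by (simp only: pair_tensor_delta Dt delta_closed comult_hall_eq 2 finite_support_plus finite_support_delta)
  qed (use fr in \<open>auto\<close>)
  have fin: "finite {p. f ((\<lambda>(X, Y). X + Y) p) \<noteq> 0}"
    using f by (intro finite_support_plus) simp
  have "(\<lambda>p. f ((\<lambda>(X, Y). X + Y) (?l p))) = (\<lambda>p. f ((\<lambda>(X, Y). X + Y) (?r p)))"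
    by (auto simp: fun_eq_iff add.assoc)
  then show ?thesis
    using 3[OF fin] 4[OF fin] by (simp only: comult_hall_eq)
qed

lemma bialgebra_hall: "bialgebra (hall :: ('a isoclass \<Rightarrow> rat) bialg)"
  unfolding bialgebra_def
  by (intro conjI ballI Q_algebra_hall comult_hall_linear counit_hall_linear hall_coassociative
      hall_counit_laws comult_hall_ring_hom counit_hall_ring_hom)

end

section \<open>Primitive elements of the Hall algebra\<close>

text \<open>
  With the coproduct \<open>\<Delta> f (X, Y) = f (X + Y)\<close> and \<open>delta 0\<close> as the unit, this says that
  \<open>\<Delta> f = f \<otimes> 1 + 1 \<otimes> f\<close>.
\<close>

definition prim :: "('a::{semigroup_mult,mult_zero} isoclass \<Rightarrow> rat) \<Rightarrow> bool" where
  "prim f \<longleftrightarrow> (\<forall>X Y. f (X + Y) = f X * delta 0 Y + delta 0 X * f Y)"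

lemma prim_delta: "indec M \<Longrightarrow> prim (delta M)"
  unfolding prim_def
proof (intro allI)
  fix X Y :: "'a isoclass"
  assume M: "indec M"
  then have "M \<noteq> 0" "M = X + Y \<Longrightarrow> X = 0 \<or> Y = 0"
    unfolding indec_def by blast+
  then show "delta M (X + Y) = delta M X * delta 0 Y + delta 0 X * delta M Y"
    by (cases "X = 0"; cases "Y = 0") (auto simp: delta_def)
qed

lemma prim_zero: "prim f \<Longrightarrow> f 0 = 0"
  unfolding prim_def by (drule spec[of _ 0], drule spec[of _ 0]) (simp add: delta_def)

lemma prim_support:
  assumes "prim f" "f X \<noteq> 0"
  shows "indec X"
  unfolding indec_def
proof (intro conjI allI impI)
  show "X \<noteq> 0"
    using assms prim_zero by auto
  fix Y Z assume "X = Y + Z"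
  then have "f Y * delta 0 Z + delta 0 Y * f Z \<noteq> 0"
    using assms by (simp add: prim_def)
  then show "Y = 0 \<or> Z = 0"
    by (auto simp: delta_def split: if_splits)
qed

text \<open>
  A primitive element has the coproduct \<open>f \<otimes> 1 + 1 \<otimes> f\<close>, so \<open>\<Delta>(f h) = (f \<otimes> 1 + 1 \<otimes> f) \<Delta>(h)\<close>.
\<close>

lemma hmul_prim:
  assumes f: "prim f" and h: "\<And>X Y. h (X + Y) = (\<Sum>(a, b)\<leftarrow>ab. a X * b Y)"
  shows "hmul f h (X + Y) = (\<Sum>(a, b)\<leftarrow>ab. hmul f a X * b Y + a X * hmul f b Y)"
proof -
  let ?f = "\<lambda>p. f (fst p) * delta 0 (snd p) + delta 0 (fst p) * f (snd p)"
  have "hmul f h (X + Y) = pmul (\<lambda>p. f ((\<lambda>(X, Y). X + Y) p)) (\<lambda>p. h ((\<lambda>(X, Y). X + Y) p)) (X, Y)"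
    using hmul_plus[of f h "(X, Y)"] by simp
  also have "\<dots> = pmul ?f (\<lambda>p. \<Sum>(a, b)\<leftarrow>ab. a (fst p) * b (snd p)) (X, Y)"
    using f h by (simp add: prim_def split_beta)
  also have "\<dots> = (\<Sum>(a, b)\<leftarrow>ab. hmul f a X * b Y + a X * hmul f b Y)"
  proof (induction ab)
    case Nil
    then show ?case by (simp add: pmul_def)
  next
    case (Cons c ab)
    obtain a b where c: "c = (a, b)" by fastforce
    have "pmul ?f (\<lambda>p. a (fst p) * b (snd p)) (X, Y) = hmul f a X * b Y + a X * hmul f b Y"
      by (simp add: pmul_linear_simps(1) pmul_product hmul_one_left)
    then show ?case
      using Cons by (simp add: c pmul_linear_simps(3))
  qed
  finally show ?thesis .
qed

text \<open>
  In \<open>\<Delta>(f g)\<close> the mixed terms \<open>f \<otimes> g + g \<otimes> f\<close> are symmetric, and cancel in the commutator.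
\<close>

lemma prim_commutator:
  assumes "prim f" "prim g"
  shows "prim (\<lambda>X. hmul f g X - hmul g f X)"
proof -
  have "hmul f g (X + Y) = hmul f g X * delta 0 Y + delta 0 X * hmul f g Y + (g X * f Y + f X * g Y)"
    if "prim f" "prim g" for f g :: "'a isoclass \<Rightarrow> rat" and X Y
    using hmul_prim[OF that(1), of g "[(g, delta 0), (delta 0, g)]" X Y] that(2)
    by (simp add: prim_def hmul_one_right)
  then show ?thesis
    using assms by (simp add: prim_def algebra_simps)
qed

subsection \<open>Products of indecomposable classes\<close>

text \<open>
  A split of a list of factors records which of them go to the first summand of a wedge sum.
\<close>

fun splits :: "'x list \<Rightarrow> ('x list \<times> 'x list) list" where
  "splits [] = [([], [])]"
| "splits (x # xs) = map (\<lambda>(as, bs). (x # as, bs)) (splits xs) @ map (\<lambda>(as, bs). (as, x # bs)) (splits xs)"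

lemma splits_mset: "(as, bs) \<in> set (splits xs) \<Longrightarrow> mset as + mset bs = mset xs"
  by (induction xs arbitrary: as bs) auto

lemma splits_Nil: "([], xs) \<in> set (splits xs)"
  by (induction xs) (auto simp: image_iff)

lemma splits_single: "x \<in> set xs \<Longrightarrow> ([x], remove1 x xs) \<in> set (splits xs)"
proof (induction xs)
  case (Cons y xs)
  show ?case
  proof (cases "x = y")
    case True
    then show ?thesis
      using splits_Nil[of xs] by (force simp: image_iff)
  next
    case False
    then show ?thesis
      using Cons by (force simp: image_iff)
  qed
qed simp

abbreviation hall_word :: "'a::{semigroup_mult,mult_zero} isoclass list \<Rightarrow> 'a isoclass \<Rightarrow> rat" where
  "hall_word \<equiv> word_prod hall delta"

text \<open>
  The iterated coproduct of a product of primitive elements: each factor goes to one side or to the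
  other.
\<close>

lemma hall_word_plus:
  assumes "\<forall>M\<in>set Ms. indec M"
  shows "hall_word Ms (X + Y) = (\<Sum>(as, bs)\<leftarrow>splits Ms. hall_word as X * hall_word bs Y)"
  using assms
proof (induction Ms arbitrary: X Y)
  case Nil
  then show ?case by (auto simp: delta_def)
next
  case (Cons M Ms)
  have "hall_word (M # Ms) (X + Y) = (\<Sum>(a, b)\<leftarrow>map (\<lambda>(as, bs). (hall_word as, hall_word bs)) (splits Ms).
      hmul (delta M) a X * b Y + a X * hmul (delta M) b Y)"
    unfolding word_prod_simps hall_simps
    by (rule hmul_prim) (use Cons prim_delta in \<open>auto simp: o_def split_beta\<close>)
  then show ?case
    by (simp add: o_def split_beta sum_list_addf)
qed

lemma hmul_nonneg: "(\<And>X. f X \<ge> 0) \<Longrightarrow> (\<And>X. g X \<ge> 0) \<Longrightarrow> hmul f g X \<ge> 0"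
  unfolding hmul_def by (intro sum_nonneg mult_nonneg_nonneg)

lemma hall_word_nonneg: "hall_word Ms X \<ge> 0"
  by (induction Ms arbitrary: X) (auto intro: hmul_nonneg simp: delta_def)

text \<open>
  The key to the comparison with the enveloping algebra.  The summands \<open>X\<close> of the argument are split off
  one at a time.  A nonzero term must put at least one factor on \<open>X\<close>, because \<open>X\<close> is nonzero; as there
  are no more factors than summands, it puts exactly one there, and this factor has to be \<open>X\<close>.  All
  terms are nonnegative, so nothing cancels.  In particular the multiset of indecomposable summands
  of a class is unique (Krull-Schmidt), and products of distinct multisets of the same size have
  different leading terms.
\<close>

lemma hall_word_nonzero_iff:
  assumes "\<forall>M\<in>set Ms. indec M" "\<forall>X\<in>set Xs. indec X" "length Ms \<le> length Xs"
  shows "hall_word Ms (sum_list Xs) \<noteq> 0 \<longleftrightarrow> mset Ms = mset Xs"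
  using assms
proof (induction Xs arbitrary: Ms)
  case Nil
  then show ?case by (simp add: delta_def)
next
  case (Cons X Xs)
  have X0: "X \<noteq> 0"
    using Cons.prems by (simp add: indec_def)
  have single: "hall_word [Y] = delta Y" for Y :: "'a isoclass"
    by (simp add: hmul_one_right)
  have "hall_word Ms (sum_list (X # Xs)) \<noteq> 0 \<longleftrightarrow>
      (\<exists>p\<in>set (splits Ms). hall_word (fst p) X * hall_word (snd p) (sum_list Xs) \<noteq> 0)"
    unfolding case_prod_unfold sum_list.Cons hall_word_plus[OF Cons.prems(1)]
    by (subst sum_list_nonneg_eq_0_iff) (auto simp: hall_word_nonneg)
  also have "\<dots> \<longleftrightarrow> mset Ms = mset (X # Xs)"
  proof
    assume "mset Ms = mset (X # Xs)"
    moreover from this have "X \<in> set Ms"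
      by (metis list.set_intros(1) set_mset_mset)
    ultimately have s: "([X], remove1 X Ms) \<in> set (splits Ms)" "mset (remove1 X Ms) = mset Xs"
      by (simp_all add: splits_single)
    have "length (remove1 X Ms) = length Xs"
      using s(2) by (rule mset_eq_length)
    moreover have "\<forall>M\<in>set (remove1 X Ms). indec M"
      using Cons.prems(1) set_remove1_subset[of X Ms] by blast
    ultimately have "hall_word (remove1 X Ms) (sum_list Xs) \<noteq> 0"
      using Cons.IH[of "remove1 X Ms"] Cons.prems(2) s(2) by simp
    then show "\<exists>p\<in>set (splits Ms). hall_word (fst p) X * hall_word (snd p) (sum_list Xs) \<noteq> 0"
      using single[of X] by (intro bexI[OF _ s(1)]) (simp add: delta_def del: word_prod_simps)
  next
    assume "\<exists>p\<in>set (splits Ms). hall_word (fst p) X * hall_word (snd p) (sum_list Xs) \<noteq> 0"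
    then obtain as bs where s: "(as, bs) \<in> set (splits Ms)" "hall_word as X \<noteq> 0"
      "hall_word bs (sum_list Xs) \<noteq> 0" by auto
    note m = splits_mset[OF s(1)]
    have len: "length as + length bs = length Ms"
      using arg_cong[OF m, of size] by simp
    have "as \<noteq> []"
      using s(2) X0 by (auto simp: delta_def)
    moreover have "\<forall>M\<in>set bs. indec M"
      using Cons.prems(1) m by (metis set_mset_mset set_mset_union UnCI)
    ultimately have bs: "mset bs = mset Xs"
      using Cons.IH[of bs] Cons.prems len s(3) by (cases as) auto
    then have "length bs = length Xs" by (rule mset_eq_length)
    then obtain a where a: "as = [a]"
      using \<open>as \<noteq> []\<close> len Cons.prems(3) by (cases as; cases "tl as") auto
    then have "a = X"
      using s(2) single[of a] by (auto simp: delta_def split: if_splits)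
    then show "mset Ms = mset (X # Xs)"
      using m bs a by simp
  qed
  finally show ?case .
qed

section \<open>The Hall algebra is the enveloping algebra of its primitive elements\<close>

text \<open>
  An enveloping algebra is generated by its Lie algebra.
\<close>

lemma (in Q_bracket) enveloping_hom_eqI:
  assumes "Q_algebra Z" "f \<in> Q_linear E Z" "f \<in> ring_hom E Z" "h \<in> Q_linear E Z" "h \<in> ring_hom E Z"
    and "\<And>x. x \<in> carrier g \<Longrightarrow> f (\<iota> x) = h (\<iota> x)" and "u \<in> carrier E"
  shows "f u = h u"
proof (rule enveloping_linear_eqI[OF assms(2,4,7)])
  interpret E: Q_alg E by unfold_locales (rule Q_algebra_enveloping)
  fix ws assume ws: "set ws \<subseteq> carrier g"
  then have i: "\<iota> ` set ws \<subseteq> carrier E"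
    using incl_closed by auto
  show "f (word_prod E \<iota> ws) = h (word_prod E \<iota> ws)"
    unfolding word_prod_hom[OF assms(3) E.ring_axioms i] word_prod_hom[OF assms(5) E.ring_axioms i]
    by (rule word_prod_cong) (use ws assms(6) in auto)
qed

context
  assumes fg: "finitely_generated TYPE('a::{semigroup_mult,mult_zero})"
begin

abbreviation "\<H> \<equiv> hall :: ('a isoclass \<Rightarrow> rat) bialg"
abbreviation "\<n> \<equiv> hall_lie :: ('a isoclass \<Rightarrow> rat) set"
abbreviation "\<g> \<equiv> \<H>\<lparr>carrier := \<n>\<rparr>"

interpretation H: Q_alg \<H> by unfold_locales (rule Q_algebra_hall[OF fg])

lemma hall_lie_gens:
  "{delta (isoclass M) | M :: ('a, nat) amod. finite_amodule M \<and> indecomposable M} = delta ` {X. indec X}"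
proof -
  have "\<exists>M :: ('a, nat) amod. delta X = delta (isoclass M) \<and> finite_amodule M \<and> indecomposable M"
    if "indec X" for X :: "'a isoclass"
    using that indec_isoclass[OF finite_amodule_rep, of X] by (intro exI[of _ "rep_isoclass X"]) simp
  then show ?thesis
    using indec_isoclass by blast
qed

lemma hall_lie_span: "\<n> = Q_span \<H> (delta ` {X. indec X})"
  by (simp add: hall_lie_def hall_lie_gens)

lemma gens_subset: "delta ` {X. indec X} \<subseteq> carrier \<H>"
  by auto

lemma prim_submodule: "submodule {f \<in> carrier \<H>. prim f} QQ \<H>"
  by (rule H.submoduleI)
    (auto simp: prim_def algebra_simps intro: finite_support_add finite_support_smult)

text \<open>
  A finitely supported function is a linear combination of the delta functions of its support.
\<close>

lemma submodule_support:
  assumes S: "submodule S QQ \<H>" and f: "f \<in> carrier \<H>" and d: "\<And>X. f X \<noteq> 0 \<Longrightarrow> delta X \<in> S"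
  shows "f \<in> S"
proof -
  note SD = H.submoduleD[OF S]
  have "finite {X. f X \<noteq> 0}" using f by simp
  then show ?thesis
  proof (induction rule: finsupp_induct)
    case zero
    then show ?case using SD(2) by simp
  next
    case (step c q G)
    then show ?case
      using SD(3)[OF SD(4)[OF d, of q c], of G] by simp
  qed
qed

text \<open>
  A primitive function vanishes on the zero class and on decomposable classes, and the delta function
  of an indecomposable class is primitive.  Hence the span of these delta functions is the space of
  all primitive elements, and is closed under commutators.
\<close>

lemma hall_lie_eq: "\<n> = {f \<in> carrier \<H>. prim f}"
proof
  show "\<n> \<subseteq> {f \<in> carrier \<H>. prim f}"
    unfolding hall_lie_span by (rule H.Q_span_least[OF prim_submodule]) (auto simp: prim_delta)
  show "{f \<in> carrier \<H>. prim f} \<subseteq> \<n>"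
    unfolding hall_lie_span
    using submodule_support[OF H.Q_span_submodule[OF gens_subset]] H.Q_span_superset[of "delta ` {X. indec X}"]
      prim_support by blast
qed

lemma hall_lie_submodule: "submodule \<n> QQ \<H>"
  unfolding hall_lie_eq by (rule prim_submodule)

lemma commutator_hall:
  assumes "x \<in> carrier \<H>" "y \<in> carrier \<H>"
  shows "commutator \<H> x y = (\<lambda>X. hmul x y X - hmul y x X)"
proof -
  have "hmul y x \<in> carrier \<H>" using assms H.m_closed[of y x] by simp
  then have "\<ominus>\<^bsub>\<H>\<^esub> hmul y x = (-1) \<odot>\<^bsub>\<H>\<^esub> hmul y x" by (rule H.smult_minus_one[symmetric])
  then show ?thesis by (simp add: commutator_def a_minus_def)
qed

lemma hall_lie_commutator:
  assumes "x \<in> \<n>" "y \<in> \<n>" shows "commutator \<H> x y \<in> \<n>"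
proof -
  have c: "x \<in> carrier \<H>" "y \<in> carrier \<H>" using assms by (auto simp: hall_lie_eq)
  then have "commutator \<H> x y \<in> carrier \<H>"
    unfolding commutator_def by (intro H.minus_closed H.m_closed)
  then show ?thesis
    using assms by (simp add: hall_lie_eq commutator_hall[OF c] prim_commutator)
qed

lemma lie_subalgebra_hall: "lie_subalgebra \<n> \<H>"
  by (simp add: lie_subalgebra_def hall_lie_submodule hall_lie_commutator)

lemma bracket_hall_lie: "Q_bracket \<g> (commutator \<H>)"
proof (intro Q_bracket.intro Q_space.intro Q_bracket_axioms.intro)
  show "module QQ \<g>"
    by (rule submodule.submodule_is_module[OF hall_lie_submodule H.is_module])
qed (simp add: hall_lie_commutator)

interpretation L: Q_bracket \<g> "commutator \<H>"
  by (rule bracket_hall_lie)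

abbreviation "\<U> \<equiv> enveloping \<g> (commutator \<H>)"
abbreviation "hall_incl \<equiv> env_incl \<g> (commutator \<H>)"

interpretation U: Q_alg \<U> by unfold_locales (rule L.Q_algebra_enveloping)

lemma hall_lie_carrier: "x \<in> \<n> \<Longrightarrow> x \<in> carrier \<H>"
  by (simp add: hall_lie_eq)

lemma inclusion_lift:
  "Q_algebra \<H>" "(\<lambda>x. x) \<in> Q_linear \<g> \<H>"
  "x \<in> carrier \<g> \<Longrightarrow> y \<in> carrier \<g> \<Longrightarrow> x \<otimes>\<^bsub>\<H>\<^esub> y = y \<otimes>\<^bsub>\<H>\<^esub> x \<oplus>\<^bsub>\<H>\<^esub> commutator \<H> x y"
proof -
  show "Q_algebra \<H>" by (rule Q_algebra_hall[OF fg])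
  show "(\<lambda>x. x) \<in> Q_linear \<g> \<H>"
    by (rule Q_linearI) (auto dest: hall_lie_carrier)
  show "x \<otimes>\<^bsub>\<H>\<^esub> y = y \<otimes>\<^bsub>\<H>\<^esub> x \<oplus>\<^bsub>\<H>\<^esub> commutator \<H> x y" if "x \<in> carrier \<g>" "y \<in> carrier \<g>"
    using that by (simp add: commutator_hall hall_lie_carrier[simplified])
qed

text \<open>
  The algebra homomorphism from the enveloping algebra to the Hall algebra that extends the inclusion
  of the Lie algebra.  It is the inverse of the isomorphism to be constructed.
\<close>

definition hall_map where "hall_map = env_lift \<H> (\<lambda>x. x)"

lemma hall_map_linear: "hall_map \<in> Q_linear \<U> \<H>"
  unfolding hall_map_def by (rule L.env_lift_linear[OF inclusion_lift])

lemma hall_map_ring_hom: "hall_map \<in> ring_hom \<U> \<H>"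
  unfolding hall_map_def by (rule L.env_lift_ring_hom[OF inclusion_lift])

lemma hall_map_incl: "x \<in> \<n> \<Longrightarrow> hall_map (hall_incl x) = x"
  unfolding hall_map_def using L.env_lift_incl[OF inclusion_lift] by simp

lemmas hall_map_closed = Q_linear_closed[OF hall_map_linear]

lemma delta_hall_lie: "indec X \<Longrightarrow> delta X \<in> \<n>"
  by (simp add: hall_lie_eq prim_delta)

definition uword :: "'a isoclass list \<Rightarrow> _" where
  "uword = word_prod \<U> (\<lambda>M. hall_incl (delta M))"

definition indecs :: "'a isoclass list \<Rightarrow> bool" where
  "indecs Ms \<longleftrightarrow> (\<forall>M\<in>set Ms. indec M)"

lemma indecs_simps [simp]: "indecs []" "indecs (M # Ms) \<longleftrightarrow> indec M \<and> indecs Ms"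
  "indecs (Ms @ Ns) \<longleftrightarrow> indecs Ms \<and> indecs Ns"
  by (auto simp: indecs_def)

lemma indecs_mset: "mset Ms = mset Ns \<Longrightarrow> indecs Ms = indecs Ns"
  unfolding indecs_def by (metis set_mset_mset)

lemma incl_delta_closed: "indec M \<Longrightarrow> hall_incl (delta M) \<in> carrier \<U>"
  using L.incl_closed delta_hall_lie by simp

lemma uword_simps [simp]: "uword [] = \<one>\<^bsub>\<U>\<^esub>" "uword (M # Ms) = hall_incl (delta M) \<otimes>\<^bsub>\<U>\<^esub> uword Ms"
  by (simp_all add: uword_def)

lemma uword_closed: "indecs Ms \<Longrightarrow> uword Ms \<in> carrier \<U>"
  by (induction Ms) (auto simp: incl_delta_closed)

lemma hall_map_uword: "indecs Ms \<Longrightarrow> hall_map (uword Ms) = hall_word Ms"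
  by (induction Ms)
    (auto simp: ring_homE[OF hall_map_ring_hom] incl_delta_closed uword_closed hall_map_incl delta_hall_lie
      simp del: hall_simps)

text \<open>
  The filtration of the enveloping algebra by the length of words in the \<open>delta M\<close>.  The strict bound
  makes \<open>word_span 0\<close> the zero space, the start of the induction that shows injectivity.
\<close>

definition word_span where "word_span k = Q_span \<U> (uword ` {Ms. indecs Ms \<and> length Ms < k})"

lemma word_span_gens: "uword ` {Ms. indecs Ms \<and> length Ms < k} \<subseteq> carrier \<U>"
  by (auto simp: uword_closed)

lemma word_span_submodule: "submodule (word_span k) QQ \<U>"
  unfolding word_span_def by (rule U.Q_span_submodule[OF word_span_gens])

lemmas word_spanD = U.submoduleD[OF word_span_submodule]

lemma word_span_closed: "u \<in> word_span k \<Longrightarrow> u \<in> carrier \<U>"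
  using word_spanD(1) by blast

lemma uword_word_span: "indecs Ms \<Longrightarrow> length Ms < k \<Longrightarrow> uword Ms \<in> word_span k"
  unfolding word_span_def by (rule subsetD[OF U.Q_span_superset]) auto

lemma word_span_mono: "k \<le> l \<Longrightarrow> word_span k \<subseteq> word_span l"
  unfolding word_span_def by (rule U.Q_span_mono) auto

lemma incl_delta_word_span:
  assumes "indec M" "u \<in> word_span k"
  shows "hall_incl (delta M) \<otimes>\<^bsub>\<U>\<^esub> u \<in> word_span (Suc k)"
proof -
  note c = incl_delta_closed[OF assms(1)]
  show ?thesis
    using assms(2) unfolding word_span_def[of k]
  proof (induction rule: U.Q_span_induct[OF _ word_span_gens, consumes 1, case_names zero add smult gen])
    case zero
    then show ?case using c word_spanD(2) by simp
  next
    case (add x y)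
    then show ?case
      using c word_span_closed[of _ k] by (simp add: U.r_distr word_spanD(3) word_span_def[of k])
  next
    case (smult a x)
    then show ?case
      using c word_span_closed[of _ k] by (simp add: U.smult_mult_right word_spanD(4) word_span_def[of k])
  next
    case (gen x)
    then obtain Ms where "x = uword Ms" "indecs Ms" "length Ms < k" by auto
    then show ?case
      using uword_word_span[of "M # Ms" "Suc k"] assms(1) by simp
  qed
qed

lemma incl_word_span:
  assumes "x \<in> \<n>" "u \<in> word_span k"
  shows "hall_incl x \<otimes>\<^bsub>\<U>\<^esub> u \<in> word_span (Suc k)"
proof -
  have u: "u \<in> carrier \<U>" using word_span_closed[OF assms(2)] .
  have g: "x \<in> carrier \<g>" if "x \<in> Q_span \<H> (delta ` {X. indec X})" for x
    using that by (simp add: hall_lie_span)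
  note ic = L.incl_closed[OF g]
  have "x \<in> Q_span \<H> (delta ` {X. indec X})"
    using assms(1) by (simp add: hall_lie_span)
  then show ?thesis
  proof (induction rule: H.Q_span_induct[OF _ gens_subset, consumes 1, case_names zero add smult gen])
    case zero
    have "hall_incl \<zero>\<^bsub>\<H>\<^esub> = \<zero>\<^bsub>\<U>\<^esub>"
      using Q_linear_zero[OF L.Q_space_axioms U.Q_space_axioms L.incl_linear] by simp
    then show ?case using u word_spanD(2) by simp
  next
    case (add x y)
    then show ?case
      using Q_linear_add[OF L.incl_linear g g, of x y] ic u by (simp add: U.l_distr word_spanD(3) del: hall_simps)
  next
    case (smult c x)
    then show ?case
      using Q_linear_smult[OF L.incl_linear g, of x c] ic u by (simp add: U.smult_mult_left word_spanD(4) del: hall_simps)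
  next
    case (gen x)
    then show ?case using incl_delta_word_span assms(2) by auto
  qed
qed

lemma U_in_word_span:
  assumes "u \<in> carrier \<U>"
  shows "\<exists>k. u \<in> word_span k"
  using assms
proof (induction rule: L.enveloping_induct)
  case (add u v)
  then obtain k l where "u \<in> word_span k" "v \<in> word_span l" by blast
  then have "u \<in> word_span (max k l)" "v \<in> word_span (max k l)"
    using word_span_mono[of k "max k l"] word_span_mono[of l "max k l"] by auto
  then show ?case using word_spanD(3) by blast
next
  case (smult c u)
  then show ?case using word_spanD(4) by blast
next
  case (word ws)
  then show ?case
  proof (induction ws)
    case Nil
    then show ?case using uword_word_span[of "[]" 1] by auto
  next
    case (Cons x ws)
    then show ?case using incl_word_span[of x] by auto
  qed
qed

text \<open>
  Exchanging the first two letters changes a word by a word with one letter less, whose first letter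
  is their commutator.  The commutator is a combination of indecomposable classes again.
\<close>

lemma uword_swap:
  assumes "indecs (M # N # Ms)" "length Ms = n"
  shows "uword (M # N # Ms) \<ominus>\<^bsub>\<U>\<^esub> uword (N # M # Ms) \<in> word_span (Suc (Suc n))"
proof -
  let ?M = "hall_incl (delta M)" and ?N = "hall_incl (delta N)" and ?b = "commutator \<H> (delta M) (delta N)"
  have MN: "delta M \<in> carrier \<g>" "delta N \<in> carrier \<g>" "?b \<in> \<n>"
    using assms by (auto simp: delta_hall_lie hall_lie_commutator)
  note c = L.incl_closed[OF MN(1)] L.incl_closed[OF MN(2)] L.incl_closed[of ?b]
  have u: "uword Ms \<in> carrier \<U>" "uword Ms \<in> word_span (Suc n)"
    using assms by (auto intro: uword_closed uword_word_span)
  have "uword (M # N # Ms) = (?M \<otimes>\<^bsub>\<U>\<^esub> ?N) \<otimes>\<^bsub>\<U>\<^esub> uword Ms"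
    using c u by (simp add: U.m_assoc)
  also have "\<dots> = uword (N # M # Ms) \<oplus>\<^bsub>\<U>\<^esub> hall_incl ?b \<otimes>\<^bsub>\<U>\<^esub> uword Ms"
    using c u MN by (simp add: L.incl_bracket[OF MN(1,2)] U.l_distr U.m_assoc)
  finally have "uword (M # N # Ms) \<ominus>\<^bsub>\<U>\<^esub> uword (N # M # Ms) = hall_incl ?b \<otimes>\<^bsub>\<U>\<^esub> uword Ms"
    using c u MN by (simp add: a_minus_def U.a_ac U.r_neg)
  then show ?thesis
    using incl_word_span[OF MN(3) u(2)] by simp
qed

lemma word_span_trans:
  assumes "x \<ominus>\<^bsub>\<U>\<^esub> y \<in> word_span k" "y \<ominus>\<^bsub>\<U>\<^esub> z \<in> word_span k" "x \<in> carrier \<U>" "y \<in> carrier \<U>" "z \<in> carrier \<U>"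
  shows "x \<ominus>\<^bsub>\<U>\<^esub> z \<in> word_span k"
  using word_spanD(3)[OF assms(1,2)] U.minus_add_cancel[OF assms(3-5)] by simp

lemma uword_Cons_diff:
  assumes "uword Ms \<ominus>\<^bsub>\<U>\<^esub> uword Ns \<in> word_span k" "indec M" "indecs Ms" "indecs Ns"
  shows "uword (M # Ms) \<ominus>\<^bsub>\<U>\<^esub> uword (M # Ns) \<in> word_span (Suc k)"
proof -
  note c = incl_delta_closed[OF assms(2)] uword_closed[OF assms(3)] uword_closed[OF assms(4)]
  have "uword (M # Ms) \<ominus>\<^bsub>\<U>\<^esub> uword (M # Ns) = hall_incl (delta M) \<otimes>\<^bsub>\<U>\<^esub> (uword Ms \<ominus>\<^bsub>\<U>\<^esub> uword Ns)"
    using c by (simp add: a_minus_def U.r_distr U.r_minus)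
  then show ?thesis
    using incl_delta_word_span[OF assms(2,1)] by simp
qed

lemma uword_move:
  "indecs (as @ M # bs) \<Longrightarrow>
    uword (as @ M # bs) \<ominus>\<^bsub>\<U>\<^esub> uword (M # as @ bs) \<in> word_span (length (as @ M # bs))"
proof (induction as)
  case Nil
  then show ?case
    using uword_closed[OF Nil] word_spanD(2) by (simp add: U.minus_self)
next
  case (Cons a as)
  have "uword (a # as @ M # bs) \<ominus>\<^bsub>\<U>\<^esub> uword (a # M # as @ bs) \<in> word_span (Suc (length (as @ M # bs)))"
    by (rule uword_Cons_diff) (use Cons in auto)
  moreover have "uword (a # M # as @ bs) \<ominus>\<^bsub>\<U>\<^esub> uword (M # a # as @ bs) \<in> word_span (Suc (length (as @ M # bs)))"
    using uword_swap[of a M "as @ bs" "length (as @ bs)"] Cons.prems by simp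
  moreover have "uword (a # as @ M # bs) \<in> carrier \<U>" "uword (a # M # as @ bs) \<in> carrier \<U>"
    "uword (M # a # as @ bs) \<in> carrier \<U>"
    by (rule uword_closed; use Cons.prems in simp)+
  ultimately show ?case
    using word_span_trans by (simp del: uword_simps)
qed

text \<open>
  Modulo shorter words, the letters of a word commute.
\<close>

lemma uword_mset:
  "indecs Ms \<Longrightarrow> mset Ms = mset Ns \<Longrightarrow> uword Ms \<ominus>\<^bsub>\<U>\<^esub> uword Ns \<in> word_span (length Ms)"
proof (induction Ms arbitrary: Ns)
  case Nil
  then show ?case using word_spanD(2) by (simp add: U.minus_self)
next
  case (Cons M Ms)
  have iN: "indecs Ns"
    using Cons.prems indecs_mset by blast
  have "M \<in> set Ns"
    using Cons.prems(2) by (metis list.set_intros(1) set_mset_mset)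
  then obtain as bs where Ns: "Ns = as @ M # bs"
    by (auto simp: in_set_conv_decomp)
  have m: "mset Ms = mset (as @ bs)"
    using Cons.prems(2) by (simp add: Ns)
  have l: "length Ns = Suc (length Ms)"
    using mset_eq_length[OF Cons.prems(2)] by simp
  have 1: "uword (M # Ms) \<ominus>\<^bsub>\<U>\<^esub> uword (M # as @ bs) \<in> word_span (Suc (length Ms))"
    by (rule uword_Cons_diff[OF Cons.IH[OF _ m]]) (use Cons.prems iN Ns in auto)
  have c: "uword Ns \<in> carrier \<U>" "uword (M # as @ bs) \<in> carrier \<U>" "uword (M # Ms) \<in> carrier \<U>"
    by (rule uword_closed; use Cons.prems iN Ns in simp)+
  have "uword (as @ M # bs) \<ominus>\<^bsub>\<U>\<^esub> uword (M # as @ bs) \<in> word_span (Suc (length Ms))"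
    using uword_move[of as M bs] iN l Ns by simp
  then have "\<ominus>\<^bsub>\<U>\<^esub> (uword Ns \<ominus>\<^bsub>\<U>\<^esub> uword (M # as @ bs)) \<in> word_span (Suc (length Ms))"
    using word_spanD(5) Ns by blast
  then have "uword (M # as @ bs) \<ominus>\<^bsub>\<U>\<^esub> uword Ns \<in> word_span (Suc (length Ms))"
    using c by (simp add: a_minus_def U.minus_add U.a_comm)
  from word_span_trans[OF 1 this] c show ?case by simp
qed

text \<open>
  A product of indecomposable classes vanishes at any sum of more indecomposable classes than factors.
\<close>

lemma hall_map_word_span_eval:
  assumes "u \<in> word_span k" "indecs Xs" "k \<le> length Xs"
  shows "hall_map u (sum_list Xs) = 0"
  using assms(1) unfolding word_span_def
proof (induction rule: U.Q_span_induct[OF _ word_span_gens, consumes 1, case_names zero add smult gen])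
  case zero
  then show ?case
    using Q_linear_zero[OF U.Q_space_axioms H.Q_space_axioms hall_map_linear] by simp
next
  case (add x y)
  then have "x \<in> carrier \<U>" "y \<in> carrier \<U>"
    using word_span_closed[of _ k] by (auto simp: word_span_def)
  then show ?case
    using Q_linear_add[OF hall_map_linear, of x y] add by simp
next
  case (smult c x)
  then have "x \<in> carrier \<U>"
    using word_span_closed[of _ k] by (auto simp: word_span_def)
  then show ?case
    using Q_linear_smult[OF hall_map_linear, of x c] smult by simp
next
  case (gen x)
  then obtain Ms where Ms: "x = uword Ms" "indecs Ms" "length Ms < k" by auto
  then have "\<not> mset Ms = mset Xs"
    using assms(3) by (auto dest: mset_eq_length)
  then show ?case
    using hall_word_nonzero_iff[of Ms Xs] Ms assms by (auto simp: hall_map_uword indecs_def)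
qed

definition list_of where "list_of m = (SOME Xs. mset Xs = m)"

lemma mset_list_of [simp]: "mset (list_of m) = m"
  unfolding list_of_def by (rule someI_ex) (rule ex_mset)

text \<open>
  Modulo shorter words, an element of the filtration is a combination of words of length \<open>k\<close>, one for
  each multiset of letters.
\<close>

lemma word_span_leading_terms:
  assumes "u \<in> word_span (Suc k)"
  shows "\<exists>F. finite {m. F m \<noteq> 0} \<and> (\<forall>m. F m \<noteq> 0 \<longrightarrow> indecs (list_of m) \<and> length (list_of m) = k) \<and>
    u \<ominus>\<^bsub>\<U>\<^esub> lincomb \<U> (\<lambda>m. uword (list_of m)) F \<in> word_span k"
  (is "\<exists>F. ?P F u")
  using assms unfolding word_span_def[of "Suc k"]
proof (induction rule: U.Q_span_induct[OF _ word_span_gens, consumes 1, case_names zero add smult gen])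
  case zero
  have "?P (\<lambda>_. 0) \<zero>\<^bsub>\<U>\<^esub>"
    using word_spanD(2) by (simp add: U.minus_self)
  then show ?case by (intro exI[of _ "\<lambda>_. 0"])
next
  case (add x y)
  then have c: "x \<in> carrier \<U>" "y \<in> carrier \<U>"
    using word_span_closed[of _ "Suc k"] by (auto simp: word_span_def)
  obtain F G where F: "?P F x" and G: "?P G y" using add by blast
  let ?v = "\<lambda>m. uword (list_of m)"
  have v: "?v \<in> {m. F m \<noteq> 0} \<rightarrow> carrier \<U>" "?v \<in> {m. G m \<noteq> 0} \<rightarrow> carrier \<U>"
    using F G by (auto intro: uword_closed)
  have "x \<oplus>\<^bsub>\<U>\<^esub> y \<ominus>\<^bsub>\<U>\<^esub> lincomb \<U> ?v (\<lambda>m. F m + G m) =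
      (x \<ominus>\<^bsub>\<U>\<^esub> lincomb \<U> ?v F) \<oplus>\<^bsub>\<U>\<^esub> (y \<ominus>\<^bsub>\<U>\<^esub> lincomb \<U> ?v G)"
    using F G v c by (simp add: U.lincomb_add U.add_minus_add U.lincomb_closed)
  then have "x \<oplus>\<^bsub>\<U>\<^esub> y \<ominus>\<^bsub>\<U>\<^esub> lincomb \<U> ?v (\<lambda>m. F m + G m) \<in> word_span k"
    using F G word_spanD(3) by simp
  moreover have "finite {m. F m + G m \<noteq> 0}"
    using F G finite_support_add by blast
  moreover have "F m \<noteq> 0 \<or> G m \<noteq> 0" if "F m + G m \<noteq> 0" for m
    using that by auto
  ultimately have "?P (\<lambda>m. F m + G m) (x \<oplus>\<^bsub>\<U>\<^esub> y)"
    using F G by blast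
  then show ?case by (intro exI[of _ "\<lambda>m. F m + G m"])
next
  case (smult c x)
  then have x: "x \<in> carrier \<U>"
    using word_span_closed[of _ "Suc k"] by (auto simp: word_span_def)
  obtain F where F: "?P F x" using smult by blast
  let ?v = "\<lambda>m. uword (list_of m)"
  have v: "?v \<in> {m. F m \<noteq> 0} \<rightarrow> carrier \<U>"
    using F by (auto intro: uword_closed)
  have "c \<odot>\<^bsub>\<U>\<^esub> x \<ominus>\<^bsub>\<U>\<^esub> lincomb \<U> ?v (\<lambda>m. c * F m) = c \<odot>\<^bsub>\<U>\<^esub> (x \<ominus>\<^bsub>\<U>\<^esub> lincomb \<U> ?v F)"
    using F v x by (simp add: U.lincomb_smult U.smult_minus U.lincomb_closed)
  then have "c \<odot>\<^bsub>\<U>\<^esub> x \<ominus>\<^bsub>\<U>\<^esub> lincomb \<U> ?v (\<lambda>m. c * F m) \<in> word_span k"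
    using F word_spanD(4) by simp
  moreover have "finite {m. c * F m \<noteq> 0}"
    using F finite_support_smult by blast
  ultimately have "?P (\<lambda>m. c * F m) (c \<odot>\<^bsub>\<U>\<^esub> x)"
    using F by simp
  then show ?case by (intro exI[of _ "\<lambda>m. c * F m"])
next
  case (gen x)
  then obtain Ms where Ms: "x = uword Ms" "indecs Ms" "length Ms \<le> k" by auto
  show ?case
  proof (cases "length Ms = k")
    case True
    have i: "indecs (list_of (mset Ms))" "length (list_of (mset Ms)) = k"
      using Ms True indecs_mset[of "list_of (mset Ms)" Ms] mset_eq_length[of "list_of (mset Ms)" Ms] by auto
    have "lincomb \<U> (\<lambda>m. uword (list_of m)) (delta (mset Ms)) = uword (list_of (mset Ms))"
      by (rule lincomb_delta[OF U.Q_space_axioms]) (rule uword_closed[OF i(1)])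
    then have "?P (delta (mset Ms)) x"
      using uword_mset[of Ms "list_of (mset Ms)"] Ms True i by (auto simp: delta_def)
    then show ?thesis by (intro exI[of _ "delta (mset Ms)"])
  next
    case False
    then have "uword Ms \<in> word_span k" using Ms by (intro uword_word_span) auto
    then have "?P (\<lambda>_. 0) x"
      using Ms uword_closed[OF Ms(2)] by (simp add: a_minus_def)
    then show ?thesis by (intro exI[of _ "\<lambda>_. 0"])
  qed
qed

text \<open>
  At the sum of the multiset \<open>m0\<close> the image of \<open>u\<close> is the coefficient at \<open>m0\<close> times a nonzero number: shorter
  words vanish there, and so do words of the same length with other letters.  If the image is zero,
  then so are all coefficients of words of length \<open>k\<close>.
\<close>

lemma hall_map_kernel_step:
  assumes u: "u \<in> word_span (Suc k)" and z: "hall_map u = (\<lambda>_. 0)"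
  shows "u \<in> word_span k"
proof -
  let ?v = "\<lambda>m. uword (list_of m)"
  obtain F where F: "finite {m. F m \<noteq> 0}" "\<And>m. F m \<noteq> 0 \<Longrightarrow> indecs (list_of m) \<and> length (list_of m) = k"
    and w: "u \<ominus>\<^bsub>\<U>\<^esub> lincomb \<U> ?v F \<in> word_span k"
    using word_span_leading_terms[OF u] by blast
  have v: "?v \<in> {m. F m \<noteq> 0} \<rightarrow> carrier \<U>"
    using F by (auto intro: uword_closed)
  have lc: "lincomb \<U> ?v F \<in> carrier \<U>"
    by (rule U.lincomb_closed[OF v])
  have hv: "(\<lambda>m. hall_map (?v m)) \<in> {m. F m \<noteq> 0} \<rightarrow> carrier \<H>"
    using v hall_map_closed by blast
  have "F m0 = 0" for m0
  proof (rule ccontr)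
    assume m0: "F m0 \<noteq> 0"
    define X where "X = sum_list (list_of m0)"
    have ev: "(\<lambda>f. f X) \<in> Q_linear \<H> QQ"
      by (rule Q_linearI) auto
    define c where "c = hall_map (?v m0) X"
    have c0: "c \<noteq> 0"
      using F(2)[OF m0] hall_word_nonzero_iff[of "list_of m0" "list_of m0"]
      by (simp add: c_def X_def hall_map_uword indecs_def)
    have QQs: "Q_space QQ" by (rule Q_space.intro[OF module_QQ])
    have "hall_map (u \<ominus>\<^bsub>\<U>\<^esub> lincomb \<U> ?v F) X = 0"
      unfolding X_def by (rule hall_map_word_span_eval[OF w]) (use F(2)[OF m0] in auto)
    moreover have "hall_map (u \<ominus>\<^bsub>\<U>\<^esub> lincomb \<U> ?v F) = hall_map u \<ominus>\<^bsub>\<H>\<^esub> hall_map (lincomb \<U> ?v F)"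
      by (rule Q_linear_minus(2)[OF U.Q_space_axioms H.Q_space_axioms hall_map_linear word_span_closed[OF u] lc])
    ultimately have "(hall_map u \<ominus>\<^bsub>\<H>\<^esub> hall_map (lincomb \<U> ?v F)) X = 0" by simp
    moreover have "(hall_map u \<ominus>\<^bsub>\<H>\<^esub> hall_map (lincomb \<U> ?v F)) X =
        hall_map u X \<ominus>\<^bsub>QQ\<^esub> hall_map (lincomb \<U> ?v F) X"
      by (rule Q_linear_minus(2)[OF H.Q_space_axioms QQs ev])
        (use hall_map_closed[OF word_span_closed[OF u]] hall_map_closed[OF lc] in auto)
    moreover have "a \<ominus>\<^bsub>QQ\<^esub> b = a - b" for a b :: rat
    proof -
      interpret q: Q_space QQ by (rule QQs)
      show ?thesis using q.smult_minus_one[of b] by (simp add: a_minus_def)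
    qed
    ultimately have "hall_map (lincomb \<U> ?v F) X = 0"
      by (simp add: z)
    moreover have "hall_map (lincomb \<U> ?v F) X = lincomb QQ (\<lambda>m. hall_map (?v m) X) F"
      using Q_linear_lincomb[OF U.Q_space_axioms H.Q_space_axioms hall_map_linear F(1) v]
        Q_linear_lincomb[OF H.Q_space_axioms QQs ev F(1) hv] by simp
    moreover have "lincomb QQ (\<lambda>m. hall_map (?v m) X) F = F m0 * c"
    proof (rule fun_space_linear_eqI[OF QQs lincomb_linear[OF QQs] _ F(1)])
      show "(\<lambda>F. F m0 * c) \<in> Q_linear fun_space QQ"
        by (rule Q_linearI) (auto simp: algebra_simps)
      fix m assume m: "F m \<noteq> 0"
      have "hall_map (?v m) X = delta m m0 * c"
        using F(2)[OF m] F(2)[OF m0] hall_word_nonzero_iff[of "list_of m" "list_of m0"]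
        by (cases "m = m0") (auto simp: c_def X_def hall_map_uword indecs_def delta_def)
      then show "lincomb QQ (\<lambda>m. hall_map (?v m) X) (delta m) = delta m m0 * c"
        using lincomb_delta[OF QQs, of "\<lambda>m. hall_map (?v m) X" m] by simp
    qed simp
    ultimately show False using m0 c0 by simp
  qed
  then have "lincomb \<U> ?v F = \<zero>\<^bsub>\<U>\<^esub>"
    by (simp add: lincomb_def)
  then show ?thesis
    using w word_span_closed[OF u] by (simp add: a_minus_def)
qed

lemma hall_map_kernel:
  assumes "u \<in> carrier \<U>" "hall_map u = (\<lambda>_. 0)"
  shows "u = \<zero>\<^bsub>\<U>\<^esub>"
proof -
  have "u \<in> word_span k \<Longrightarrow> u = \<zero>\<^bsub>\<U>\<^esub>" for k
  proof (induction k)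
    case 0
    then have "u \<in> Q_span \<U> {}" by (simp add: word_span_def)
    moreover have "Q_span \<U> {} \<subseteq> {\<zero>\<^bsub>\<U>\<^esub>}"
      by (rule U.Q_span_least, rule U.submoduleI) auto
    ultimately show ?case by blast
  next
    case (Suc k)
    then show ?case using hall_map_kernel_step[OF _ assms(2)] by blast
  qed
  then show ?thesis using U_in_word_span[OF assms(1)] by blast
qed

lemma hall_map_image_submodule: "submodule (hall_map ` carrier \<U>) QQ \<H>"
proof (rule H.submoduleI)
  show "\<zero>\<^bsub>\<H>\<^esub> \<in> hall_map ` carrier \<U>"
    using Q_linear_zero[OF U.Q_space_axioms H.Q_space_axioms hall_map_linear] by (metis U.zero_closed imageI)
  fix a b c assume "a \<in> hall_map ` carrier \<U>" "b \<in> hall_map ` carrier \<U>"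
  then obtain u v where u: "u \<in> carrier \<U>" "a = hall_map u" and v: "v \<in> carrier \<U>" "b = hall_map v"
    by blast
  show "a \<oplus>\<^bsub>\<H>\<^esub> b \<in> hall_map ` carrier \<U>"
    by (rule image_eqI[of _ _ "u \<oplus>\<^bsub>\<U>\<^esub> v"])
      (use u v in \<open>simp_all only: Q_linear_add[OF hall_map_linear] U.a_closed\<close>)
  show "c \<odot>\<^bsub>\<H>\<^esub> a \<in> hall_map ` carrier \<U>"
    by (rule image_eqI[of _ _ "c \<odot>\<^bsub>\<U>\<^esub> u"])
      (use u in \<open>simp_all only: Q_linear_smult[OF hall_map_linear] U.smult_closed\<close>)
next
  show "hall_map ` carrier \<U> \<subseteq> carrier \<H>"
    using hall_map_closed by blast
qed

text \<open>
  The product of the indecomposable summands of a class \<open>X\<close> is a nonzero multiple of \<open>delta X\<close> plus a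
  combination of classes with fewer indecomposable summands.  Induction on the number of summands
  gives that all delta functions are in the image.
\<close>

lemma delta_in_image:
  "indecs Xs \<Longrightarrow> delta (sum_list Xs) \<in> hall_map ` carrier \<U>"
proof (induction "length Xs" arbitrary: Xs rule: less_induct)
  case less
  let ?X = "sum_list Xs" and ?h = "hall_word Xs"
  note ID = H.submoduleD[OF hall_map_image_submodule]
  have h: "?h \<in> hall_map ` carrier \<U>"
    using hall_map_uword[OF less.prems] uword_closed[OF less.prems] by (metis imageI)
  then have hc: "?h \<in> carrier \<H>" using ID(1) by blast
  have nz: "?h ?X \<noteq> 0"
    using hall_word_nonzero_iff[of Xs Xs] less.prems by (simp add: indecs_def)
  \<comment> \<open>the terms of the product other than the leading one\<close>
  let ?r = "\<lambda>Y. if Y = ?X then 0 else ?h Y"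
  have "?r \<in> hall_map ` carrier \<U>"
  proof (rule submodule_support[OF hall_map_image_submodule])
    show "?r \<in> carrier \<H>"
      using hc by (auto elim: rev_finite_subset)
    fix Y assume Y: "?r Y \<noteq> 0"
    obtain Ys where Ys: "indecs Ys" "Y = sum_list Ys"
      using indec_decomposition[of Y] by (auto simp: indecs_def)
    have "length Ys < length Xs"
    proof (rule ccontr)
      assume "\<not> length Ys < length Xs"
      then have "mset Xs = mset Ys"
        using hall_word_nonzero_iff[of Xs Ys] Y Ys less.prems by (auto simp: indecs_def split: if_splits)
      then have "Y = ?X"
        using Ys(2) by (metis sum_mset_sum_list)
      then show False using Y by simp
    qed
    then show "delta Y \<in> hall_map ` carrier \<U>"
      using less.hyps Ys by blast
  qed
  then have "(1 / ?h ?X) \<odot>\<^bsub>\<H>\<^esub> (?h \<oplus>\<^bsub>\<H>\<^esub> (-1) \<odot>\<^bsub>\<H>\<^esub> ?r) \<in> hall_map ` carrier \<U>"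
    by (rule ID(4)[OF ID(3)[OF h ID(4)]])
  moreover have "(1 / ?h ?X) \<odot>\<^bsub>\<H>\<^esub> (?h \<oplus>\<^bsub>\<H>\<^esub> (-1) \<odot>\<^bsub>\<H>\<^esub> ?r) = delta ?X"
    using nz by (auto simp: delta_def fun_eq_iff)
  ultimately show ?case by simp
qed

lemma hall_map_bij: "bij_betw hall_map (carrier \<U>) (carrier \<H>)"
  unfolding bij_betw_def
proof
  show "inj_on hall_map (carrier \<U>)"
  proof (rule inj_onI)
    fix u v assume uv: "u \<in> carrier \<U>" "v \<in> carrier \<U>" "hall_map u = hall_map v"
    have "hall_map (u \<ominus>\<^bsub>\<U>\<^esub> v) = \<zero>\<^bsub>\<H>\<^esub>"
      using Q_linear_minus(2)[OF U.Q_space_axioms H.Q_space_axioms hall_map_linear uv(1,2)]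
        uv hall_map_closed by (simp add: H.minus_eq_zero_iff del: hall_simps)
    then have "u \<ominus>\<^bsub>\<U>\<^esub> v = \<zero>\<^bsub>\<U>\<^esub>"
      using hall_map_kernel[OF U.minus_closed[OF uv(1,2)]] by simp
    then show "u = v"
      using U.minus_eq_zero_iff uv by blast
  qed
  have "f \<in> hall_map ` carrier \<U>" if "f \<in> carrier \<H>" for f
  proof (rule submodule_support[OF hall_map_image_submodule that])
    fix X show "delta X \<in> hall_map ` carrier \<U>"
      using indec_decomposition[of X] delta_in_image by (auto simp: indecs_def)
  qed
  then show "hall_map ` carrier \<U> = carrier \<H>"
    using hall_map_closed by blast
qed

lemma comult_prim:
  assumes f: "f \<in> \<n>"
  shows "comult \<H> f = tens \<H> \<H> f \<one>\<^bsub>\<H>\<^esub> \<oplus>\<^bsub>tensor \<H> \<H>\<^esub> tens \<H> \<H> \<one>\<^bsub>\<H>\<^esub> f"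
proof -
  have fc: "finite {X. f X \<noteq> 0}" "prim f" using f by (auto simp: hall_lie_eq)
  let ?a = "\<lambda>p :: 'a isoclass \<times> 'a isoclass. f (fst p) * delta 0 (snd p)"
  let ?b = "\<lambda>p :: 'a isoclass \<times> 'a isoclass. delta 0 (fst p) * f (snd p)"
  have "comult \<H> f = pair_tensor (\<lambda>p. ?a p + ?b p)"
    using fc(2) by (simp add: comult_hall prim_def case_prod_unfold)
  also have "\<dots> = pair_tensor ?a \<oplus>\<^bsub>tensor \<H> \<H>\<^esub> pair_tensor ?b"
  proof -
    have "?a \<in> carrier fun_space" "?b \<in> carrier fun_space"
      unfolding fun_space_simps mem_Collect_eq
      by (rule finite_support_product(1); rule fc(1) finite_support_delta)+
    from Q_linear_add[OF pair_tensor_linear[OF fg] this] show ?thesis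
      unfolding fun_space_simps .
  qed
  also have "\<dots> = tens \<H> \<H> f \<one>\<^bsub>\<H>\<^esub> \<oplus>\<^bsub>tensor \<H> \<H>\<^esub> tens \<H> \<H> \<one>\<^bsub>\<H>\<^esub> f"
    by (simp only: pair_tensor_product[OF fg fc(1) finite_support_delta] pair_tensor_product[OF fg finite_support_delta fc(1)] hall_simps)
  finally show ?thesis .
qed

text \<open>
  Coproducts and counits on both sides are algebra homomorphisms, so their compatibility may be
  checked on the Lie algebra, which consists of primitive elements on both sides.
\<close>

lemma hall_map_bialg_iso: "hall_map \<in> bialg_iso \<U> \<H>"
  unfolding bialg_iso_def mem_Collect_eq
proof (intro conjI ballI hall_map_bij hall_map_linear hall_map_ring_hom)
  note B = bialgebraD[OF bialgebra_hall[OF fg]]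
  note sp = U.Q_space_axioms U.Q_space_axioms H.Q_space_axioms H.Q_space_axioms
  note tl = tensor_map_linear[OF sp hall_map_linear hall_map_linear]
    and tt = tensor_map_tens[OF sp hall_map_linear hall_map_linear]
    and th = tensor_map_ring_hom[OF U.is_algebra U.is_algebra H.is_algebra H.is_algebra
      hall_map_linear hall_map_ring_hom hall_map_linear hall_map_ring_hom]
  have hom_comp: "(\<lambda>x. g (f x)) \<in> ring_hom A C" if "f \<in> ring_hom A B" "g \<in> ring_hom B C"
    for f g and A :: "('x, 'xx) ring_scheme" and B :: "('y, 'yy) ring_scheme" and C :: "('z, 'zz) ring_scheme"
    using ring_hom_trans[OF that] by (simp add: o_def)
  fix u assume u: "u \<in> carrier \<U>"
  show "tensor_map \<H> \<H> hall_map hall_map (comult \<U> u) = comult \<H> (hall_map u)"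
  proof (rule L.enveloping_hom_eqI[OF Q_algebra_tensor[OF H.is_algebra H.is_algebra]
        Q_linear_comp[OF L.comult_enveloping_linear tl] hom_comp[OF L.comult_enveloping_ring_hom th]
        Q_linear_comp[OF hall_map_linear B(2)] hom_comp[OF hall_map_ring_hom B(4)] _ u])
    fix x assume x: "x \<in> carrier \<g>"
    note c = L.incl_closed[OF x] tens_closed[OF sp(1,2)]
    show "tensor_map \<H> \<H> hall_map hall_map (comult \<U> (hall_incl x)) = comult \<H> (hall_map (hall_incl x))"
      using x c by (simp add: L.comult_incl L.diag_def Q_linear_add[OF tl] tt hall_map_incl comult_prim
          ring_homE(2)[OF hall_map_ring_hom] del: hall_simps)
  qed
  show "counit \<H> (hall_map u) = counit \<U> u"
  proof (rule L.enveloping_hom_eqI[OF L.Q_algebra_QQ Q_linear_comp[OF hall_map_linear B(3)]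
        hom_comp[OF hall_map_ring_hom B(5)] L.counit_enveloping_linear L.counit_enveloping_ring_hom _ u])
    fix x assume x: "x \<in> carrier \<g>"
    then have "x \<in> \<n>" by simp
    moreover from this have "prim x" by (simp add: hall_lie_eq)
    ultimately show "counit \<H> (hall_map (hall_incl x)) = counit \<U> (hall_incl x)"
      by (simp add: hall_map_incl L.counit_incl[OF x] prim_zero)
  qed
qed

text \<open>
  The Hall algebra is known to be a bialgebra, which is transported to the enveloping algebra; the
  enveloping algebra has an antipode, which is transported back to the Hall algebra.
\<close>

lemma hall_enveloping:
  "hopf_algebra \<H> \<and> lie_subalgebra \<n> \<H> \<and> hopf_algebra \<U> \<and> (\<exists>\<phi>. \<phi> \<in> hopf_iso \<H> \<U>)"
proof -
  \<comment> \<open>the inverse of the canonical map\<close>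
  define \<phi> where "\<phi> = inv_into (carrier \<U>) hall_map"
  have inv: "\<phi> \<in> bialg_iso \<H> \<U>"
    unfolding \<phi>_def
    by (rule bialg_iso_inverse[OF U.is_algebra L.comult_enveloping_linear H.is_algebra hall_map_bialg_iso])
  interpret HU: bialg_isomorphism \<H> \<U> \<phi>
    by (intro bialg_isomorphism.intro bialgebra_hall[OF fg] U.is_algebra inv)
  interpret UH: bialg_isomorphism \<U> \<H> hall_map
    by (intro bialg_isomorphism.intro HU.bialgebra_target H.is_algebra hall_map_bialg_iso)
  show ?thesis
    unfolding hopf_algebra_def
    using bialgebra_hall[OF fg] UH.antipode_transport[OF L.antipode_enveloping] HU.bialgebra_target
      L.antipode_enveloping HU.hopf_isoI lie_subalgebra_hall by blast
qed

end

theorem theorem1: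
  assumes "finitely_generated TYPE('a::{semigroup_mult,mult_zero})"
  shows "let H = (hall :: ('a isoclass \<Rightarrow> rat) bialg);
             n = (hall_lie :: ('a isoclass \<Rightarrow> rat) set);
             U = enveloping (H\<lparr>carrier := n\<rparr>) (commutator H)
         in hopf_algebra H \<and> lie_subalgebra n H \<and> hopf_algebra U \<and>
            (\<exists>\<phi>. \<phi> \<in> hopf_iso H U)"
  using hall_enveloping[OF assms] by (simp only: Let_def)

end
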